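(* Let $G$ be a finite graph. Then $G$ is $3$-locally interval if and only if $G$ is wheel-free and $G$ contains none of the following graphs as an induced subgraph: the graphs obtained by adding an apex vertex to the long claw, to the whipping top, to $\dagger_k$ for some $k \geq 2$, or to $\ddagger_n$ for some $n \geq 3$.
   Context: For a graph $G$ and a vertex $v$, the ball $B_G(v, 3/2)$ is the subgraph of $G$ with vertex set consisting of $v$ and its neighbours, and edge set consisting of the edges $xy$ of $G$ with $d(v,x) + d(v,y) < 3$ (i.e. all edges among these vertices). A graph is an interval graph if there is a path $P$ and a map $v \mapsto P_v$ assigning to each vertex a subpath of $P$ such that $uv$ is an edge if and only if $P_u$ and $P_v$ share a vertex. $G$ is $3$-locally interval if every ball $B_G(v, 3/2)$ is an interval graph. A wheel $W_n$ ($n \geq 4$) is a cycle of length $n$ plus a vertex adjacent to all its vertices; $G$ is wheel-free if it contains no wheel $W_n$, $n\ge 4$, as an induced subgraph. Adding an apex vertex to a graph $F$ means adding a new vertex adjacent to every vertex of $F$. The named graphs: The long claw has vertices $c, a_1, a_2, a_3, b_1, b_2, b_3$ and edges $ca_i$, $a_ib_i$ ($i=1,2,3$). The whipping top consists of a path $x_1x_2x_3x_4x_5$, a vertex $y$ adjacent to all of $x_1,\dots,x_5$, and a vertex $z$ adjacent only to $x_3$. For $k \geq 2$, $\dagger_k$ consists of a path $v_1 \dots v_k$, a vertex $c$ adjacent to all $v_i$, and three further vertices $p, q, s$ with $p$ adjacent only to $v_1$, $q$ adjacent only to $v_k$, and $s$ adjacent only to $c$. For $n \geq 3$, $\ddagger_n$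 consists of a path $x_1 \dots x_n$, a vertex $u$ adjacent to $x_1, \dots, x_{n-1}$, a vertex $v$ adjacent to $x_2, \dots, x_n$, the edge $uv$, and a vertex $w$ adjacent only to $u$ and $v$. *)

theory Defs
  imports "Graph_Theory.Graph_Theory"
begin

text \<open>
  Graphs are values of type \<^typ>\<open>'a pair_pre_digraph\<close>; a finite simple graph is one satisfying
  \<^const>\<open>pair_graph\<close> (finite, symmetric, loop-free), an edge \<open>xy\<close> being the pair of arcs
  \<open>(x, y)\<close>, \<open>(y, x)\<close>.
\<close>

definition undirected :: "'a set \<Rightarrow> 'a rel \<Rightarrow> 'a pair_pre_digraph" where
  "undirected V E = \<lparr> pverts = V, parcs = E \<union> E\<inverse> \<rparr>"

definition has_induced :: "'a pair_pre_digraph \<Rightarrow> 'b pair_pre_digraph \<Rightarrow> bool" where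
  "has_induced G F \<longleftrightarrow>
     (\<exists>H :: 'a pair_pre_digraph.
        induced_subgraph (with_proj H) (with_proj G) \<and> digraph_iso (with_proj F) (with_proj H))"


subsection \<open>Interval graphs\<close>

definition path_graph :: "nat \<Rightarrow> nat pair_pre_digraph" where
  "path_graph n = undirected {1..n} {(i, Suc i) |i. 1 \<le> i \<and> i < n}"

definition is_path :: "'a pair_pre_digraph \<Rightarrow> bool" where
  "is_path P \<longleftrightarrow> (\<exists>n\<ge>1. digraph_iso (with_proj (path_graph n)) (with_proj P))"

text \<open>
  Every finite path has an isomorphic copy with vertices in \<^typ>\<open>nat\<close>, so fixing the vertex type of
  the host path \<open>P\<close> loses nothing. Paths, hence subpaths, have at least one vertex.
\<close>

definition interval_graph :: "'a pair_pre_digraph \<Rightarrow> bool" where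
  "interval_graph G \<longleftrightarrow>
     (\<exists>(P :: nat pair_pre_digraph) (S :: 'a \<Rightarrow> nat pair_pre_digraph).
        is_path P \<and>
        (\<forall>v \<in> pverts G. is_path (S v) \<and> subgraph (with_proj (S v)) (with_proj P)) \<and>
        (\<forall>u \<in> pverts G. \<forall>v \<in> pverts G. u \<noteq> v \<longrightarrow>
           ((u, v) \<in> parcs G \<longleftrightarrow> pverts (S u) \<inter> pverts (S v) \<noteq> {})))"


subsection \<open>Balls of radius 3/2\<close>

definition graph_dist :: "'a pair_pre_digraph \<Rightarrow> 'a \<Rightarrow> 'a \<Rightarrow> ereal" where
  "graph_dist G = wf_digraph.\<mu> (with_proj G) (\<lambda>_. 1)"

definition ball_three_halves :: "'a pair_pre_digraph \<Rightarrow> 'a \<Rightarrow> 'a pair_pre_digraph" where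
  "ball_three_halves G v =
     \<lparr> pverts = insert v {x. (v, x) \<in> parcs G},
       parcs = {(x, y). (x, y) \<in> parcs G \<and> graph_dist G v x + graph_dist G v y < 3} \<rparr>"

definition three_locally_interval :: "'a pair_pre_digraph \<Rightarrow> bool" where
  "three_locally_interval G \<longleftrightarrow> (\<forall>v \<in> pverts G. interval_graph (ball_three_halves G v))"


subsection \<open>Apex vertices and wheels\<close>

text \<open>The apex is \<^term>\<open>None\<close>; the vertices of \<open>F\<close> are embedded by \<^term>\<open>Some\<close>.\<close>

definition add_apex :: "'a pair_pre_digraph \<Rightarrow> 'a option pair_pre_digraph" where
  "add_apex F =
     undirected (insert None (Some ` pverts F))
       (map_prod Some Some ` parcs F \<union> {None} \<times> Some ` pverts F)"

definition cycle_graph :: "nat \<Rightarrow> nat pair_pre_digraph" where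
  "cycle_graph n = undirected {..<n} {(i, Suc i mod n) |i. i < n}"

definition wheel :: "nat \<Rightarrow> nat option pair_pre_digraph" where
  "wheel n = add_apex (cycle_graph n)"

definition wheel_free :: "'a pair_pre_digraph \<Rightarrow> bool" where
  "wheel_free G \<longleftrightarrow> (\<forall>n\<ge>4. \<not> has_induced G (wheel n))"


subsection \<open>The long claw, the whipping top, and the two dagger families\<close>

datatype long_claw_vertex = LC_c | LC_a nat | LC_b nat

definition long_claw :: "long_claw_vertex pair_pre_digraph" where
  "long_claw =
     undirected ({LC_c} \<union> LC_a ` {1..3} \<union> LC_b ` {1..3})
       ({(LC_c, LC_a i) |i. i \<in> {1..3}} \<union> {(LC_a i, LC_b i) |i. i \<in> {1..3}})"

datatype whipping_top_vertex = WT_x nat | WT_y | WT_z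

definition whipping_top :: "whipping_top_vertex pair_pre_digraph" where
  "whipping_top =
     undirected (WT_x ` {1..5} \<union> {WT_y, WT_z})
       ({(WT_x i, WT_x (Suc i)) |i. 1 \<le> i \<and> i < 5} \<union> {(WT_y, WT_x i) |i. i \<in> {1..5}}
        \<union> {(WT_z, WT_x 3)})"

datatype dagger_vertex = Dag_v nat | Dag_c | Dag_p | Dag_q | Dag_s

definition dagger :: "nat \<Rightarrow> dagger_vertex pair_pre_digraph" where
  "dagger k =
     undirected (Dag_v ` {1..k} \<union> {Dag_c, Dag_p, Dag_q, Dag_s})
       ({(Dag_v i, Dag_v (Suc i)) |i. 1 \<le> i \<and> i < k} \<union> {(Dag_c, Dag_v i) |i. i \<in> {1..k}}
        \<union> {(Dag_p, Dag_v 1), (Dag_q, Dag_v k), (Dag_s, Dag_c)})"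

datatype ddagger_vertex = DDag_x nat | DDag_u | DDag_v | DDag_w

definition ddagger :: "nat \<Rightarrow> ddagger_vertex pair_pre_digraph" where
  "ddagger n =
     undirected (DDag_x ` {1..n} \<union> {DDag_u, DDag_v, DDag_w})
       ({(DDag_x i, DDag_x (Suc i)) |i. 1 \<le> i \<and> i < n}
        \<union> {(DDag_u, DDag_x i) |i. 1 \<le> i \<and> i \<le> n - 1} \<union> {(DDag_v, DDag_x i) |i. 2 \<le> i \<and> i \<le> n}
        \<union> {(DDag_u, DDag_v), (DDag_w, DDag_u), (DDag_w, DDag_v)})"

end

theory Submission
  imports Defs
begin

text \<open>
  A ball of radius 3/2 is the neighbourhood of its centre together with a universal vertex, so the
  statement reduces to the theorem of Lekkerkerker and Boland for the neighbourhoods.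

  A smallest chordal non-interval graph has an asteroidal triple. Given nonadjacent vertices \<open>u\<close>,
  \<open>v\<close>, let \<open>X\<close> be the clique of neighbours of the component of \<open>v\<close> in \<open>G - N[u]\<close>. For
  every component \<open>F\<close> of \<open>G - X\<close>, representing \<open>G[F \<union> X \<union> {d}]\<close> for a vertex \<open>d\<close>
  outside \<open>F\<close> complete to \<open>X\<close> puts \<open>X\<close> at one end of \<open>F\<close>. Components can be stacked when the attachment
  of the outer one is complete to the inner one; three pairwise unstackable components give an
  asteroidal triple, so two stacks suffice and glue to a representation of \<open>G\<close>. The only
  obstacle is that \<open>G[F \<union> X \<union> {d}]\<close> is all of \<open>G\<close>, and then \<open>u\<close> or \<open>v\<close> is a simplicial
  vertex \<open>d\<close> with \<open>G - N[d]\<close> connected. Such vertices are pairwise nonadjacent, and three of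
  them are an asteroidal triple, so deleting two vertices leaves a clique.

  In a chordal graph that is minimal with an asteroidal triple \<open>a\<close>, \<open>b\<close>, \<open>c\<close>, the three
  neighbourhoods are cliques. If \<open>c\<close> shares neighbours with both \<open>a\<close> and \<open>b\<close>, a path from
  \<open>a\<close> to \<open>b\<close> avoiding \<open>N[c]\<close> yields \<open>\<ddagger>\<close>. Otherwise minimality forces a neighbour \<open>\<alpha>\<close> of \<open>a\<close> to
  be adjacent to a vertex of each path from \<open>b\<close> to \<open>c\<close> avoiding \<open>N[a]\<close>; two or more
  such vertices give \<open>\<dagger>\<close>, a single one in the middle of the path gives the long claw, and the
  remaining configurations give the whipping top or an induced four-cycle.
\<close>

text \<open>Dilworth's theorem for width two, by Galvin's induction on a maximal element.\<close>

lemma two_chains: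
  fixes R :: "'b \<Rightarrow> 'b \<Rightarrow> bool"
  assumes "finite S"
    and refl: "\<And>x. R x x" and trans: "\<And>x y z. R x y \<Longrightarrow> R y z \<Longrightarrow> y \<in> S \<Longrightarrow> R x z"
    and width: "\<And>x y z. \<lbrakk>x \<in> S; y \<in> S; z \<in> S; \<not> R x y; \<not> R y x; \<not> R x z; \<not> R z x; \<not> R y z; \<not> R z y\<rbrakk> \<Longrightarrow> False"
  shows "\<exists>A B. S = A \<union> B \<and> A \<inter> B = {} \<and> (\<forall>x\<in>A. \<forall>y\<in>A. R x y \<or> R y x) \<and> (\<forall>x\<in>B. \<forall>y\<in>B. R x y \<or> R y x)"
  using assms
proof (induction "card S" arbitrary: S)
  case 0
  then show ?case by auto
next
  case (Suc n)
  note trans = Suc.prems(3) and width = Suc.prems(4)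
  \<comment> \<open>\<open>R\<close> is only a preorder, so maximality of \<open>m\<close> means
    that whatever lies above \<open>m\<close> also lies below it.\<close>
  have top: "\<exists>m\<in>T. \<forall>x\<in>T. R m x \<longrightarrow> R x m" if "finite T" "T \<noteq> {}" "T \<subseteq> S" for T
    using that
  proof (induction T rule: finite_ne_induct)
    case (insert t T)
    then obtain m where m: "m \<in> T" "\<forall>x\<in>T. R m x \<longrightarrow> R x m" by blast
    show ?case
    proof (cases "R m t")
      case True
      have "R x t" if "x \<in> T" "R t x" for x
      proof -
        have "R m x" using trans[OF True \<open>R t x\<close>] insert.prems by blast
        then have "R x m" using m(2) that by blast
        then show ?thesis using trans[OF _ True, of x] m(1) insert.prems by blast
      qed
      then show ?thesis using refl by blast
    next
      case False
      then show ?thesis using m by auto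
    qed
  qed (auto simp: refl)
  have "S \<noteq> {}" using Suc.hyps(2) by auto
  then obtain m where m: "m \<in> S" "\<And>x. x \<in> S \<Longrightarrow> R m x \<Longrightarrow> R x m"
    using top[of S] Suc.prems(1) by blast
  let ?S = "S - {m}"
  have "\<exists>A B. ?S = A \<union> B \<and> A \<inter> B = {} \<and> (\<forall>x\<in>A. \<forall>y\<in>A. R x y \<or> R y x) \<and> (\<forall>x\<in>B. \<forall>y\<in>B. R x y \<or> R y x)"
  proof (rule Suc.hyps(1))
    show "n = card (S - {m})" using Suc.hyps(2) Suc.prems(1) m(1) by simp
    show "finite (S - {m})" using Suc.prems(1) by simp
    show "R x x" for x by (rule Suc.prems)
    show "R x z" if "R x y" "R y z" "y \<in> S - {m}" for x y z using trans[OF that(1,2)] that(3) by blast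
    show False if "x \<in> S - {m}" "y \<in> S - {m}" "z \<in> S - {m}" "\<not> R x y" "\<not> R y x" "\<not> R x z" "\<not> R z x" "\<not> R y z" "\<not> R z y" for x y z
      using width[of x y z] that by blast
  qed
  then obtain A B where AB: "?S = A \<union> B" "A \<inter> B = {}"
      "\<And>x y. x \<in> A \<Longrightarrow> y \<in> A \<Longrightarrow> R x y \<or> R y x" "\<And>x y. x \<in> B \<Longrightarrow> y \<in> B \<Longrightarrow> R x y \<or> R y x"
    by metis
  have chain_top: "\<exists>a\<in>T. \<forall>x\<in>T. R x a"
    if T: "T \<subseteq> S" "T \<noteq> {}" "\<And>x y. x \<in> T \<Longrightarrow> y \<in> T \<Longrightarrow> R x y \<or> R y x" for T
    using top[of T] T Suc.prems(1) by (meson finite_subset)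
  \<comment> \<open>\<open>a\<close> lies above every element of \<open>A\<close> that is
    incomparable to something in \<open>B\<close>. By maximality \<open>m\<close> lies above
    \<open>a\<close>, so \<open>m\<close> and the part of \<open>A\<close> below \<open>a\<close>
    form one chain. The rest of \<open>A\<close> is comparable to all of \<open>B\<close> and forms
    the other chain with it.\<close>
  have split: "\<exists>K. m \<in> K \<and> K \<subseteq> S \<and> (\<forall>x\<in>K. \<forall>y\<in>K. R x y \<or> R y x) \<and> (\<forall>x\<in>S - K. \<forall>y\<in>S - K. R x y \<or> R y x)"
    if AB: "?S = A \<union> B" "A \<inter> B = {}"
      "\<And>x y. x \<in> A \<Longrightarrow> y \<in> A \<Longrightarrow> R x y \<or> R y x" "\<And>x y. x \<in> B \<Longrightarrow> y \<in> B \<Longrightarrow> R x y \<or> R y x"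
      and a: "a \<in> A" "\<And>x y. x \<in> A \<Longrightarrow> y \<in> B \<Longrightarrow> \<not> R x y \<Longrightarrow> \<not> R y x \<Longrightarrow> R x a" and cmp: "R a m \<or> R m a"
    for A B a
  proof -
    have am: "R a m" using cmp m a AB(1) by auto
    have aS: "a \<in> S" "m \<notin> A" "m \<notin> B" "A \<subseteq> S" "B \<subseteq> S" "S \<subseteq> insert m (A \<union> B)" using a AB(1) by auto
    show ?thesis
    proof (rule exI[of _ "insert m {x \<in> A. R x a}"], intro conjI ballI)
      fix x y assume "x \<in> insert m {x \<in> A. R x a}" "y \<in> insert m {x \<in> A. R x a}"
      moreover have "R z m" if "R z a" for z using trans[OF that am] aS by blast
      ultimately show "R x y \<or> R y x" using AB(3)[of x y] refl by auto
    next
      fix x y assume "x \<in> S - insert m {x \<in> A. R x a}" "y \<in> S - insert m {x \<in> A. R x a}"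
      then have "x \<in> A \<and> \<not> R x a \<or> x \<in> B" "y \<in> A \<and> \<not> R y a \<or> y \<in> B" using aS by auto
      then show "R x y \<or> R y x" using a(2)[of x y] a(2)[of y x] AB(3,4)[of x y] by blast
    qed (use m(1) aS in auto)
  qed
  have "\<exists>K. m \<in> K \<and> K \<subseteq> S \<and> (\<forall>x\<in>K. \<forall>y\<in>K. R x y \<or> R y x) \<and> (\<forall>x\<in>S - K. \<forall>y\<in>S - K. R x y \<or> R y x)"
  proof (cases "\<forall>x\<in>?S. \<forall>y\<in>?S. R x y \<or> R y x")
    case True
    then show ?thesis using m(1) refl[of m] by (intro exI[of _ "{m}"] conjI) simp_all
  next
    case False
    define A0 where "A0 = {x\<in>A. \<exists>y\<in>B. \<not> R x y \<and> \<not> R y x}"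
    define B0 where "B0 = {y\<in>B. \<exists>x\<in>A. \<not> R x y \<and> \<not> R y x}"
    obtain p q where pq: "p \<in> ?S" "q \<in> ?S" "\<not> R p q" "\<not> R q p" using False by blast
    then have "p \<in> A \<and> q \<in> B \<or> p \<in> B \<and> q \<in> A" using AB(1) AB(3,4)[of p q] by blast
    then have ne: "A0 \<noteq> {}" "B0 \<noteq> {}" using pq(3,4) unfolding A0_def B0_def by blast+
    have sub: "A \<subseteq> S" "B \<subseteq> S" using AB(1) by auto
    obtain a where a: "a \<in> A0" "\<forall>x\<in>A0. R x a"
      using chain_top[of A0] ne AB(3) sub unfolding A0_def by blast
    obtain b where b: "b \<in> B0" "\<forall>x\<in>B0. R x b"
      using chain_top[of B0] ne AB(4) sub unfolding B0_def by blast
    have aA: "a \<in> A" and bB: "b \<in> B" using a b unfolding A0_def B0_def by auto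
    obtain y where y: "y \<in> B" "\<not> R a y" "\<not> R y a" using a unfolding A0_def by auto
    obtain x where x: "x \<in> A" "\<not> R b x" "\<not> R x b" using b unfolding B0_def by auto
    have "R y b" using b(2) y aA unfolding B0_def by blast
    moreover have "R x a" using a(2) x bB unfolding A0_def by blast
    \<comment> \<open>\<open>R a b\<close> would put \<open>x\<close> below \<open>b\<close> through
      \<open>a\<close>, although \<open>x\<close> and \<open>b\<close> are incomparable; likewise
      \<open>R b a\<close> with \<open>y\<close>. By width, \<open>m\<close> is then comparable to
      \<open>a\<close> or to \<open>b\<close>, as \<open>split\<close> demands.\<close>
    ultimately have inc: "\<not> R a b" "\<not> R b a"
      using trans[of x a b] trans[of y b a] x y sub aA bB by blast+
    have "(R a m \<or> R m a) \<or> (R b m \<or> R m b)" using width[of a b m] inc sub aA bB m(1) by blast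
    then show ?thesis
    proof
      assume c: "R a m \<or> R m a"
      have "R x a" if "x \<in> A" "y \<in> B" "\<not> R x y" "\<not> R y x" for x y
        using a(2) that unfolding A0_def by blast
      from split[OF AB(1,2) AB(3,4) aA this c] show ?thesis .
    next
      assume c: "R b m \<or> R m b"
      have BA: "?S = B \<union> A" "B \<inter> A = {}" using AB(1,2) by blast+
      have "R x b" if "x \<in> B" "y \<in> A" "\<not> R x y" "\<not> R y x" for x y
        using b(2) that unfolding B0_def by blast
      from split[OF BA AB(4,3) bB this c] show ?thesis .
    qed
  qed
  then obtain K where K: "m \<in> K" "K \<subseteq> S" "\<forall>x\<in>K. \<forall>y\<in>K. R x y \<or> R y x" "\<forall>x\<in>S - K. \<forall>y\<in>S - K. R x y \<or> R y x"
    by (elim exE conjE)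
  have "S = K \<union> (S - K)" "K \<inter> (S - K) = {}" using K(2) by auto
  then show ?case using K(3,4) by (intro exI[of _ K] exI[of _ "S - K"] conjI) assumption+
qed

section \<open>Simple graphs as adjacency relations, with vertex sets standing for induced
  subgraphs\<close>

locale sgraph =
  fixes adj :: "'a \<Rightarrow> 'a \<Rightarrow> bool"
  assumes sym: "adj x y \<Longrightarrow> adj y x" and irrefl: "\<not> adj x x"
begin

lemma commute: "adj x y \<longleftrightarrow> adj y x"
  using sym by blast

definition cnb :: "'a \<Rightarrow> 'a set" where
  "cnb v = {u. u = v \<or> adj v u}"

definition clique :: "'a set \<Rightarrow> bool" where
  "clique W \<longleftrightarrow> (\<forall>x\<in>W. \<forall>y\<in>W. x \<noteq> y \<longrightarrow> adj x y)"

text \<open>Connection by a walk inside \<open>W\<close>. The closure constrains only the vertices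
  reached after a step, hence the explicit \<open>u \<in> W\<close>.\<close>

definition joined :: "'a set \<Rightarrow> 'a \<Rightarrow> 'a \<Rightarrow> bool" where
  "joined W u v \<longleftrightarrow> u \<in> W \<and> (\<lambda>x y. adj x y \<and> y \<in> W)\<^sup>*\<^sup>* u v"

definition comp :: "'a set \<Rightarrow> 'a \<Rightarrow> 'a set" where
  "comp W u = {v. joined W u v}"

text \<open>Distinctness and nonadjacency of the three vertices come for free: the ends of each walk
  lie outside the closed neighbourhood that it avoids, see \<open>asteroidal_nonadj\<close>.\<close>

definition asteroidal :: "'a set \<Rightarrow> 'a \<Rightarrow> 'a \<Rightarrow> 'a \<Rightarrow> bool" where
  "asteroidal W a b c \<longleftrightarrow> a \<in> W \<and> b \<in> W \<and> c \<in> W \<and>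
     joined (W - cnb a) b c \<and> joined (W - cnb b) a c \<and> joined (W - cnb c) a b"

text \<open>Closed integer intervals, which can be translated and reflected freely;
  \<open>interval_graph_iff\<close> goes back to subpaths of a path.\<close>

definition is_rep :: "'a set \<Rightarrow> ('a \<Rightarrow> int) \<Rightarrow> ('a \<Rightarrow> int) \<Rightarrow> bool" where
  "is_rep W l r \<longleftrightarrow> (\<forall>v\<in>W. l v \<le> r v) \<and>
     (\<forall>u\<in>W. \<forall>v\<in>W. u \<noteq> v \<longrightarrow> (adj u v \<longleftrightarrow> l u \<le> r v \<and> l v \<le> r u))"

definition interval :: "'a set \<Rightarrow> bool" where
  "interval W \<longleftrightarrow> (\<exists>l r. is_rep W l r)"

text \<open>Induced paths as vertex lists. For a single vertex the quantifier is vacuous, so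
  \<open>hd []\<close> does no harm.\<close>

fun ipath :: "'a list \<Rightarrow> bool" where
  "ipath [] \<longleftrightarrow> True"
| "ipath (x # xs) \<longleftrightarrow> ipath xs \<and> x \<notin> set xs \<and> (\<forall>y\<in>set xs. adj x y \<longleftrightarrow> y = hd xs)"

text \<open>Chordality in the form in which it is used; \<open>chordal_of_no_cycle\<close> relates it to induced cycles.\<close>

definition chordal :: "'a set \<Rightarrow> bool" where
  "chordal W \<longleftrightarrow> (\<forall>xs u. ipath xs \<and> set xs \<subseteq> W \<and> xs \<noteq> [] \<and> u \<in> W \<and> u \<notin> set xs \<and>
     adj u (hd xs) \<and> adj u (last xs) \<longrightarrow> (\<forall>x\<in>set xs. adj u x))"

subsection \<open>Connectivity\<close>

lemma cnb_iff: "u \<in> cnb v \<longleftrightarrow> u = v \<or> adj v u"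
  by (simp add: cnb_def)

lemma cnb_commute: "u \<in> cnb v \<longleftrightarrow> v \<in> cnb u"
  by (auto simp: cnb_iff intro: sym)

lemma joined_refl: "u \<in> W \<Longrightarrow> joined W u u"
  by (simp add: joined_def)

lemma joined_step: "joined W u v \<Longrightarrow> adj v w \<Longrightarrow> w \<in> W \<Longrightarrow> joined W u w"
  by (auto simp: joined_def intro: rtranclp.rtrancl_into_rtrancl)

lemma joined_induct [consumes 1, case_names refl step]:
  assumes "joined W u v" and "u \<in> W \<Longrightarrow> P u"
    and "\<And>x y. joined W u x \<Longrightarrow> x \<in> W \<Longrightarrow> P x \<Longrightarrow> adj x y \<Longrightarrow> y \<in> W \<Longrightarrow> P y"
  shows "P v"
proof -
  have uW: "u \<in> W" using assms(1) by (simp add: joined_def)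
  have "(\<lambda>x y. adj x y \<and> y \<in> W)\<^sup>*\<^sup>* u v" using assms(1) by (simp add: joined_def)
  then have "P v \<and> joined W u v \<and> v \<in> W"
    by (induction rule: rtranclp_induct) (use uW assms(2,3) joined_refl joined_step in blast)+
  then show ?thesis by blast
qed

lemma joined_mem: "joined W u v \<Longrightarrow> u \<in> W \<and> v \<in> W"
  by (rule conjI, simp add: joined_def, induction rule: joined_induct)

lemma joined_trans: "joined W u v \<Longrightarrow> joined W v w \<Longrightarrow> joined W u w"
  by (auto simp: joined_def)

lemma joined_edge: "u \<in> W \<Longrightarrow> v \<in> W \<Longrightarrow> adj u v \<Longrightarrow> joined W u v"
  by (meson joined_refl joined_step)

lemma joined_sym: "joined W u v \<Longrightarrow> joined W v u"
proof (induction rule: joined_induct)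
  case (step x y)
  then show ?case by (meson joined_edge joined_trans sym)
qed (rule joined_refl)

lemma joined_mono: "joined W u v \<Longrightarrow> W \<subseteq> W' \<Longrightarrow> joined W' u v"
  by (induction rule: joined_induct) (auto intro: joined_refl joined_step)

lemma comp_sub: "comp W u \<subseteq> W"
  using joined_mem by (auto simp: comp_def)

lemma comp_step: "x \<in> comp W u \<Longrightarrow> adj x y \<Longrightarrow> y \<in> W \<Longrightarrow> y \<in> comp W u"
  by (auto simp: comp_def intro: joined_step)

lemma comp_self: "u \<in> W \<Longrightarrow> u \<in> comp W u"
  by (simp add: comp_def joined_refl)

lemma comp_eq: "v \<in> comp W u \<Longrightarrow> comp W v = comp W u"
  unfolding comp_def using joined_trans joined_sym[of W u v] by blast

lemma comp_joined: assumes "x \<in> comp W u" "y \<in> comp W u" shows "joined (comp W u) x y"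
proof -
  have "joined W x y" using assms joined_trans[OF joined_sym[of W u x]] by (auto simp: comp_def)
  then have "joined (comp W u) x y \<and> y \<in> comp W u"
  proof (induction rule: joined_induct)
    case refl
    then show ?case using assms(1) joined_refl by blast
  next
    case (step z y)
    then show ?case using comp_step[of z W u y] joined_step[of "comp W u" x z y] by blast
  qed
  then show ?thesis ..
qed

lemma asteroidal_swap1: "asteroidal W a b c \<Longrightarrow> asteroidal W b a c"
  unfolding asteroidal_def by (elim conjE, intro conjI) (assumption | erule joined_sym)+

lemma asteroidal_swap2: "asteroidal W a b c \<Longrightarrow> asteroidal W a c b"
  unfolding asteroidal_def by (elim conjE, intro conjI) (assumption | erule joined_sym)+

lemma asteroidal_mono: "asteroidal W a b c \<Longrightarrow> W \<subseteq> W' \<Longrightarrow> asteroidal W' a b c"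
  unfolding asteroidal_def by (meson Diff_mono joined_mono subsetD subset_refl)

lemma chordal_mono: "chordal W \<Longrightarrow> W' \<subseteq> W \<Longrightarrow> chordal W'"
  unfolding chordal_def by (meson subset_trans subsetD)

lemma chordalD:
  assumes "chordal W" "ipath xs" "set xs \<subseteq> W" "u \<in> W" "u \<notin> set xs" "adj u (hd xs)" "adj u (last xs)" "x \<in> set xs"
  shows "adj u x"
  using assms unfolding chordal_def by (metis empty_iff list.set(1))

subsection \<open>Induced paths\<close>

lemma ipath_drop: "ipath xs \<Longrightarrow> ipath (drop n xs)"
proof (induction xs arbitrary: n)
  case (Cons x xs)
  then show ?case by (cases n) auto
qed simp

lemma ipath_distinct: "ipath xs \<Longrightarrow> distinct xs"
  by (induction xs) auto

text \<open>The index form, from which cutting a path at its end and reading off adjacency at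
  arbitrary positions are immediate.\<close>

lemma ipath_iff_nth:
  "ipath xs \<longleftrightarrow> distinct xs \<and> (\<forall>i j. i < j \<and> j < length xs \<longrightarrow> (adj (xs ! i) (xs ! j) \<longleftrightarrow> j = Suc i))"
proof (induction xs)
  case (Cons x xs)
  show ?case
  proof
    assume A: "ipath (x # xs)"
    show "distinct (x # xs) \<and> (\<forall>i j. i < j \<and> j < length (x # xs) \<longrightarrow> (adj ((x # xs) ! i) ((x # xs) ! j) \<longleftrightarrow> j = Suc i))"
    proof (intro conjI allI impI)
      show "distinct (x # xs)" using A by (rule ipath_distinct)
      fix i j assume ij: "i < j \<and> j < length (x # xs)"
      then obtain j' where j: "j = Suc j'" by (cases j) auto
      have xs: "xs \<noteq> []" using ij j by auto
      have d: "distinct xs" using A ipath_distinct by auto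
      show "adj ((x # xs) ! i) ((x # xs) ! j) \<longleftrightarrow> j = Suc i"
      proof (cases i)
        case 0
        then show ?thesis using A ij j xs d nth_eq_iff_index_eq[OF d, of j' 0] by (auto simp: hd_conv_nth)
      next
        case (Suc i')
        then show ?thesis using A Cons ij j by auto
      qed
    qed
  next
    assume A: "distinct (x # xs) \<and> (\<forall>i j. i < j \<and> j < length (x # xs) \<longrightarrow> (adj ((x # xs) ! i) ((x # xs) ! j) \<longleftrightarrow> j = Suc i))"
    then have B: "adj ((x # xs) ! i) ((x # xs) ! j) \<longleftrightarrow> j = Suc i" if "i < j" "j < length (x # xs)" for i j
      using that by blast
    have "ipath xs" unfolding Cons using A B[of "Suc _" "Suc _"] by auto
    moreover have "adj x y \<longleftrightarrow> y = hd xs" if "y \<in> set xs" for y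
    proof -
      obtain j where j: "j < length xs" "y = xs ! j" using \<open>y \<in> set xs\<close> by (metis in_set_conv_nth)
      then have "adj x y \<longleftrightarrow> j = 0" using B[of 0 "Suc j"] by auto
      moreover have "hd xs = xs ! 0" using j(1) by (cases xs) simp_all
      moreover have "distinct xs" using A by (metis distinct.simps(2))
      moreover have "0 < length xs" using j(1) by linarith
      ultimately show ?thesis using j nth_eq_iff_index_eq[of xs j 0] by simp
    qed
    moreover have "x \<notin> set xs" using A by simp
    ultimately show "ipath (x # xs)" by simp
  qed
qed simp

lemma ipath_nth:
  assumes "ipath xs" "i < length xs" "j < length xs"
  shows "adj (xs ! i) (xs ! j) \<longleftrightarrow> j = Suc i \<or> i = Suc j"
  using assms unfolding ipath_iff_nth
  by (metis Suc_lessD irrefl lessI less_not_sym linorder_neqE_nat commute n_not_Suc_n)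

lemma ipath_take: "ipath xs \<Longrightarrow> ipath (take n xs)"
  unfolding ipath_iff_nth by auto

text \<open>Induction along the walk: a new vertex already on the path cuts the path there, and any
  other is put in front of its last neighbour on the path.\<close>

lemma joined_ipath:
  assumes "joined W u v"
  obtains xs where "ipath xs" "set xs \<subseteq> W" "xs \<noteq> []" "hd xs = u" "last xs = v"
proof -
  have "\<exists>xs. ipath xs \<and> set xs \<subseteq> W \<and> xs \<noteq> [] \<and> hd xs = y \<and> last xs = u" if "joined W u y" for u y
    using that
  proof (induction rule: joined_induct)
    case refl
    then show ?case by (intro exI[of _ "[u]"]) auto
  next
    case (step z y)
    then obtain xs where xs: "ipath xs" "set xs \<subseteq> W" "xs \<noteq> []" "hd xs = z" "last xs = u" by blast
    show ?case
    proof (cases "y \<in> set xs")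
      case True
      then obtain n where n: "n < length xs" "xs ! n = y" by (auto simp: in_set_conv_nth)
      moreover have "set (drop n xs) \<subseteq> W" using set_drop_subset[of n xs] xs(2) by (rule subset_trans)
      ultimately show ?thesis using xs
        by (intro exI[of _ "drop n xs"]) (simp add: ipath_drop hd_drop_conv_nth)
    next
      case False
      \<comment> \<open>\<open>n\<close> will be the last position adjacent to \<open>y\<close>, so
        that \<open>y\<close> has exactly one neighbour on \<open>drop n xs\<close>, namely its
        head.\<close>
      define J where "J = {j. j < length xs \<and> adj y (xs ! j)}"
      have J: "finite J" "0 \<in> J" using xs step by (auto simp: J_def hd_conv_nth sym)
      define n where "n = Max J"
      have n: "n \<in> J" "\<And>j. j \<in> J \<Longrightarrow> j \<le> n" using J Max_in Max_ge unfolding n_def by auto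
      have nl: "n < length xs" using n(1) by (simp add: J_def)
      have "adj y x \<longleftrightarrow> x = hd (drop n xs)" if "x \<in> set (drop n xs)" for x
      proof -
        obtain k where k: "k < length xs - n" "x = xs ! (n + k)"
          using \<open>x \<in> set (drop n xs)\<close> nl by (auto simp: in_set_conv_nth)
        have "adj y x \<longleftrightarrow> n + k \<in> J" using k by (auto simp: J_def)
        also have "\<dots> \<longleftrightarrow> k = 0" using n(1) n(2)[of "n + k"] by auto
        also have "\<dots> \<longleftrightarrow> x = hd (drop n xs)"
          using k nl ipath_distinct[OF xs(1)] by (auto simp: hd_drop_conv_nth nth_eq_iff_index_eq)
        finally show ?thesis .
      qed
      moreover have sub: "set (drop n xs) \<subseteq> set xs" by (rule set_drop_subset)
      ultimately have "ipath (y # drop n xs)" using ipath_drop[OF xs(1), of n] False by auto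
      moreover have "set (y # drop n xs) \<subseteq> W" using sub xs(2) \<open>y \<in> W\<close> by auto
      moreover have "last (y # drop n xs) = u" using xs(5) nl by simp
      ultimately show ?thesis by (intro exI[of _ "y # drop n xs"]) simp
    qed
  qed
  \<comment> \<open>The induction prepends vertices, so its paths run from the far end back to the
    start; symmetry turns them round.\<close>
  from this[OF joined_sym[OF assms]] show ?thesis using that by blast
qed

lemma ipath_joined:
  assumes "ipath xs" "set xs \<subseteq> W" "i < length xs" "j < length xs"
  shows "joined W (xs ! i) (xs ! j)"
proof -
  have "joined W (xs ! 0) (xs ! k)" if "k < length xs" for k
    using that
  proof (induction k)
    case 0
    then show ?case using assms(2) by (meson joined_refl nth_mem subsetD)
  next
    case (Suc k)
    then have "joined W (xs ! 0) (xs ! k)" "adj (xs ! k) (xs ! Suc k)" "xs ! Suc k \<in> W"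
      using ipath_nth[OF assms(1), of k "Suc k"] assms(2) nth_mem[of "Suc k" xs] by auto
    then show ?case by (rule joined_step)
  qed
  from this[OF assms(3)] this[OF assms(4)] show ?thesis by (rule joined_trans[OF joined_sym])
qed

subsection \<open>Gluing interval representations along a clique\<close>

lemma is_repD:
  assumes "is_rep W l r" "u \<in> W" "v \<in> W"
  shows "l u \<le> r u" "u \<noteq> v \<Longrightarrow> adj u v \<longleftrightarrow> l u \<le> r v \<and> l v \<le> r u"
  using assms unfolding is_rep_def by blast+

lemma is_rep_mono: "is_rep W l r \<Longrightarrow> W' \<subseteq> W \<Longrightarrow> is_rep W' l r"
  unfolding is_rep_def by blast

lemma interval_mono: "interval W \<Longrightarrow> W' \<subseteq> W \<Longrightarrow> interval W'"
  unfolding interval_def using is_rep_mono by blast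

lemma is_rep_reflect:
  assumes "is_rep W l r" shows "is_rep W (\<lambda>v. - r v) (\<lambda>v. - l v)"
  using assms unfolding is_rep_def by auto

text \<open>The intervals of adjacent vertices of \<open>U\<close> meet and none of them meets that
  of \<open>d\<close>, so a walk in \<open>U\<close> cannot jump over \<open>d\<close>.\<close>

lemma rep_side:
  assumes "is_rep W l r" "joined U u v" "U \<subseteq> W" "d \<in> W" "\<And>x. x \<in> U \<Longrightarrow> x \<notin> cnb d" "r u < l d"
  shows "r v < l d"
  using assms(2)
proof (induction rule: joined_induct)
  case refl
  then show ?case using assms by blast
next
  case (step x y)
  have xy: "x \<in> W" "y \<in> W" "y \<noteq> d" "\<not> adj d y" "x \<noteq> y" using step assms(3,5) irrefl by (auto simp: cnb_iff)
  have "l x \<le> r y \<and> l y \<le> r x" using is_repD(2)[OF assms(1) xy(1,2,5)] step by blast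
  moreover have "\<not> (l d \<le> r y \<and> l y \<le> r d)" using is_repD(2)[OF assms(1) assms(4) xy(2)] xy by blast
  moreover have "l d \<le> r d" using is_repD(1)[OF assms(1) assms(4) assms(4)] .
  ultimately show ?case using step by linarith
qed

text \<open>
  A representation of \<open>F\<close> on the negative axis in which every \<open>x \<in> X\<close> is the interval from
  \<open>l x\<close> to \<open>0\<close>; the value \<open>r x\<close> is irrelevant.
\<close>

definition anchored :: "'a set \<Rightarrow> 'a set \<Rightarrow> bool" where
  "anchored X F \<longleftrightarrow> (\<exists>l r :: 'a \<Rightarrow> int. is_rep F l r \<and> (\<forall>f\<in>F. r f < 0) \<and>
     (\<forall>x\<in>X. l x \<le> 0 \<and> (\<forall>f\<in>F. adj x f \<longleftrightarrow> l x \<le> r f)))"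

text \<open>\<open>F\<close> is connected and avoids \<open>N[d]\<close>, so by
  \<open>rep_side\<close> it lies on one side of \<open>d\<close>, while every interval of
  \<open>X\<close> reaches \<open>d\<close>. The picture is cut at \<open>d\<close>, after a
  reflection if \<open>F\<close> lies to the right.\<close>

lemma anchored_of_interval:
  assumes int: "interval (F \<union> X \<union> {d})"
    and conn: "\<And>f g. f \<in> F \<Longrightarrow> g \<in> F \<Longrightarrow> joined F f g"
    and d: "\<And>f. f \<in> F \<Longrightarrow> f \<notin> cnb d" "\<And>x. x \<in> X \<Longrightarrow> adj d x"
    and FX: "F \<inter> X = {}"
  shows "anchored X F"
proof -
  let ?W = "F \<union> X \<union> {d}"
  have left: "anchored X F" if rep: "is_rep ?W l r" and f0: "\<And>f. f \<in> F \<Longrightarrow> r f < l d" for l r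
  proof -
    \<comment> \<open>The left end of \<open>d\<close> is moved to 0. A vertex of \<open>X\<close>
      that starts later is extended to start there; this meets no new vertex of \<open>F\<close>,
      since all of \<open>F\<close> ends before \<open>d\<close>.\<close>
    define l' where "l' v = (if v \<in> X then min (l v) (l d) - l d else l v - l d)" for v
    define r' where "r' v = r v - l d" for v
    have "is_rep F l r" using rep by (rule is_rep_mono) auto
    then have "is_rep F l' r'" using FX unfolding is_rep_def l'_def r'_def by auto
    moreover have "adj x f \<longleftrightarrow> l' x \<le> r' f" if x: "x \<in> X" and f: "f \<in> F" for x f
    proof -
      have "x \<noteq> f" "x \<noteq> d" using x f FX d irrefl by auto
      have "l d \<le> r x"
        using is_repD(2)[OF rep, of d x] d(2)[OF x] x \<open>x \<noteq> d\<close> by auto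
      moreover have "adj x f \<longleftrightarrow> l x \<le> r f \<and> l f \<le> r x"
        using is_repD(2)[OF rep, of x f] x f \<open>x \<noteq> f\<close> by auto
      moreover have "l f \<le> r f" using is_repD(1)[OF rep, of f f] f by auto
      ultimately show ?thesis using x f0[OF f] unfolding l'_def r'_def by auto
    qed
    moreover have "\<forall>x\<in>X. l' x \<le> 0" by (auto simp: l'_def)
    moreover have "\<forall>f\<in>F. r' f < 0" using f0 by (auto simp: r'_def)
    ultimately show ?thesis unfolding anchored_def by blast
  qed
  obtain l r where rep: "is_rep ?W l r" using int unfolding interval_def by blast
  note side = rep_side[OF _ conn _ _ d(1)]
  show ?thesis
  proof (cases "F = {}")
    case True
    then show ?thesis unfolding anchored_def is_rep_def by (intro exI[of _ "\<lambda>_. 0"]) auto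
  next
    case False
    then obtain f where f: "f \<in> F" by blast
    have "\<not> adj d f" "f \<noteq> d" using d(1)[OF f] by (auto simp: cnb_iff)
    then have "r f < l d \<or> r d < l f"
      using is_repD(2)[OF rep, of d f] f by auto
    then show ?thesis
    proof
      assume "r f < l d"
      then show ?thesis using left[OF rep] side[OF rep, of f] f by blast
    next
      assume "r d < l f"
      then have "- l f < - r d" by simp
      then show ?thesis using left[OF is_rep_reflect[OF rep]] side[OF is_rep_reflect[OF rep], of f] f by blast
    qed
  qed
qed

text \<open>\<open>F\<close> is moved to the left of everything used for \<open>W\<close>. A vertex
  of \<open>X\<close> that reaches \<open>F\<close> then runs across all of \<open>W\<close>, which
  \<open>dom\<close> permits.\<close>

lemma anchored_Un:
  assumes W: "anchored X W" and F: "anchored X F" and fin: "finite W" "finite X"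
    and disj: "W \<inter> F = {}" "W \<inter> X = {}" "F \<inter> X = {}"
    and sep: "\<And>w f. w \<in> W \<Longrightarrow> f \<in> F \<Longrightarrow> \<not> adj w f"
    and dom: "\<And>x f w. x \<in> X \<Longrightarrow> f \<in> F \<Longrightarrow> adj x f \<Longrightarrow> w \<in> W \<Longrightarrow> adj x w"
  shows "anchored X (W \<union> F)"
proof -
  obtain l r where W: "is_rep W l r" "\<And>w. w \<in> W \<Longrightarrow> r w < 0" "\<And>x. x \<in> X \<Longrightarrow> l x \<le> 0"
      "\<And>x w. x \<in> X \<Longrightarrow> w \<in> W \<Longrightarrow> adj x w \<longleftrightarrow> l x \<le> r w"
    using W unfolding anchored_def by blast
  obtain l2 r2 where F: "is_rep F l2 r2" "\<And>f. f \<in> F \<Longrightarrow> r2 f < 0" "\<And>x. x \<in> X \<Longrightarrow> l2 x \<le> 0"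
      "\<And>x f. x \<in> X \<Longrightarrow> f \<in> F \<Longrightarrow> adj x f \<longleftrightarrow> l2 x \<le> r2 f"
    using F unfolding anchored_def by blast
  \<comment> \<open>\<open>M\<close> lies below all left ends of \<open>W\<close> and
    \<open>X\<close>; translated by \<open>M\<close>, the intervals of \<open>F\<close> end before
    these begin. The inserted 0 gives \<open>M \<le> 0\<close>, which keeps \<open>F\<close> on the
    negative axis.\<close>
  have "bdd_below (insert 0 (l ` (W \<union> X)))" using fin by simp
  then obtain M where M: "\<And>v. v \<in> W \<union> X \<Longrightarrow> M \<le> l v" and M0: "M \<le> 0" unfolding bdd_below_def by auto
  \<comment> \<open>A vertex of \<open>X\<close> with a neighbour in \<open>F\<close> takes its left
    end from the representation of \<open>F\<close>, every other one from that of
    \<open>W\<close>.\<close>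
  define far where "far x \<longleftrightarrow> (\<exists>f\<in>F. adj x f)" for x
  define l' where "l' v = (if v \<in> F \<or> v \<in> X \<and> far v then l2 v + M else l v)" for v
  define r' where "r' v = (if v \<in> F then r2 v + M else r v)" for v
  have "is_rep (W \<union> F) l' r'"
    unfolding is_rep_def
  proof (intro conjI ballI impI)
    fix v assume "v \<in> W \<union> F"
    then show "l' v \<le> r' v" using is_repD(1)[OF W(1), of v v] is_repD(1)[OF F(1), of v v] disj
      unfolding l'_def r'_def by auto
  next
    have lW: "l' w = l w" "r' w = r w" if "w \<in> W" for w using that disj unfolding l'_def r'_def by auto
    have lF: "l' w = l2 w + M" "r' w = r2 w + M" if "w \<in> F" for w using that unfolding l'_def r'_def by auto
    have wf: "\<not> adj u v \<and> \<not> adj v u \<and> r' v < l' u" if "u \<in> W" "v \<in> F" for u v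
      using that sep[OF that] commute[of u v] M[of u] F(2)[of v] lW[of u] lF[of v] by auto
    fix u v assume uv: "u \<in> W \<union> F" "v \<in> W \<union> F" "u \<noteq> v"
    then consider "u \<in> W" "v \<in> W" | "u \<in> F" "v \<in> F" | "u \<in> W" "v \<in> F" | "u \<in> F" "v \<in> W" by blast
    then show "adj u v \<longleftrightarrow> l' u \<le> r' v \<and> l' v \<le> r' u"
    proof cases
      case 1
      then show ?thesis using is_repD(2)[OF W(1), of u v] uv lW by simp
    next
      case 2
      then show ?thesis using is_repD(2)[OF F(1), of u v] uv lF by simp
    next
      case 3
      then show ?thesis using wf[OF 3] by simp
    next
      case 4
      then show ?thesis using wf[OF 4(2,1)] by simp
    qed
  qed
  moreover have "r' v < 0" if "v \<in> W \<union> F" for v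
    using that W(2)[of v] F(2)[of v] M0 unfolding r'_def by auto
  moreover have "l' x \<le> 0" if "x \<in> X" for x
    using W(3)[OF that] F(3)[OF that] that disj M0 unfolding l'_def by auto
  moreover have "adj x f \<longleftrightarrow> l' x \<le> r' f" if x: "x \<in> X" and f: "f \<in> W \<union> F" for x f
  proof (cases "f \<in> F")
    case True
    have "far x \<Longrightarrow> l' x = l2 x + M" "\<not> far x \<Longrightarrow> l' x = l x" using x disj unfolding l'_def by auto
    moreover have "\<not> far x \<Longrightarrow> \<not> adj x f" using True far_def by blast
    ultimately show ?thesis using F(4)[OF x True] F(2)[OF True] M[of x] x True unfolding r'_def by fastforce
  next
    case False
    then have f: "f \<in> W" using f by blast
    show ?thesis
    proof (cases "far x")
      case True
      then have "adj x f" using dom[OF x] f unfolding far_def by blast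
      moreover have "l' x \<le> M" using True x F(3)[OF x] unfolding l'_def by auto
      moreover have "M \<le> l f" using M f by blast
      moreover have "l f \<le> r f" using is_repD(1)[OF W(1) f f] .
      ultimately show ?thesis using False unfolding r'_def by auto
    next
      case nfar: False
      then have "l' x = l x" using x disj unfolding l'_def by auto
      then show ?thesis using False W(4)[OF x f] unfolding r'_def by simp
    qed
  qed
  ultimately show ?thesis unfolding anchored_def by (intro exI[of _ l'] exI[of _ r']) blast
qed

text \<open>\<open>F\<close> may be placed between \<open>F'\<close> and the common end of \<open>X\<close>.\<close>

definition inside :: "'a set \<Rightarrow> 'a set \<Rightarrow> 'a set \<Rightarrow> bool" where
  "inside X F F' \<longleftrightarrow> (\<forall>x\<in>X. \<forall>f\<in>F. \<forall>f'\<in>F'. adj x f' \<longrightarrow> adj x f)"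

text \<open>\<open>inside\<close> is transitive through nonempty sets, so a finite family in which
  any two members are related has an outermost one. It is removed, and \<open>anchored_Un\<close>
  puts it back at the far end.\<close>

lemma anchored_Union:
  assumes "finite \<F>" "finite X"
    and "\<And>F. F \<in> \<F> \<Longrightarrow> anchored X F \<and> finite F \<and> F \<inter> X = {} \<and> F \<noteq> {}"
    and "\<And>F F'. F \<in> \<F> \<Longrightarrow> F' \<in> \<F> \<Longrightarrow> F \<noteq> F' \<Longrightarrow> F \<inter> F' = {} \<and> (\<forall>f\<in>F. \<forall>f'\<in>F'. \<not> adj f f')"
    and "\<And>F F'. F \<in> \<F> \<Longrightarrow> F' \<in> \<F> \<Longrightarrow> F \<noteq> F' \<Longrightarrow> inside X F F' \<or> inside X F' F"
  shows "anchored X (\<Union>\<F>)"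
  using assms
proof (induction "card \<F>" arbitrary: \<F>)
  case 0
  then have "\<F> = {}" by simp
  then show ?case unfolding anchored_def is_rep_def by (intro exI[of _ "\<lambda>_. 0"]) auto
next
  case (Suc n)
  have tr: "inside X F H" if "inside X F G" "inside X G H" "G \<in> \<F>" for F G H
  proof -
    obtain g where "g \<in> G" using Suc.prems(3)[OF \<open>G \<in> \<F>\<close>] by blast
    then show ?thesis using that(1,2) unfolding inside_def by meson
  qed
  have out: "\<exists>F\<in>T. \<forall>G\<in>T. G \<noteq> F \<longrightarrow> inside X G F" if "finite T" "T \<noteq> {}" "T \<subseteq> \<F>" for T
    using that
  proof (induction T rule: finite_ne_induct)
    case (insert t T)
    then obtain F where F: "F \<in> T" "\<forall>G\<in>T. G \<noteq> F \<longrightarrow> inside X G F" by blast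
    have ne: "t \<noteq> F" "t \<in> \<F>" "F \<in> \<F>" using F insert by blast+
    then consider "inside X t F" | "inside X F t" using Suc.prems(5) by blast
    then show ?case
    proof cases
      case 1
      then show ?thesis using F by blast
    next
      case 2
      have "inside X G t" if "G \<in> T" for G
        using tr[OF _ 2 ne(3), of G] F(2) that 2 by (cases "G = F") simp_all
      then show ?thesis by (intro bexI[of _ t]) simp_all
    qed
  qed simp
  have "\<F> \<noteq> {}" using Suc.hyps(2) by auto
  then obtain F where F: "F \<in> \<F>" "\<And>G. G \<in> \<F> \<Longrightarrow> G \<noteq> F \<Longrightarrow> inside X G F"
    using out[of \<F>] Suc.prems(1) by blast
  let ?T = "\<F> - {F}"
  have "anchored X (\<Union>?T)"
  proof (rule Suc.hyps(1))
    show "n = card ?T" using Suc.hyps(2) F(1) Suc.prems(1) by simp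
    show "finite ?T" using Suc.prems(1) by simp
    show "finite X" by fact
    show "anchored X G \<and> finite G \<and> G \<inter> X = {} \<and> G \<noteq> {}" if "G \<in> ?T" for G
      using Suc.prems(3)[of G] that by blast
    show "G \<inter> G' = {} \<and> (\<forall>f\<in>G. \<forall>f'\<in>G'. \<not> adj f f')" if "G \<in> ?T" "G' \<in> ?T" "G \<noteq> G'" for G G'
      using Suc.prems(4)[of G G'] that by blast
    show "inside X G G' \<or> inside X G' G" if "G \<in> ?T" "G' \<in> ?T" "G \<noteq> G'" for G G'
      using Suc.prems(5)[of G G'] that by blast
  qed
  moreover have "anchored X F" using Suc.prems(3)[OF F(1)] by blast
  ultimately have "anchored X (\<Union>?T \<union> F)"
  proof (rule anchored_Un)
    show "finite (\<Union>?T)" using Suc.prems(1,3) by blast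
    show "finite X" by fact
    show "\<Union>?T \<inter> F = {}" using Suc.prems(4)[OF F(1)] by blast
    show "\<Union>?T \<inter> X = {}" using Suc.prems(3) by blast
    show "F \<inter> X = {}" using Suc.prems(3)[OF F(1)] by blast
    fix w f assume w: "w \<in> \<Union>?T" and f: "f \<in> F"
    then obtain G where G: "G \<in> \<F>" "G \<noteq> F" "w \<in> G" by blast
    show "\<not> adj w f" using Suc.prems(4)[OF G(1) F(1) G(2)] G(3) f by blast
  next
    fix x f w assume *: "x \<in> X" "f \<in> F" "adj x f" "w \<in> \<Union>?T"
    then obtain G where G: "G \<in> \<F>" "G \<noteq> F" "w \<in> G" by blast
    show "adj x w" using F(2)[OF G(1,2)] G(3) * unfolding inside_def by blast
  qed
  moreover have "\<Union>?T \<union> F = \<Union>\<F>" using F(1) by blast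
  ultimately show ?case by simp
qed

text \<open>\<open>A\<close> stays on the negative axis and \<open>B\<close> is reflected to the
  positive one. A vertex of \<open>X\<close> extends to the left as for \<open>A\<close> and to the
  right as for \<open>B\<close>; all of them contain 0, as befits a clique.\<close>

lemma interval_of_anchored:
  assumes A: "anchored X A" and B: "anchored X B" and X: "clique X" "A \<inter> X = {}" "B \<inter> X = {}"
    and AB: "A \<inter> B = {}" "\<And>a b. a \<in> A \<Longrightarrow> b \<in> B \<Longrightarrow> \<not> adj a b"
  shows "interval (A \<union> B \<union> X)"
proof -
  obtain l r where A: "is_rep A l r" "\<And>w. w \<in> A \<Longrightarrow> r w < 0" "\<And>x. x \<in> X \<Longrightarrow> l x \<le> 0"
      "\<And>x w. x \<in> X \<Longrightarrow> w \<in> A \<Longrightarrow> adj x w \<longleftrightarrow> l x \<le> r w"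
    using A unfolding anchored_def by blast
  obtain l2 r2 where B: "is_rep B l2 r2" "\<And>f. f \<in> B \<Longrightarrow> r2 f < 0" "\<And>x. x \<in> X \<Longrightarrow> l2 x \<le> 0"
      "\<And>x f. x \<in> X \<Longrightarrow> f \<in> B \<Longrightarrow> adj x f \<longleftrightarrow> l2 x \<le> r2 f"
    using B unfolding anchored_def by blast
  define l' where "l' v = (if v \<in> B then - r2 v else l v)" for v
  define r' where "r' v = (if v \<in> A then r v else - l2 v)" for v
  have inA: "l' v = l v" "r' v = r v" "l' v \<le> r' v" "r' v < 0" if "v \<in> A" for v
    using that AB(1) A(2) is_repD(1)[OF A(1), of v v] unfolding l'_def r'_def by auto
  have inB: "l' v = - r2 v" "r' v = - l2 v" "l' v \<le> r' v" "0 < l' v" if "v \<in> B" for v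
    using that AB(1) B(2)[of v] is_repD(1)[OF B(1), of v v] unfolding l'_def r'_def by auto
  have inX: "l' v = l v" "r' v = - l2 v" "l' v \<le> 0" "0 \<le> r' v" if "v \<in> X" for v
    using that X A(3)[of v] B(3)[of v] unfolding l'_def r'_def by auto
  have AX: "adj x a \<longleftrightarrow> l' x \<le> r' a \<and> l' a \<le> r' x" "adj a x \<longleftrightarrow> l' x \<le> r' a \<and> l' a \<le> r' x"
    if "a \<in> A" "x \<in> X" for a x
    using A(4)[OF that(2,1)] inA[OF that(1)] inX[OF that(2)] commute[of a x] by auto
  have BX: "adj x a \<longleftrightarrow> l' x \<le> r' a \<and> l' a \<le> r' x" "adj a x \<longleftrightarrow> l' x \<le> r' a \<and> l' a \<le> r' x"
    if "a \<in> B" "x \<in> X" for a x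
    using B(4)[OF that(2,1)] inB[OF that(1)] inX[OF that(2)] commute[of a x] by auto
  have "is_rep (A \<union> B \<union> X) l' r'"
    unfolding is_rep_def
  proof (intro conjI ballI impI)
    fix v assume "v \<in> A \<union> B \<union> X"
    then show "l' v \<le> r' v" using inA(3)[of v] inB(3)[of v] inX(3,4)[of v] by auto
  next
    fix u v assume uv: "u \<in> A \<union> B \<union> X" "v \<in> A \<union> B \<union> X" "u \<noteq> v"
    then consider "u \<in> A" "v \<in> A" | "u \<in> B" "v \<in> B" | "u \<in> X" "v \<in> X" | "u \<in> A" "v \<in> B" | "u \<in> B" "v \<in> A"
      | "u \<in> A" "v \<in> X" | "u \<in> X" "v \<in> A" | "u \<in> B" "v \<in> X" | "u \<in> X" "v \<in> B" by blast
    then show "adj u v \<longleftrightarrow> l' u \<le> r' v \<and> l' v \<le> r' u"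
    proof cases
      case 1 then show ?thesis using is_repD(2)[OF A(1), of u v] uv inA by simp
    next
      case 2 then show ?thesis using is_repD(2)[OF B(1), of u v] uv inB by auto
    next
      case 3 then show ?thesis using X(1) uv inX(3,4)[of u] inX(3,4)[of v] unfolding clique_def by auto
    next
      case 4 then show ?thesis using AB(2)[OF 4] inA(4)[of u] inB(4)[of v] by auto
    next
      case 5 then show ?thesis using AB(2)[OF 5(2,1)] inA(4)[of v] inB(4)[of u] commute[of u v] by auto
    next
      case 6 then show ?thesis using AX by blast
    next
      case 7 then show ?thesis using AX by blast
    next
      case 8 then show ?thesis using BX by blast
    next
      case 9 then show ?thesis using BX by blast
    qed
  qed
  then show ?thesis unfolding interval_def by blast
qed

text \<open>The vertex of \<open>F\<close> whose interval ends first is farthest from the common end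
  of \<open>X\<close>, so what reaches it from there passes all of \<open>F\<close>. Such vertices
  will form the asteroidal triple.\<close>

lemma anchored_least:
  assumes "anchored X F" "finite F" "F \<noteq> {}"
  shows "\<exists>f\<in>F. \<forall>x\<in>X. adj x f \<longrightarrow> (\<forall>g\<in>F. adj x g)"
proof -
  obtain l r where F: "\<And>x f. x \<in> X \<Longrightarrow> f \<in> F \<Longrightarrow> adj x f \<longleftrightarrow> l x \<le> (r f :: int)"
    using assms(1) unfolding anchored_def by blast
  have "Min (r ` F) \<in> r ` F" using assms by (intro Min_in) auto
  then obtain f where f: "f \<in> F" "r f = Min (r ` F)" by auto
  have "r f \<le> r g" if "g \<in> F" for g using f(2) assms(2) that by simp
  then have "adj x g" if "x \<in> X" "adj x f" "g \<in> F" for x g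
    using F[of x f] F[of x g] f(1) that by fastforce
  then show ?thesis using f(1) by blast
qed

lemma comps_disjoint:
  assumes "F = comp U u" "G = comp U v" "F \<noteq> G"
  shows "F \<inter> G = {}" "\<And>f g. f \<in> F \<Longrightarrow> g \<in> G \<Longrightarrow> \<not> adj f g"
proof -
  show disj: "F \<inter> G = {}" using assms comp_eq by blast
  fix f g assume "f \<in> F" "g \<in> G"
  then show "\<not> adj f g" using comp_step[of f U u g] comp_sub[of U v] disj assms by blast
qed

text \<open>The walk goes from \<open>f1\<close> inside \<open>F1\<close> to \<open>g1\<close>, over
  \<open>x1\<close> and \<open>x2\<close>, and from \<open>g2\<close> inside \<open>F2\<close> to
  \<open>f2\<close>. Distinct components have no edges between them, and \<open>x1\<close>,
  \<open>x2\<close> miss \<open>f3\<close> by hypothesis.\<close>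

lemma joined_avoiding:
  assumes F: "F1 = comp (W - X) u1" "F2 = comp (W - X) u2" "F3 = comp (W - X) u3"
    and ne: "F1 \<noteq> F3" "F2 \<noteq> F3"
    and X: "clique X" "X \<subseteq> W"
    and f: "f1 \<in> F1" "f2 \<in> F2" "f3 \<in> F3"
    and x: "x1 \<in> X" "g1 \<in> F1" "adj x1 g1" "\<not> adj x1 f3" "x2 \<in> X" "g2 \<in> F2" "adj x2 g2" "\<not> adj x2 f3"
  shows "joined (W - cnb f3) f1 f2"
proof -
  have sub: "F1 \<subseteq> W - X" "F2 \<subseteq> W - X" "F3 \<subseteq> W - X" using F comp_sub by blast+
  have 1: "F1 \<subseteq> W - cnb f3"
    using sub comps_disjoint[OF F(3,1)] ne(1) f(3) by (fastforce simp: cnb_iff)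
  have 2: "F2 \<subseteq> W - cnb f3"
    using sub comps_disjoint[OF F(3,2)] ne(2) f(3) by (fastforce simp: cnb_iff)
  have x': "x1 \<in> W - cnb f3" "x2 \<in> W - cnb f3"
    using x X(2) sub f(3) commute by (auto simp: cnb_iff)
  have j1: "joined (W - cnb f3) f1 g1"
    using comp_joined[of f1 "W - X" u1 g1] f(1) x(2) F(1) joined_mono[OF _ 1] by simp
  have j2: "joined (W - cnb f3) g2 f2"
    using comp_joined[of g2 "W - X" u2 f2] f(2) x(6) F(2) joined_mono[OF _ 2] by simp
  have "joined (W - cnb f3) g1 x1" using 1 x(2) x'(1) sym[OF x(3)] by (intro joined_edge) auto
  moreover have "joined (W - cnb f3) x1 x2"
  proof (cases "x1 = x2")
    case True
    then show ?thesis using x' joined_refl by simp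
  next
    case False
    then show ?thesis using x' X(1) x unfolding clique_def by (intro joined_edge) auto
  qed
  moreover have "joined (W - cnb f3) x2 g2" using 2 x(6,7) x'(2) by (intro joined_edge) auto
  ultimately show ?thesis using j1 j2 joined_trans by blast
qed

text \<open>The components of \<open>W - X\<close> are preordered by stacking. Width at most two
  follows from the absence of asteroidal triples, and the two chains become the two sides of
  \<open>X\<close>.\<close>

lemma interval_of_anchored_comps:
  assumes fin: "finite W" and X: "clique X" "X \<subseteq> W"
    and anch: "\<And>u. u \<in> W - X \<Longrightarrow> anchored X (comp (W - X) u)"
    and noAT: "\<And>a b c. \<not> asteroidal W a b c"
  shows "interval W"
proof -
  define \<F> where "\<F> = comp (W - X) ` (W - X)"
  \<comment> \<open>\<open>inside X F F\<close> may fail, whereas \<open>two_chains\<close> asks for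
    a reflexive relation; hence the disjunct \<open>F = G\<close>.\<close>
  define R where "R F G \<longleftrightarrow> F = G \<or> (G \<in> \<F> \<and> inside X F G)" for F G
  have finX: "finite X" "finite \<F>" using fin X finite_subset unfolding \<F>_def by auto
  have F: "anchored X F \<and> finite F \<and> F \<inter> X = {} \<and> F \<noteq> {}" if "F \<in> \<F>" for F
  proof -
    obtain u where u: "u \<in> W - X" "F = comp (W - X) u" using \<open>F \<in> \<F>\<close> unfolding \<F>_def by blast
    have "F \<subseteq> W - X" "u \<in> F" using u comp_sub comp_self by auto
    then show ?thesis using anch[OF u(1)] u(2) fin finite_subset[of F W] by auto
  qed
  have sep: "F \<inter> G = {} \<and> (\<forall>f\<in>F. \<forall>g\<in>G. \<not> adj f g)" if FG: "F \<in> \<F>" "G \<in> \<F>" "F \<noteq> G" for F G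
  proof -
    obtain u v where "F = comp (W - X) u" "G = comp (W - X) v" using FG unfolding \<F>_def by blast
    then show ?thesis using comps_disjoint[of F "W - X" u G v] FG(3) by blast
  qed
  have tr: "R F H" if "R F G" "R G H" "G \<in> \<F>" for F G H
  proof -
    obtain g where "g \<in> G" using F[OF \<open>G \<in> \<F>\<close>] by blast
    moreover have "F = G \<or> G = H \<or> inside X F G \<and> inside X G H \<and> H \<in> \<F>" using that(1,2) unfolding R_def by blast
    ultimately show ?thesis using that(1,2) unfolding R_def inside_def by meson
  qed
  have wit: "\<exists>x\<in>X. \<exists>g\<in>F. adj x g \<and> (\<exists>h\<in>G. \<not> adj x h)" if "\<not> R G F" "F \<in> \<F>" for F G
    using that unfolding R_def inside_def by blast
  have width: False
    if in\<F>: "F \<in> \<F>" "G \<in> \<F>" "H \<in> \<F>" and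
      inc: "\<not> R F G" "\<not> R G F" "\<not> R F H" "\<not> R H F" "\<not> R G H" "\<not> R H G" for F G H
  proof -
    have j: "joined (W - cnb f3) f1 f2"
      if Fi: "F1 \<in> \<F>" "F2 \<in> \<F>" "F3 \<in> \<F>" and nR: "\<not> R F3 F1" "\<not> R F3 F2" and f: "f1 \<in> F1" "f2 \<in> F2" "f3 \<in> F3"
        and least: "\<And>x g. x \<in> X \<Longrightarrow> adj x f3 \<Longrightarrow> g \<in> F3 \<Longrightarrow> adj x g" for F1 F2 F3 f1 f2 f3
    proof -
      obtain u1 u2 u3 where u: "F1 = comp (W - X) u1" "F2 = comp (W - X) u2" "F3 = comp (W - X) u3"
        using Fi unfolding \<F>_def by blast
      obtain x1 g1 h1 where 1: "x1 \<in> X" "g1 \<in> F1" "adj x1 g1" "h1 \<in> F3" "\<not> adj x1 h1" using wit[OF nR(1) Fi(1)] by blast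
      obtain x2 g2 h2 where 2: "x2 \<in> X" "g2 \<in> F2" "adj x2 g2" "h2 \<in> F3" "\<not> adj x2 h2" using wit[OF nR(2) Fi(2)] by blast
      \<comment> \<open>Each of \<open>x1\<close>, \<open>x2\<close> misses some vertex of
        \<open>F3\<close>. By the choice of \<open>f3\<close> a neighbour of \<open>f3\<close> in
        \<open>X\<close> is complete to \<open>F3\<close>, so both miss \<open>f3\<close>
        itself.\<close>
      have "\<not> adj x1 f3" "\<not> adj x2 f3" using least 1 2 by blast+
      moreover have "F1 \<noteq> F3" "F2 \<noteq> F3" using nR unfolding R_def by blast+
      ultimately show ?thesis using joined_avoiding[OF u _ _ X f 1(1-3) _ 2(1-3)] by blast
    qed
    have least: "\<exists>f\<in>F. \<forall>x\<in>X. adj x f \<longrightarrow> (\<forall>g\<in>F. adj x g)" if "F \<in> \<F>" for F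
      using anchored_least[of X F] F[OF that] by blast
    obtain f where f: "f \<in> F" "\<And>x g. x \<in> X \<Longrightarrow> adj x f \<Longrightarrow> g \<in> F \<Longrightarrow> adj x g"
      using least[OF in\<F>(1)] by blast
    obtain g where g: "g \<in> G" "\<And>x h. x \<in> X \<Longrightarrow> adj x g \<Longrightarrow> h \<in> G \<Longrightarrow> adj x h"
      using least[OF in\<F>(2)] by blast
    obtain h where h: "h \<in> H" "\<And>x g. x \<in> X \<Longrightarrow> adj x h \<Longrightarrow> g \<in> H \<Longrightarrow> adj x g"
      using least[OF in\<F>(3)] by blast
    have "f \<in> W" "g \<in> W" "h \<in> W" using f(1) g(1) h(1) in\<F> comp_sub[of "W - X"] unfolding \<F>_def by blast+
    moreover have "joined (W - cnb f) g h" using j[OF in\<F>(2,3,1) inc(1,3) g(1) h(1) f] .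
    moreover have "joined (W - cnb g) f h" using j[OF in\<F>(1,3,2) inc(2,5) f(1) h(1) g] .
    moreover have "joined (W - cnb h) f g" using j[OF in\<F>(1,2,3) inc(4,6) f(1) g(1) h] .
    ultimately have "asteroidal W f g h" unfolding asteroidal_def by (intro conjI)
    then show False using noAT by blast
  qed
  have "\<exists>A B. \<F> = A \<union> B \<and> A \<inter> B = {} \<and> (\<forall>x\<in>A. \<forall>y\<in>A. R x y \<or> R y x) \<and> (\<forall>x\<in>B. \<forall>y\<in>B. R x y \<or> R y x)"
  proof (rule two_chains[OF finX(2)])
    show "R F F" for F unfolding R_def by blast
    show "R F H" if "R F G" "R G H" "G \<in> \<F>" for F G H using tr[OF that] .
    show False if "F \<in> \<F>" "G \<in> \<F>" "H \<in> \<F>" "\<not> R F G" "\<not> R G F" "\<not> R F H" "\<not> R H F" "\<not> R G H" "\<not> R H G" for F G H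
      using width[OF that] .
  qed
  then obtain A B where AB: "\<F> = A \<union> B" "A \<inter> B = {}"
    and chains: "\<forall>x\<in>A. \<forall>y\<in>A. R x y \<or> R y x" "\<forall>x\<in>B. \<forall>y\<in>B. R x y \<or> R y x" by (elim exE conjE)
  have Un: "anchored X (\<Union>T)" if T: "T \<subseteq> \<F>" "\<forall>x\<in>T. \<forall>y\<in>T. R x y \<or> R y x" for T
  proof (rule anchored_Union[OF _ finX(1)])
    show "finite T" using T(1) finX(2) finite_subset by blast
    show "anchored X F \<and> finite F \<and> F \<inter> X = {} \<and> F \<noteq> {}" if "F \<in> T" for F using F[of F] T(1) that by blast
    show "F \<inter> F' = {} \<and> (\<forall>f\<in>F. \<forall>f'\<in>F'. \<not> adj f f')" if "F \<in> T" "F' \<in> T" "F \<noteq> F'" for F F'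
      using sep[of F F'] T(1) that by blast
    show "inside X F F' \<or> inside X F' F" if "F \<in> T" "F' \<in> T" "F \<noteq> F'" for F F'
      using T(2) that unfolding R_def by blast
  qed
  have "interval (\<Union>A \<union> \<Union>B \<union> X)"
  proof (rule interval_of_anchored)
    show "anchored X (\<Union>A)" "anchored X (\<Union>B)" using Un AB(1) chains by blast+
    show "\<Union>A \<inter> X = {}" "\<Union>B \<inter> X = {}" using F AB(1) by blast+
    show "clique X" by fact
    have ne: "G \<noteq> H" "G \<in> \<F>" "H \<in> \<F>" if "G \<in> A" "H \<in> B" for G H using that AB by blast+
    show "\<Union>A \<inter> \<Union>B = {}" using sep[OF ne(2,3,1)] by blast
    show "\<not> adj a b" if "a \<in> \<Union>A" "b \<in> \<Union>B" for a b using sep[OF ne(2,3,1)] that by blast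
  qed
  moreover have "\<Union>A \<union> \<Union>B \<union> X = W"
  proof -
    have "\<Union>\<F> = W - X" unfolding \<F>_def using comp_sub[of "W - X"] comp_self[of _ "W - X"] by auto
    then show ?thesis using AB(1) X(2) by blast
  qed
  ultimately show ?thesis by simp
qed

subsection \<open>Chordal graphs without asteroidal triples\<close>

text \<open>Two boundary vertices are joined by an induced path with its inner vertices in
  \<open>C\<close>. Both ends are adjacent to \<open>a\<close>, so by chordality the whole path is;
  as \<open>C\<close> avoids \<open>N[a]\<close>, there are no inner vertices.\<close>

lemma clique_boundary:
  assumes ch: "chordal W" and a: "a \<in> W" and C: "C = comp (W - cnb a) b"
  shows "clique {x \<in> W. x \<in> cnb a \<and> (\<exists>c\<in>C. adj c x)}" "\<And>x c. x \<in> W \<Longrightarrow> x \<in> cnb a \<Longrightarrow> c \<in> C \<Longrightarrow> adj c x \<Longrightarrow> adj a x"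
proof -
  have CW: "C \<subseteq> W - cnb a" using C comp_sub by blast
  show ax: "adj a x" if "x \<in> W" "x \<in> cnb a" "c \<in> C" "adj c x" for x c
    using that CW commute[of c x] by (auto simp: cnb_iff)
  show "clique {x \<in> W. x \<in> cnb a \<and> (\<exists>c\<in>C. adj c x)}"
    unfolding clique_def
  proof (intro ballI impI)
    fix x y assume x: "x \<in> {x \<in> W. x \<in> cnb a \<and> (\<exists>c\<in>C. adj c x)}" and y: "y \<in> {x \<in> W. x \<in> cnb a \<and> (\<exists>c\<in>C. adj c x)}" and xy: "x \<noteq> y"
    obtain c d where cd: "c \<in> C" "adj c x" "d \<in> C" "adj d y" using x y by blast
    let ?U = "insert x (insert y C)"
    have "joined ?U x c" using cd sym by (intro joined_edge) auto
    moreover have "joined ?U c d" using comp_joined[of c _ b d] cd C joined_mono[of C c d ?U] by auto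
    moreover have "joined ?U d y" using cd by (intro joined_edge) auto
    ultimately have "joined ?U x y" using joined_trans by blast
    then obtain p where p: "ipath p" "set p \<subseteq> ?U" "p \<noteq> []" "hd p = x" "last p = y" by (rule joined_ipath)
    have "adj a x" "adj a y" using ax[of x c] ax[of y d] cd x y by blast+
    then have "a \<noteq> x" "a \<noteq> y" using irrefl by blast+
    moreover have "a \<notin> C" using CW by (auto simp: cnb_iff)
    ultimately have "a \<notin> set p" using p(2) by blast
    moreover have "set p \<subseteq> W" using p(2) x y CW by blast
    ultimately have all: "\<forall>z\<in>set p. adj a z" using chordalD[OF ch p(1) _ a] p(4,5) ax[of x c] ax[of y d] cd x y by auto
    have "set p \<subseteq> {x, y}" using p(2) CW all by (auto simp: cnb_iff)
    obtain q where q: "p = x # q" using p(3,4) by (cases p) auto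
    have "x \<notin> set q" using p(1) q by simp
    moreover have "q \<noteq> []" using p(5) q xy by auto
    ultimately have "hd q = y" using \<open>set p \<subseteq> {x, y}\<close> q by (cases q) auto
    then show "adj x y" using p(1) q \<open>q \<noteq> []\<close> by auto
  qed
qed

text \<open>A vertex \<open>d\<close> of \<open>C\<close> with the most neighbours in
  \<open>X\<close> works. If it missed \<open>x\<close>, the second vertex of an induced path from
  \<open>x\<close> through \<open>C\<close> to \<open>d\<close> would be adjacent to
  \<open>x\<close> and, by chordality, to all neighbours of \<open>d\<close> in \<open>X\<close>,
  which is one more.\<close>

lemma ex_dominating:
  assumes ch: "chordal W" and fin: "finite W" and X: "clique X" "X \<subseteq> W" and C: "C \<subseteq> W - X" "c0 \<in> C"
    and conn: "\<And>c d. c \<in> C \<Longrightarrow> d \<in> C \<Longrightarrow> joined C c d" and full: "\<And>x. x \<in> X \<Longrightarrow> \<exists>c\<in>C. adj c x"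
  shows "\<exists>d\<in>C. \<forall>x\<in>X. adj d x"
proof -
  define N where "N c = {x\<in>X. adj c x}" for c
  have finC: "finite C" "finite X" using fin C X finite_subset by blast+
  have "Max ((card \<circ> N) ` C) \<in> (card \<circ> N) ` C" using finC C(2) by (intro Max_in) auto
  then obtain d where d: "d \<in> C" "\<And>c. c \<in> C \<Longrightarrow> card (N c) \<le> card (N d)"
    using finC by (auto simp: Max_ge_iff) (metis Max_ge finite_imageI imageI o_apply)
  have "adj d x" if x: "x \<in> X" for x
  proof (rule ccontr)
    assume dx: "\<not> adj d x"
    obtain c where c: "c \<in> C" "adj c x" using full[OF x] by blast
    let ?U = "insert x C"
    have "joined ?U d c" using joined_mono[OF conn[OF d(1) c(1)]] by blast
    moreover have "joined ?U c x" using c by (intro joined_edge) auto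
    ultimately have "joined ?U x d" using joined_trans joined_sym by blast
    then obtain p where p: "ipath p" "set p \<subseteq> ?U" "p \<noteq> []" "hd p = x" "last p = d" by (rule joined_ipath)
    obtain q where q: "p = x # q" using p(3,4) by (cases p) auto
    have "x \<noteq> d" using x d(1) C(1) by blast
    then have qne: "q \<noteq> []" using p(5) q by auto
    let ?c = "hd q"
    have "?c \<in> set q" using qne by simp
    then have c': "?c \<in> C" "adj x ?c" using p(1,2) q by auto
    have "adj y ?c" if y: "y \<in> N d" for y
    proof (cases "y = x")
      case False
      have yX: "y \<in> X" "adj d y" using y unfolding N_def by auto
      have "y \<notin> set p" using p(2) yX C(1) False by blast
      moreover have "adj y x" using X(1) yX x False unfolding clique_def by blast
      ultimately show ?thesis
        using chordalD[OF ch p(1), of y ?c] p(2,4,5) x X(2) C(1) yX sym[of d y] q qne by auto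
    qed (use c' in simp)
    then have "insert x (N d) \<subseteq> N ?c" using sym c' x unfolding N_def by blast
    moreover have "x \<notin> N d" using dx unfolding N_def by simp
    moreover have "finite (N ?c)" "finite (N d)" using finC unfolding N_def by auto
    ultimately have "Suc (card (N d)) \<le> card (N ?c)" using card_mono[of "N ?c" "insert x (N d)"] by simp
    then show False using d(2)[OF c'(1)] by simp
  qed
  then show ?thesis using d(1) by blast
qed

text \<open>A simplicial vertex whose nonneighbours are connected, as the extreme vertex of a
  representation may be. The last conjunct makes distinct ends nonadjacent.\<close>

definition is_end :: "'a set \<Rightarrow> 'a \<Rightarrow> bool" where
  "is_end W d \<longleftrightarrow> d \<in> W \<and> clique {x \<in> W. adj d x} \<and> (\<forall>x\<in>W - cnb d. \<forall>y\<in>W - cnb d. joined (W - cnb d) x y) \<and>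
     (\<forall>x\<in>W. adj d x \<longrightarrow> (\<exists>y\<in>W - cnb d. adj x y))"

text \<open>With \<open>X\<close> the boundary of the component of \<open>v\<close> in
  \<open>W - N[u]\<close>, each component \<open>F\<close> of \<open>W - X\<close> gets a vertex
  \<open>d\<close> outside it that is complete to \<open>X\<close>. By minimality \<open>F\<close>
  is anchored unless \<open>F\<close>, \<open>X\<close> and \<open>d\<close> exhaust
  \<open>W\<close>, and in that case \<open>d\<close> is \<open>u\<close> or \<open>v\<close> and is
  an end.\<close>

lemma end_of_nonadjacent:
  assumes ch: "chordal W" and fin: "finite W" and noAT: "\<And>a b c. \<not> asteroidal W a b c"
    and min: "\<And>W'. W' \<subset> W \<Longrightarrow> interval W'" and nint: "\<not> interval W"
    and uv: "u \<in> W" "v \<in> W" "v \<notin> cnb u"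
  shows "is_end W u \<or> is_end W v"
proof (rule ccontr)
  assume nend: "\<not> (is_end W u \<or> is_end W v)"
  define C where "C = comp (W - cnb u) v"
  define X where "X = {x \<in> W. x \<in> cnb u \<and> (\<exists>c\<in>C. adj c x)}"
  have cl: "clique X" and ux: "\<And>x. x \<in> X \<Longrightarrow> adj u x"
    using clique_boundary[OF ch uv(1) C_def] unfolding X_def by blast+
  have XW: "X \<subseteq> W" unfolding X_def by blast
  have CW: "C \<subseteq> W - cnb u" unfolding C_def by (rule comp_sub)
  have CX: "C \<subseteq> W - X" using CW unfolding X_def by blast
  have vC: "v \<in> C" unfolding C_def using uv by (intro comp_self) auto
  have uX: "u \<in> W - X" using ux irrefl uv(1) by blast
  have uC: "u \<notin> C" using CW by (auto simp: cnb_iff)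
  \<comment> \<open>Deleting only the boundary \<open>X\<close> instead of all of
    \<open>N[u]\<close> already isolates \<open>C\<close>.\<close>
  have CF: "comp (W - X) v = C"
  proof
    show "comp (W - X) v \<subseteq> C"
    proof
      fix y assume "y \<in> comp (W - X) v"
      then have "joined (W - X) v y" unfolding comp_def by simp
      then show "y \<in> C"
      proof (induction rule: joined_induct)
        case refl
        show ?case by (rule vC)
      next
        case (step x y)
        then have "y \<notin> cnb u" unfolding X_def by blast
        then show ?case using comp_step[of x "W - cnb u" v y] step unfolding C_def by blast
      qed
    qed
    have "W - cnb u \<subseteq> W - X" unfolding X_def by blast
    then show "C \<subseteq> comp (W - X) v" unfolding C_def comp_def using joined_mono by blast
  qed
  have "anchored X (comp (W - X) w)" if w: "w \<in> W - X" for w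
  proof -
    define F where "F = comp (W - X) w"
    have FX: "F \<subseteq> W - X" unfolding F_def by (rule comp_sub)
    have conn: "joined F f g" if "f \<in> F" "g \<in> F" for f g
      using comp_joined that unfolding F_def by blast
    \<comment> \<open>The component that contains \<open>u\<close> uses a vertex of \<open>C\<close>
      complete to \<open>X\<close>; every other component, \<open>C\<close> among them, uses
      \<open>u\<close>.\<close>
    have "\<exists>d\<in>W. d \<notin> F \<and> (\<forall>f\<in>F. f \<notin> cnb d) \<and> (\<forall>x\<in>X. adj d x) \<and> F \<union> X \<union> {d} \<noteq> W"
    proof (cases "u \<in> F")
      case True
      have FC: "F \<noteq> C" using True uC by blast
      have disj: "F \<inter> C = {}" and nadj: "\<And>f c. f \<in> F \<Longrightarrow> c \<in> C \<Longrightarrow> \<not> adj f c"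
        using comps_disjoint[OF F_def CF[symmetric] FC] by blast+
      have "\<exists>d\<in>C. \<forall>x\<in>X. adj d x"
      proof (rule ex_dominating[OF ch fin cl XW CX vC])
        show "joined C c d" if "c \<in> C" "d \<in> C" for c d using comp_joined that unfolding C_def by blast
        show "\<exists>c\<in>C. adj c x" if "x \<in> X" for x using that unfolding X_def by blast
      qed
      then obtain d where d: "d \<in> C" "\<forall>x\<in>X. adj d x" by blast
      have dF: "d \<notin> F" "\<forall>f\<in>F. f \<notin> cnb d" using d(1) disj nadj commute by (auto simp: cnb_iff)
      have "F \<union> X \<union> {d} \<noteq> W"
      proof
        assume W: "F \<union> X \<union> {d} = W"
        \<comment> \<open>\<open>C\<close> is disjoint from \<open>F\<close> and \<open>X\<close>,
          so nothing but \<open>d\<close> is left for it, and \<open>d\<close> is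
          \<open>v\<close>.\<close>
        then have "C \<subseteq> {d}" using CX disj by blast
        then have vd: "v = d" using vC by blast
        have "{x \<in> W. adj v x} = X" using W d(2) dF(2) vd irrefl unfolding cnb_def by blast
        moreover have "W - cnb v = F" using W FX dF d(2) vd unfolding cnb_def by blast
        moreover have "\<exists>y\<in>F. adj x y" if "x \<in> X" for x using True ux[OF that] sym by blast
        ultimately have "is_end W v" unfolding is_end_def using cl uv(2) conn by auto
        then show False using nend by blast
      qed
      then show ?thesis using d dF CW by blast
    next
      case False
      have nadj: "f \<notin> cnb u" if "f \<in> F" for f
      proof -
        have "F \<noteq> comp (W - X) u" using False comp_self[OF uX] by blast
        then have "\<not> adj f u" using comps_disjoint(2)[OF F_def refl] comp_self[OF uX] that by blast
        then show ?thesis using that False commute by (auto simp: cnb_iff)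
      qed
      have "F \<union> X \<union> {u} \<noteq> W"
      proof
        assume W: "F \<union> X \<union> {u} = W"
        \<comment> \<open>The only component left is that of \<open>v\<close>, so \<open>F\<close>
          is \<open>C\<close> and every vertex of \<open>X\<close> has a neighbour in it.\<close>
        then have "v \<in> F" using vC CX uC by blast
        then have FC: "F = C" using comp_eq[of v "W - X" w] CF unfolding F_def by simp
        have "{x \<in> W. adj u x} = X" using W ux nadj irrefl unfolding cnb_def by blast
        moreover have "W - cnb u = F" using W FX nadj ux unfolding cnb_def by blast
        moreover have "\<exists>y\<in>F. adj x y" if "x \<in> X" for x using that FC sym unfolding X_def by blast
        ultimately have "is_end W u" unfolding is_end_def using cl uv(1) conn by auto
        then show False using nend by blast
      qed
      then show ?thesis using False nadj ux uv(1) by blast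
    qed
    then obtain d where d: "d \<in> W" "d \<notin> F" "\<forall>f\<in>F. f \<notin> cnb d" "\<forall>x\<in>X. adj d x" "F \<union> X \<union> {d} \<noteq> W" by blast
    have "F \<union> X \<union> {d} \<subset> W" using d(1,5) FX XW by blast
    from min[OF this] have "anchored X F"
      by (rule anchored_of_interval) (use conn d FX in blast)+
    then show ?thesis unfolding F_def .
  qed
  from interval_of_anchored_comps[OF fin cl XW this noAT] show False using nint by blast
qed

text \<open>If \<open>a\<close> and \<open>b\<close> were adjacent, \<open>a\<close> would have a
  neighbour \<open>y\<close> outside \<open>N[b]\<close>, although \<open>b\<close> and
  \<open>y\<close> lie in the clique of neighbours of \<open>a\<close>.\<close>

lemma ends_nonadjacent:
  assumes "is_end W a" "is_end W b" "a \<noteq> b"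
  shows "\<not> adj a b"
proof
  assume ab: "adj a b"
  have aW: "a \<in> W" "b \<in> W" using assms unfolding is_end_def by blast+
  have "adj b a" using ab by (rule sym)
  then obtain y where y: "y \<in> W - cnb b" "adj a y" using assms(2) aW unfolding is_end_def by blast
  have "y \<noteq> b" "\<not> adj b y" using y by (auto simp: cnb_iff)
  moreover have "clique {x \<in> W. adj a x}" using assms(1) unfolding is_end_def by blast
  moreover have "b \<in> {x \<in> W. adj a x}" "y \<in> {x \<in> W. adj a x}" using ab y aW by simp_all
  ultimately show False unfolding clique_def by metis
qed

lemma two_ends:
  assumes noAT: "\<And>a b c. \<not> asteroidal W a b c"
    and e: "is_end W a" "is_end W b" "is_end W c" and ne: "a \<noteq> b" "a \<noteq> c" "b \<noteq> c"
  shows False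
proof -
  have W: "a \<in> W" "b \<in> W" "c \<in> W" using e unfolding is_end_def by blast+
  have n: "\<not> adj a b" "\<not> adj b a" "\<not> adj a c" "\<not> adj c a" "\<not> adj b c" "\<not> adj c b"
    using ends_nonadjacent e ne by metis+
  have "joined (W - cnb a) b c" using e(1) W n ne unfolding is_end_def by (simp add: cnb_iff)
  moreover have "joined (W - cnb b) a c" using e(2) W n ne unfolding is_end_def by (simp add: cnb_iff)
  moreover have "joined (W - cnb c) a b" using e(3) W n ne unfolding is_end_def by (simp add: cnb_iff)
  ultimately show False using noAT[of a b c] W unfolding asteroidal_def by simp
qed

text \<open>All clique vertices contain the interval from 1 to 2; they extend to \<open>a\<close> at
  0 and to \<open>b\<close> at 3 as adjacency requires. The case \<open>a = b\<close> is
  included.\<close>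

lemma interval_clique_plus_two:
  assumes cl: "clique (W - {a, b})" and ab: "\<not> adj a b"
  shows "interval W"
proof -
  define l :: "'a \<Rightarrow> int" where "l v = (if v = a then 0 else if v = b then 3 else if adj a v then 0 else 1)" for v
  define r :: "'a \<Rightarrow> int" where "r v = (if v = a then 0 else if v = b then 3 else if adj b v then 3 else 2)" for v
  have "\<not> adj b a" using ab sym by blast
  then have "is_rep W l r"
    unfolding is_rep_def
  proof (intro conjI ballI impI)
    fix u v assume "u \<in> W" "v \<in> W" "u \<noteq> v"
    then have "u \<notin> {a, b} \<Longrightarrow> v \<notin> {a, b} \<Longrightarrow> adj u v" using cl unfolding clique_def by blast
    then show "adj u v \<longleftrightarrow> l u \<le> r v \<and> l v \<le> r u"
      using ab \<open>\<not> adj b a\<close> \<open>u \<noteq> v\<close> commute[of u a] commute[of u b] unfolding l_def r_def by auto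
  qed (auto simp: l_def r_def)
  then show ?thesis unfolding interval_def by blast
qed

theorem chordal_asteroidal_free_interval:
  assumes "finite W" "chordal W" "\<And>a b c. \<not> asteroidal W a b c"
  shows "interval W"
  using assms
proof (induction "card W" arbitrary: W rule: less_induct)
  case less
  show ?case
  proof (rule ccontr)
    assume nint: "\<not> interval W"
    have min: "interval W'" if W': "W' \<subset> W" for W'
    proof (rule less.hyps)
      show "card W' < card W" using less.prems(1) W' by (rule psubset_card_mono)
      show "finite W'" using less.prems(1) W' finite_subset by blast
      show "chordal W'" using chordal_mono[OF less.prems(2)] W' by blast
      show "\<not> asteroidal W' a b c" for a b c using asteroidal_mono[of W' a b c W] less.prems(3) W' by blast
    qed
    have ends: "is_end W u \<or> is_end W v" if uv: "u \<in> W" "v \<in> W" "u \<noteq> v" "\<not> adj u v" for u v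
      using end_of_nonadjacent[OF less.prems(2,1,3) min nint uv(1,2)] uv(3,4) by (simp add: cnb_iff)
    \<comment> \<open>An end if there is one, and an arbitrary vertex otherwise; below,
      \<open>b\<close> is a second end or else \<open>a\<close> again.\<close>
    obtain a where a: "\<forall>d. is_end W d \<longrightarrow> is_end W a"
      by (cases "\<exists>d. is_end W d") blast+
    obtain b where b: "\<not> adj a b" "\<forall>d. is_end W d \<longrightarrow> d = a \<or> d = b"
    proof (cases "\<exists>d. is_end W d \<and> d \<noteq> a")
      case True
      then obtain b where b: "is_end W b" "b \<noteq> a" by blast
      then have "is_end W a" using a by blast
      have "\<not> adj a b" using ends_nonadjacent[OF \<open>is_end W a\<close> b(1)] b(2) by blast
      moreover have "d = a \<or> d = b" if "is_end W d" for d
        using two_ends[OF less.prems(3) \<open>is_end W a\<close> b(1) that] b(2) by blast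
      ultimately show ?thesis using that by blast
    next
      case False
      then show ?thesis using that[of a] irrefl by blast
    qed
    have "clique (W - {a, b})" unfolding clique_def using ends b(2) by blast
    then show False using interval_clique_plus_two b(1) nint by blast
  qed
qed

end

section \<open>The named graphs and their induced copies\<close>

lemma long_claw_verts: "pverts long_claw = {LC_c, LC_a 1, LC_a 2, LC_a 3, LC_b 1, LC_b 2, LC_b 3}"
proof -
  have "{1..3::nat} = {1, 2, 3}" by auto
  then show ?thesis unfolding long_claw_def undirected_def by auto
qed

lemma long_claw_arcs:
  "(LC_c, LC_a i) \<in> parcs long_claw \<longleftrightarrow> i \<in> {1..3}" "(LC_a i, LC_c) \<in> parcs long_claw \<longleftrightarrow> i \<in> {1..3}"
  "(LC_a i, LC_b j) \<in> parcs long_claw \<longleftrightarrow> i = j \<and> i \<in> {1..3}" "(LC_b j, LC_a i) \<in> parcs long_claw \<longleftrightarrow> i = j \<and> i \<in> {1..3}"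
  "(LC_c, LC_c) \<notin> parcs long_claw" "(LC_a i, LC_a j) \<notin> parcs long_claw" "(LC_b i, LC_b j) \<notin> parcs long_claw"
  "(LC_c, LC_b j) \<notin> parcs long_claw" "(LC_b j, LC_c) \<notin> parcs long_claw"
  unfolding long_claw_def undirected_def by auto

lemma whipping_top_verts: "pverts whipping_top = {WT_x 1, WT_x 2, WT_x 3, WT_x 4, WT_x 5, WT_y, WT_z}"
proof -
  have "{1..5::nat} = {1, 2, 3, 4, 5}" by auto
  then show ?thesis unfolding whipping_top_def undirected_def by auto
qed

lemma whipping_top_arcs:
  "(WT_x i, WT_x j) \<in> parcs whipping_top \<longleftrightarrow> (j = Suc i \<or> i = Suc j) \<and> i \<in> {1..5} \<and> j \<in> {1..5}"
  "(WT_y, WT_x i) \<in> parcs whipping_top \<longleftrightarrow> i \<in> {1..5}" "(WT_x i, WT_y) \<in> parcs whipping_top \<longleftrightarrow> i \<in> {1..5}"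
  "(WT_z, WT_x i) \<in> parcs whipping_top \<longleftrightarrow> i = 3" "(WT_x i, WT_z) \<in> parcs whipping_top \<longleftrightarrow> i = 3"
  "(WT_y, WT_y) \<notin> parcs whipping_top" "(WT_z, WT_z) \<notin> parcs whipping_top"
  "(WT_y, WT_z) \<notin> parcs whipping_top" "(WT_z, WT_y) \<notin> parcs whipping_top"
  unfolding whipping_top_def undirected_def by auto

text \<open>The path of \<open>dagger k\<close> counts from 1, while positions in lists count from
  0; writing its vertices as \<open>Dag_v (Suc i)\<close> with \<open>i < k\<close> makes the two
  match.\<close>

lemma dagger_verts: "x \<in> pverts (dagger k) \<longleftrightarrow> (\<exists>i<k. x = Dag_v (Suc i)) \<or> x \<in> {Dag_c, Dag_p, Dag_q, Dag_s}"
proof -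
  have "{1..k} = Suc ` {..<k}" by (simp add: image_Suc_lessThan)
  then show ?thesis unfolding dagger_def undirected_def by auto
qed

lemma dagger_arcs:
  "(Dag_v i, Dag_v j) \<in> parcs (dagger k) \<longleftrightarrow> (j = Suc i \<or> i = Suc j) \<and> i \<in> {1..k} \<and> j \<in> {1..k}"
  "(Dag_c, Dag_v i) \<in> parcs (dagger k) \<longleftrightarrow> i \<in> {1..k}" "(Dag_v i, Dag_c) \<in> parcs (dagger k) \<longleftrightarrow> i \<in> {1..k}"
  "(Dag_p, Dag_v i) \<in> parcs (dagger k) \<longleftrightarrow> i = 1" "(Dag_v i, Dag_p) \<in> parcs (dagger k) \<longleftrightarrow> i = 1"
  "(Dag_q, Dag_v i) \<in> parcs (dagger k) \<longleftrightarrow> i = k" "(Dag_v i, Dag_q) \<in> parcs (dagger k) \<longleftrightarrow> i = k"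
  "(Dag_s, Dag_v i) \<notin> parcs (dagger k)" "(Dag_v i, Dag_s) \<notin> parcs (dagger k)"
  "(Dag_s, Dag_c) \<in> parcs (dagger k)" "(Dag_c, Dag_s) \<in> parcs (dagger k)"
  "(Dag_c, Dag_c) \<notin> parcs (dagger k)" "(Dag_p, Dag_p) \<notin> parcs (dagger k)"
  "(Dag_q, Dag_q) \<notin> parcs (dagger k)" "(Dag_s, Dag_s) \<notin> parcs (dagger k)"
  "(Dag_p, Dag_q) \<notin> parcs (dagger k)" "(Dag_q, Dag_p) \<notin> parcs (dagger k)"
  "(Dag_p, Dag_c) \<notin> parcs (dagger k)" "(Dag_c, Dag_p) \<notin> parcs (dagger k)"
  "(Dag_q, Dag_c) \<notin> parcs (dagger k)" "(Dag_c, Dag_q) \<notin> parcs (dagger k)"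
  "(Dag_p, Dag_s) \<notin> parcs (dagger k)" "(Dag_s, Dag_p) \<notin> parcs (dagger k)"
  "(Dag_q, Dag_s) \<notin> parcs (dagger k)" "(Dag_s, Dag_q) \<notin> parcs (dagger k)"
  unfolding dagger_def undirected_def by auto

lemma ddagger_verts: "x \<in> pverts (ddagger n) \<longleftrightarrow> (\<exists>i<n. x = DDag_x (Suc i)) \<or> x \<in> {DDag_u, DDag_v, DDag_w}"
proof -
  have "{1..n} = Suc ` {..<n}" by (simp add: image_Suc_lessThan)
  then show ?thesis unfolding ddagger_def undirected_def by auto
qed

lemma ddagger_arcs:
  "(DDag_x i, DDag_x j) \<in> parcs (ddagger n) \<longleftrightarrow> (j = Suc i \<or> i = Suc j) \<and> i \<in> {1..n} \<and> j \<in> {1..n}"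
  "(DDag_u, DDag_x i) \<in> parcs (ddagger n) \<longleftrightarrow> i \<in> {1..n - 1}" "(DDag_x i, DDag_u) \<in> parcs (ddagger n) \<longleftrightarrow> i \<in> {1..n - 1}"
  "(DDag_v, DDag_x i) \<in> parcs (ddagger n) \<longleftrightarrow> i \<in> {2..n}" "(DDag_x i, DDag_v) \<in> parcs (ddagger n) \<longleftrightarrow> i \<in> {2..n}"
  "(DDag_w, DDag_x i) \<notin> parcs (ddagger n)" "(DDag_x i, DDag_w) \<notin> parcs (ddagger n)"
  "(DDag_u, DDag_v) \<in> parcs (ddagger n)" "(DDag_v, DDag_u) \<in> parcs (ddagger n)"
  "(DDag_w, DDag_u) \<in> parcs (ddagger n)" "(DDag_u, DDag_w) \<in> parcs (ddagger n)"
  "(DDag_w, DDag_v) \<in> parcs (ddagger n)" "(DDag_v, DDag_w) \<in> parcs (ddagger n)"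
  "(DDag_u, DDag_u) \<notin> parcs (ddagger n)" "(DDag_v, DDag_v) \<notin> parcs (ddagger n)" "(DDag_w, DDag_w) \<notin> parcs (ddagger n)"
  unfolding ddagger_def undirected_def by auto

context sgraph
begin

text \<open>Induced copies as adjacency-preserving and -reflecting injections into a vertex set, so
  that neighbourhoods need not be turned into graphs. The link with \<open>has_induced\<close> is
  \<open>has_induced_iff\<close>.\<close>

definition embeds :: "'a set \<Rightarrow> 'b pair_pre_digraph \<Rightarrow> bool" where
  "embeds W F \<longleftrightarrow> (\<exists>f. inj_on f (pverts F) \<and> f ` pverts F \<subseteq> W \<and>
     (\<forall>x\<in>pverts F. \<forall>y\<in>pverts F. (x, y) \<in> parcs F \<longleftrightarrow> adj (f x) (f y)))"

definition obstructed :: "'a set \<Rightarrow> bool" where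
  "obstructed W \<longleftrightarrow> embeds W long_claw \<or> embeds W whipping_top \<or>
     (\<exists>k\<ge>2. embeds W (dagger k)) \<or> (\<exists>n\<ge>3. embeds W (ddagger n))"

lemma embeds_mono: "embeds W F \<Longrightarrow> W \<subseteq> W' \<Longrightarrow> embeds W' F"
  unfolding embeds_def by (meson subset_trans)

lemma obstructed_mono: "obstructed W \<Longrightarrow> W \<subseteq> W' \<Longrightarrow> obstructed W'"
  unfolding obstructed_def by (elim disjE exE conjE; drule (1) embeds_mono; blast)

lemma embeds_long_claw:
  assumes W: "{c, a1, a2, a3, b1, b2, b3} \<subseteq> W" and d: "distinct [c, a1, a2, a3, b1, b2, b3]"
    and e: "adj c a1" "adj c a2" "adj c a3" "adj a1 b1" "adj a2 b2" "adj a3 b3"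
    and n: "\<not> adj c b1" "\<not> adj c b2" "\<not> adj c b3" "\<not> adj a1 a2" "\<not> adj a1 a3" "\<not> adj a2 a3"
      "\<not> adj a1 b2" "\<not> adj a1 b3" "\<not> adj a2 b1" "\<not> adj a2 b3" "\<not> adj a3 b1" "\<not> adj a3 b2"
      "\<not> adj b1 b2" "\<not> adj b1 b3" "\<not> adj b2 b3"
  shows "embeds W long_claw"
proof -
  define f where "f x = (case x of LC_c \<Rightarrow> c | LC_a i \<Rightarrow> (if i = 1 then a1 else if i = 2 then a2 else a3)
     | LC_b i \<Rightarrow> (if i = 1 then b1 else if i = 2 then b2 else b3))" for x
  have f: "f LC_c = c" "f (LC_a 1) = a1" "f (LC_a 2) = a2" "f (LC_a 3) = a3"
    "f (LC_b 1) = b1" "f (LC_b 2) = b2" "f (LC_b 3) = b3"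
    unfolding f_def by simp_all
  have n': "\<not> adj x y \<Longrightarrow> \<not> adj y x" for x y using sym by blast
  show ?thesis
    unfolding embeds_def
  proof (intro exI[of _ f] conjI)
    show "inj_on f (pverts long_claw)" unfolding long_claw_verts inj_on_def using d by (auto simp: f simp del: One_nat_def)
    show "f ` pverts long_claw \<subseteq> W" unfolding long_claw_verts using W by (simp add: f del: One_nat_def)
    show "\<forall>x\<in>pverts long_claw. \<forall>y\<in>pverts long_claw. ((x, y) \<in> parcs long_claw) = adj (f x) (f y)"
      unfolding long_claw_verts by (simp add: long_claw_arcs f e e[THEN sym] n n[THEN n'] irrefl del: One_nat_def)
  qed
qed

lemma embeds_whipping_top:
  assumes W: "{x1, x2, x3, x4, x5, y, z} \<subseteq> W" and d: "distinct [x1, x2, x3, x4, x5, y, z]"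
    and e: "adj x1 x2" "adj x2 x3" "adj x3 x4" "adj x4 x5" "adj y x1" "adj y x2" "adj y x3" "adj y x4" "adj y x5" "adj z x3"
    and n: "\<not> adj x1 x3" "\<not> adj x1 x4" "\<not> adj x1 x5" "\<not> adj x2 x4" "\<not> adj x2 x5" "\<not> adj x3 x5"
      "\<not> adj z x1" "\<not> adj z x2" "\<not> adj z x4" "\<not> adj z x5" "\<not> adj z y"
  shows "embeds W whipping_top"
proof -
  define f where "f v = (case v of WT_x i \<Rightarrow> (if i = 1 then x1 else if i = 2 then x2 else if i = 3 then x3 else if i = 4 then x4 else x5)
     | WT_y \<Rightarrow> y | WT_z \<Rightarrow> z)" for v
  have f: "f (WT_x 1) = x1" "f (WT_x 2) = x2" "f (WT_x 3) = x3" "f (WT_x 4) = x4" "f (WT_x 5) = x5" "f WT_y = y" "f WT_z = z"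
    unfolding f_def by simp_all
  have n': "\<not> adj x y \<Longrightarrow> \<not> adj y x" for x y using sym by blast
  show ?thesis
    unfolding embeds_def
  proof (intro exI[of _ f] conjI)
    show "inj_on f (pverts whipping_top)" unfolding whipping_top_verts inj_on_def using d by (auto simp: f simp del: One_nat_def)
    show "f ` pverts whipping_top \<subseteq> W" unfolding whipping_top_verts using W by (simp add: f del: One_nat_def)
    show "\<forall>x\<in>pverts whipping_top. \<forall>y\<in>pverts whipping_top. ((x, y) \<in> parcs whipping_top) = adj (f x) (f y)"
      unfolding whipping_top_verts by (simp add: whipping_top_arcs f e e[THEN sym] n n[THEN n'] irrefl del: One_nat_def)
  qed
qed

lemma embeds_dagger:
  assumes k: "2 \<le> k" and W: "{c, p, q, s} \<subseteq> W" "\<And>i. i < k \<Longrightarrow> v i \<in> W"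
    and inj: "\<And>i j. i < k \<Longrightarrow> j < k \<Longrightarrow> v i = v j \<Longrightarrow> i = j" "\<And>i. i < k \<Longrightarrow> v i \<notin> {c, p, q, s}" "distinct [c, p, q, s]"
    and vv: "\<And>i j. i < k \<Longrightarrow> j < k \<Longrightarrow> adj (v i) (v j) \<longleftrightarrow> j = Suc i \<or> i = Suc j"
    and cv: "\<And>i. i < k \<Longrightarrow> adj c (v i)"
    and pv: "\<And>i. i < k \<Longrightarrow> adj p (v i) \<longleftrightarrow> i = 0"
    and qv: "\<And>i. i < k \<Longrightarrow> adj q (v i) \<longleftrightarrow> Suc i = k"
    and sv: "\<And>i. i < k \<Longrightarrow> \<not> adj s (v i)"
    and r: "adj s c" "\<not> adj p q" "\<not> adj p c" "\<not> adj p s" "\<not> adj q c" "\<not> adj q s"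
  shows "embeds W (dagger k)"
proof -
  define f where "f x = (case x of Dag_v i \<Rightarrow> v (i - 1) | Dag_c \<Rightarrow> c | Dag_p \<Rightarrow> p | Dag_q \<Rightarrow> q | Dag_s \<Rightarrow> s)" for x
  have f: "f (Dag_v (Suc i)) = v i" "f Dag_c = c" "f Dag_p = p" "f Dag_q = q" "f Dag_s = s" for i
    unfolding f_def by simp_all
  have n': "\<not> adj x y \<Longrightarrow> \<not> adj y x" for x y using sym by blast
  show ?thesis
    unfolding embeds_def
  proof (intro exI[of _ f] conjI ballI)
    have ne: "v i \<noteq> c" "v i \<noteq> p" "v i \<noteq> q" "v i \<noteq> s" if "i < k" for i using inj(2)[OF that] by auto
    show "inj_on f (pverts (dagger k))"
    proof (rule inj_onI)
      fix x y assume "x \<in> pverts (dagger k)" "y \<in> pverts (dagger k)" "f x = f y"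
      then show "x = y" unfolding dagger_verts using inj(3) by (auto simp: f ne ne[symmetric] dest: inj(1))
    qed
    show "f ` pverts (dagger k) \<subseteq> W" using W by (auto simp: f dagger_verts)
    fix x y assume "x \<in> pverts (dagger k)" "y \<in> pverts (dagger k)"
    then show "((x, y) \<in> parcs (dagger k)) = adj (f x) (f y)"
      unfolding dagger_verts using k
      by (elim disjE exE conjE insertE emptyE; simp add: dagger_arcs f vv cv cv[THEN sym] pv qv sv sv[THEN n'] r(1) r(1)[THEN sym] r(2-) r(2-)[THEN n'] irrefl
        commute[of "v _" p] commute[of "v _" q])
  qed
qed

lemma embeds_ddagger:
  assumes k: "3 \<le> k" and W: "{u, w, t} \<subseteq> W" "\<And>i. i < k \<Longrightarrow> x i \<in> W"
    and inj: "\<And>i j. i < k \<Longrightarrow> j < k \<Longrightarrow> x i = x j \<Longrightarrow> i = j" "\<And>i. i < k \<Longrightarrow> x i \<notin> {u, w, t}" "distinct [u, w, t]"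
    and xx: "\<And>i j. i < k \<Longrightarrow> j < k \<Longrightarrow> adj (x i) (x j) \<longleftrightarrow> j = Suc i \<or> i = Suc j"
    and ux: "\<And>i. i < k \<Longrightarrow> adj u (x i) \<longleftrightarrow> Suc i \<noteq> k"
    and wx: "\<And>i. i < k \<Longrightarrow> adj w (x i) \<longleftrightarrow> i \<noteq> 0"
    and tx: "\<And>i. i < k \<Longrightarrow> \<not> adj t (x i)"
    and r: "adj u w" "adj t u" "adj t w"
  shows "embeds W (ddagger k)"
proof -
  define f where "f y = (case y of DDag_x i \<Rightarrow> x (i - 1) | DDag_u \<Rightarrow> u | DDag_v \<Rightarrow> w | DDag_w \<Rightarrow> t)" for y
  have f: "f (DDag_x (Suc i)) = x i" "f DDag_u = u" "f DDag_v = w" "f DDag_w = t" for i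
    unfolding f_def by simp_all
  have n': "\<not> adj x y \<Longrightarrow> \<not> adj y x" for x y using sym by blast
  show ?thesis
    unfolding embeds_def
  proof (intro exI[of _ f] conjI ballI)
    have ne: "x i \<noteq> u" "x i \<noteq> w" "x i \<noteq> t" if "i < k" for i using inj(2)[OF that] by auto
    show "inj_on f (pverts (ddagger k))"
    proof (rule inj_onI)
      fix x y assume "x \<in> pverts (ddagger k)" "y \<in> pverts (ddagger k)" "f x = f y"
      then show "x = y" unfolding ddagger_verts using inj(3) by (auto simp: f ne ne[symmetric] dest: inj(1))
    qed
    show "f ` pverts (ddagger k) \<subseteq> W" using W by (auto simp: f ddagger_verts)
    have sym': "adj (x i) u \<longleftrightarrow> Suc i \<noteq> k" "adj (x i) w \<longleftrightarrow> i \<noteq> 0" "\<not> adj (x i) t" if "i < k" for i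
      using ux wx tx commute that by blast+
    have le: "Suc i \<le> k - Suc 0 \<longleftrightarrow> Suc i \<noteq> k" "2 \<le> Suc i \<longleftrightarrow> i \<noteq> 0" "Suc 0 \<le> i \<longleftrightarrow> 0 < i" if "i < k" for i
      using that by auto
    fix x' y' assume "x' \<in> pverts (ddagger k)" "y' \<in> pverts (ddagger k)"
    then show "((x', y') \<in> parcs (ddagger k)) = adj (f x') (f y')"
      unfolding ddagger_verts
      by (elim disjE exE conjE insertE emptyE)
        (simp_all add: ddagger_arcs f xx ux wx tx r r[THEN sym] irrefl sym' le)
  qed
qed

subsection \<open>Forbidden subgraphs from asteroidal triples\<close>

text \<open>Chordality applied to the stretch from \<open>i\<close> to \<open>j\<close>: the
  neighbours of a vertex off an induced path are consecutive on it.\<close>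

lemma chordal_segment:
  assumes ch: "chordal W" and p: "ipath xs" "set xs \<subseteq> W" and u: "u \<in> W" "u \<notin> set xs"
    and ij: "i \<le> k" "k \<le> j" "j < length xs" and e: "adj u (xs ! i)" "adj u (xs ! j)"
  shows "adj u (xs ! k)"
proof -
  let ?ys = "drop i (take (Suc j) xs)"
  have sub: "set ?ys \<subseteq> set xs" by (meson set_drop_subset set_take_subset subset_trans)
  have len: "length ?ys = Suc j - i" using ij by simp
  have nth: "?ys ! m = xs ! (i + m)" if "m < Suc j - i" for m using that ij by simp
  have "0 < length ?ys" unfolding len using ij by linarith
  then have ne: "?ys \<noteq> []" by (rule length_greater_0_conv[THEN iffD1])
  have "hd ?ys = xs ! i" using hd_conv_nth[OF ne] nth[of 0] ij by simp
  moreover have "last ?ys = xs ! j" using last_conv_nth[OF ne] nth[of "j - i"] len ij by simp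
  moreover have "xs ! k \<in> set ?ys"
    using nth[of "k - i"] nth_mem[of "k - i" ?ys] len ij by simp
  moreover have "ipath ?ys" using ipath_drop ipath_take p(1) by blast
  ultimately show ?thesis using chordalD[OF ch, of ?ys u] sub p(2) u e by auto
qed

text \<open>By \<open>chordal_segment\<close>, \<open>u\<close> sees the path up to some
  \<open>i\<close> and \<open>w\<close> sees it from some \<open>j\<close> on. Chordality forces
  these stretches to overlap, and the path from \<open>j - 1\<close> to \<open>i + 1\<close> with
  \<open>u\<close>, \<open>w\<close>, \<open>c\<close> is the obstruction.\<close>

lemma ddagger_of_path:
  assumes ch: "chordal W" and p: "ipath xs" "set xs \<subseteq> W - cnb c" "xs \<noteq> []"
    and W: "u \<in> W" "w \<in> W" "c \<in> W" and e: "adj c u" "adj c w" "adj u w"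
    and u: "adj u (hd xs)" "\<not> adj u (last xs)" and w: "adj w (last xs)" "\<not> adj w (hd xs)"
  shows "obstructed W"
proof -
  define n where "n = length xs"
  have n: "0 < n" "hd xs = xs ! 0" "last xs = xs ! (n - 1)" unfolding n_def using p(3) by (auto simp: hd_conv_nth last_conv_nth)
  have pW: "set xs \<subseteq> W" using p(2) by blast
  have notin: "u \<notin> set xs" "w \<notin> set xs" "c \<notin> set xs" using p(2) e by (auto simp: cnb_iff)
  have cx: "\<not> adj c (xs ! i)" if "i < n" for i using subsetD[OF p(2) nth_mem[of i xs]] that unfolding n_def by (simp add: cnb_iff)
  define I where "I = {i. i < n \<and> adj u (xs ! i)}"
  define J where "J = {i. i < n \<and> adj w (xs ! i)}"
  have fin: "finite I" "finite J" unfolding I_def J_def by auto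
  have "0 \<in> I" "n - 1 \<in> J" using n u w unfolding I_def J_def by auto
  then have ne: "I \<noteq> {}" "J \<noteq> {}" by auto
  define i where "i = Max I"
  define j where "j = Min J"
  have iI: "i \<in> I" "\<And>k. k \<in> I \<Longrightarrow> k \<le> i" unfolding i_def using Max_in[OF fin(1) ne(1)] Max_ge[OF fin(1)] by auto
  have jJ: "j \<in> J" "\<And>k. k \<in> J \<Longrightarrow> j \<le> k" unfolding j_def using Min_in[OF fin(2) ne(2)] Min_le[OF fin(2)] by auto
  have ui: "adj u (xs ! k) \<longleftrightarrow> k \<le> i" if "k < n" for k
  proof
    assume "k \<le> i"
    moreover have "i < length xs" "adj u (xs ! i)" using iI(1) unfolding I_def n_def by auto
    ultimately show "adj u (xs ! k)" using chordal_segment[OF ch p(1) pW W(1) notin(1), of 0 k i] u(1) n(2) by simp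
  qed (use iI(2) that I_def in blast)
  have wj: "adj w (xs ! k) \<longleftrightarrow> j \<le> k" if "k < n" for k
  proof
    assume "j \<le> k"
    moreover have "adj w (xs ! j)" using jJ(1) unfolding J_def by auto
    ultimately show "adj w (xs ! k)"
      using chordal_segment[OF ch p(1) pW W(2) notin(2), of j k "n - 1"] w(1) n that unfolding n_def by simp
  qed (use jJ(2) that J_def in blast)
  have bnd: "i < n" "j < n" using iI(1) jJ(1) unfolding I_def J_def by auto
  have "i \<noteq> n - 1" using ui[of "n - 1"] u(2) n by auto
  then have i: "Suc i < n" using bnd by linarith
  have j: "0 < j" using wj[of 0] w(2) n by auto
  \<comment> \<open>Otherwise \<open>u\<close> followed by the path from \<open>i\<close> to
    \<open>j\<close> is an induced path whose two ends are adjacent to \<open>w\<close>, so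
    \<open>w\<close> would be adjacent to position \<open>i\<close>, before
    \<open>j\<close>.\<close>
  have "j \<le> i"
  proof (rule ccontr)
    assume ij: "\<not> j \<le> i"
    let ?ys = "drop i (take (Suc j) xs)"
    have sub: "set ?ys \<subseteq> set xs" by (meson set_drop_subset set_take_subset subset_trans)
    have len: "length ?ys = Suc j - i" using bnd unfolding n_def by simp
    have nth: "?ys ! m = xs ! (i + m)" if "m < Suc j - i" for m using that bnd unfolding n_def by simp
    have "0 < length ?ys" unfolding len using ij by linarith
    then have ne: "?ys \<noteq> []" by (rule length_greater_0_conv[THEN iffD1])
    have hd: "hd ?ys = xs ! i" using hd_conv_nth[OF ne] nth[of 0] ij by simp
    have last: "last ?ys = xs ! j" using last_conv_nth[OF ne] nth[of "j - i"] len ij by simp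
    have ip: "ipath ?ys" using ipath_drop ipath_take p(1) by blast
    have "adj u y \<longleftrightarrow> y = hd ?ys" if "y \<in> set ?ys" for y
    proof -
      obtain m where m: "m < Suc j - i" "y = xs ! (i + m)" using \<open>y \<in> set ?ys\<close> len nth by (metis in_set_conv_nth)
      then have mn: "i + m < n" using bnd by linarith
      have "adj u y \<longleftrightarrow> m = 0" using m ui[OF mn] by simp
      also have "\<dots> \<longleftrightarrow> y = hd ?ys" unfolding hd m(2)
        using nth_eq_iff_index_eq[OF ipath_distinct[OF p(1)], of "i + m" i] mn bnd unfolding n_def by simp
      finally show ?thesis .
    qed
    then have 1: "ipath (u # ?ys)" using ip sub notin(1) by auto
    have 2: "set (u # ?ys) \<subseteq> W" using sub pW W(1) by auto
    have 3: "w \<notin> set (u # ?ys)" using sub notin(2) e(3) irrefl by auto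
    have 4: "adj w (hd (u # ?ys))" using sym[OF e(3)] by simp
    have 5: "adj w (last (u # ?ys))" using last ne wj[of j] bnd by simp
    have 6: "xs ! i \<in> set (u # ?ys)" using hd_in_set[OF ne] hd by simp
    have "adj w (xs ! i)" by (rule chordalD[OF ch 1 2 W(2) 3 4 5 6])
    then show False using wj[OF bnd(1)] ij by simp
  qed
  \<comment> \<open>Positions \<open>j - 1\<close> to \<open>i + 1\<close>: the overlap plus one
    vertex on either side, the first missed by \<open>w\<close> and the last by
    \<open>u\<close>.\<close>
  define k where "k = i - j + 3"
  define x where "x m = xs ! (j - 1 + m)" for m
  have idx: "j - 1 + m < n" if "m < k" for m using that i j \<open>j \<le> i\<close> unfolding k_def by linarith
  have inx: "x m \<in> set xs" if "m < k" for m using idx[OF that] unfolding x_def n_def by simp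
  have "embeds W (ddagger k)"
  proof (rule embeds_ddagger[of k u w c W x])
    show "3 \<le> k" unfolding k_def by simp
    show "{u, w, c} \<subseteq> W" using W by simp
    show "x m \<in> W" if "m < k" for m using inx[OF that] pW by blast
    show "m = m'" if "m < k" "m' < k" "x m = x m'" for m m'
      using that nth_eq_iff_index_eq[OF ipath_distinct[OF p(1)]] idx[of m] idx[of m'] unfolding x_def n_def by simp
    show "x m \<notin> {u, w, c}" if "m < k" for m using inx[OF that] notin by auto
    show "distinct [u, w, c]" using e irrefl by auto
    show "adj (x m) (x m') \<longleftrightarrow> m' = Suc m \<or> m = Suc m'" if "m < k" "m' < k" for m m'
      using ipath_nth[OF p(1)] idx[OF that(1)] idx[OF that(2)] unfolding x_def n_def by auto
    show "adj u (x m) \<longleftrightarrow> Suc m \<noteq> k" if "m < k" for m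
      using ui[OF idx[OF that]] that j \<open>j \<le> i\<close> unfolding x_def k_def by auto
    show "adj w (x m) \<longleftrightarrow> m \<noteq> 0" if "m < k" for m
      using wj[OF idx[OF that]] j unfolding x_def by auto
    show "\<not> adj c (x m)" if "m < k" for m using cx[OF idx[OF that]] unfolding x_def .
  qed (use e in auto)
  moreover have "3 \<le> k" unfolding k_def by simp
  ultimately show ?thesis unfolding obstructed_def by blast
qed

text \<open>The neighbours of \<open>\<alpha>\<close> occupy positions \<open>i\<close> to
  \<open>j\<close>, away from both ends. If \<open>i < j\<close>, then \<open>\<alpha>\<close> is
  the hub of a dagger with pendant \<open>a\<close>. If \<open>i = j\<close> has two path vertices
  on each side, these with \<open>\<alpha>\<close> and \<open>a\<close> form a long claw.\<close>

lemma single_neighbour_on_path: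
  assumes ch: "chordal W" and p: "ipath xs" "set xs \<subseteq> W - cnb a"
    and W: "a \<in> W" "\<alpha> \<in> W" and e: "adj a \<alpha>"
    and ends: "\<not> adj \<alpha> (xs ! 0)" "\<not> adj \<alpha> (xs ! (length xs - 1))"
    and hit: "x \<in> set xs" "adj \<alpha> x" and no: "\<not> obstructed W"
  shows "\<exists>i. (i = 1 \<or> i = length xs - 2) \<and> (\<forall>k<length xs. adj \<alpha> (xs ! k) \<longleftrightarrow> k = i)"
proof -
  define n where "n = length xs"
  have pW: "set xs \<subseteq> W" using p(2) by blast
  have notin: "\<alpha> \<notin> set xs" "a \<notin> set xs" using p(2) e by (auto simp: cnb_iff)
  have ax: "\<not> adj a (xs ! i)" if "i < n" for i using subsetD[OF p(2) nth_mem[of i xs]] that unfolding n_def by (simp add: cnb_iff)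
  define I where "I = {i. i < n \<and> adj \<alpha> (xs ! i)}"
  have fin: "finite I" unfolding I_def by auto
  obtain m where "m < n" "x = xs ! m" using hit(1) unfolding n_def by (metis in_set_conv_nth)
  then have ne: "I \<noteq> {}" using hit(2) unfolding I_def by auto
  define i where "i = Min I"
  define j where "j = Max I"
  have iI: "i \<in> I" "\<And>k. k \<in> I \<Longrightarrow> i \<le> k" unfolding i_def using Min_in[OF fin ne] Min_le[OF fin] by auto
  have jI: "j \<in> I" "\<And>k. k \<in> I \<Longrightarrow> k \<le> j" unfolding j_def using Max_in[OF fin ne] Max_ge[OF fin] by auto
  have bnd: "i < n" "j < n" "i \<le> j" "adj \<alpha> (xs ! i)" "adj \<alpha> (xs ! j)" using iI jI unfolding I_def by auto
  have al: "adj \<alpha> (xs ! k) \<longleftrightarrow> i \<le> k \<and> k \<le> j" if "k < n" for k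
  proof
    assume "i \<le> k \<and> k \<le> j"
    then show "adj \<alpha> (xs ! k)"
      using chordal_segment[OF ch p(1) pW W(2) notin(1), of i k j] bnd unfolding n_def by simp
  qed (use iI(2) jI(2) that I_def in blast)
  have "i \<noteq> 0" using ends(1) bnd(4) by metis
  then have i: "0 < i" by simp
  have "j \<noteq> n - 1" using ends(2) bnd(5) unfolding n_def by metis
  then have j: "Suc j < n" using bnd by linarith
  have eq: "xs ! k = xs ! l \<longleftrightarrow> k = l" if "k < n" "l < n" for k l
    using nth_eq_iff_index_eq[OF ipath_distinct[OF p(1)]] that unfolding n_def by simp
  have path: "adj (xs ! k) (xs ! l) \<longleftrightarrow> l = Suc k \<or> k = Suc l" if "k < n" "l < n" for k l
    using ipath_nth[OF p(1)] that unfolding n_def by simp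
  have inW: "xs ! k \<in> W" "xs ! k \<noteq> \<alpha>" "xs ! k \<noteq> a" if "k < n" for k
    using pW notin nth_mem[of k xs] that unfolding n_def by auto
  have aal: "a \<noteq> \<alpha>" using e irrefl by auto
  have "i = j"
  proof (rule ccontr)
    assume "i \<noteq> j"
    then have ij: "i < j" using bnd by simp
    \<comment> \<open>The number of neighbours of \<open>\<alpha>\<close> on the path; the positions
      just before and after them supply the two end vertices of the dagger.\<close>
    define k where "k = Suc j - i"
    have idx: "i + m < n" if "m < k" for m using that bnd unfolding k_def by linarith
    have "embeds W (dagger k)"
    proof (rule embeds_dagger[of k \<alpha> "xs ! (i - 1)" "xs ! Suc j" a W "\<lambda>m. xs ! (i + m)"])
      show "2 \<le> k" using ij unfolding k_def by simp
      show "{\<alpha>, xs ! (i - 1), xs ! Suc j, a} \<subseteq> W" using W inW[of "i - 1"] inW[of "Suc j"] i j bnd by auto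
      show "xs ! (i + m) \<in> W" if "m < k" for m using inW idx that by blast
      show "m = m'" if "m < k" "m' < k" "xs ! (i + m) = xs ! (i + m')" for m m' using eq idx that by simp
      show "xs ! (i + m) \<notin> {\<alpha>, xs ! (i - 1), xs ! Suc j, a}" if "m < k" for m
        using inW[OF idx[OF that]] eq[OF idx[OF that], of "i - 1"] eq[OF idx[OF that], of "Suc j"] i j bnd that unfolding k_def by auto
      show "distinct [\<alpha>, xs ! (i - 1), xs ! Suc j, a]"
      proof -
        have "i - 1 < n" "i - 1 \<noteq> Suc j" using bnd by linarith+
        then show ?thesis using inW(2,3)[of "i - 1"] inW(2,3)[of "Suc j"] eq[of "i - 1" "Suc j"] aal j by auto
      qed
      show "adj (xs ! (i + m)) (xs ! (i + m')) \<longleftrightarrow> m' = Suc m \<or> m = Suc m'" if "m < k" "m' < k" for m m'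
        using path[OF idx[OF that(1)] idx[OF that(2)]] by auto
      show "adj \<alpha> (xs ! (i + m))" if "m < k" for m using al[OF idx[OF that]] that unfolding k_def by auto
      show "adj (xs ! (i - 1)) (xs ! (i + m)) \<longleftrightarrow> m = 0" if "m < k" for m
        using path[OF _ idx[OF that], of "i - 1"] i bnd by auto
      show "adj (xs ! Suc j) (xs ! (i + m)) \<longleftrightarrow> Suc m = k" if "m < k" for m
        using path[OF _ idx[OF that], of "Suc j"] i j bnd that unfolding k_def by auto
      show "\<not> adj a (xs ! (i + m))" if "m < k" for m using ax idx that by blast
      show "adj a \<alpha>" by (rule e)
      show "\<not> adj (xs ! (i - 1)) (xs ! Suc j)" using path[of "i - 1" "Suc j"] i j bnd by auto
      show "\<not> adj (xs ! (i - 1)) \<alpha>" "\<not> adj (xs ! Suc j) \<alpha>"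
        using al[of "i - 1"] al[of "Suc j"] i j bnd commute[of \<alpha>] by auto
      show "\<not> adj (xs ! (i - 1)) a" "\<not> adj (xs ! Suc j) a" using ax[of "i - 1"] ax[of "Suc j"] j bnd commute[of a] by auto
    qed
    moreover have "2 \<le> k" using ij unfolding k_def by simp
    ultimately show False using no unfolding obstructed_def by blast
  qed
  moreover have "i = 1 \<or> i = n - 2"
  proof (rule ccontr)
    assume "\<not> (i = 1 \<or> i = n - 2)"
    then have i2: "2 \<le> i" "i + 2 < n" using i j \<open>i = j\<close> by linarith+
    \<comment> \<open>Five consecutive path vertices with the neighbour of \<open>\<alpha>\<close>
      in the middle, as \<open>y 2\<close>.\<close>
    define y where "y s = xs ! (i - 2 + s)" for s
    have l: "i - 2 + s < n" if "s < 5" for s using that i2 by linarith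
    have yp: "adj (y s) (y t) \<longleftrightarrow> t = Suc s \<or> s = Suc t" if "s < 5" "t < 5" for s t
      using path[OF l[OF that(1)] l[OF that(2)]] unfolding y_def by simp
    have ye: "y s = y t \<longleftrightarrow> s = t" if "s < 5" "t < 5" for s t
      using eq[OF l[OF that(1)] l[OF that(2)]] unfolding y_def by simp
    have ya: "\<not> adj a (y s)" "\<not> adj (y s) a" if "s < 5" for s
      using ax[OF l[OF that]] commute[of a] unfolding y_def by blast+
    have "i - 2 + s = i \<longleftrightarrow> s = 2" for s using i2 by linarith
    then have yal: "adj \<alpha> (y s) \<longleftrightarrow> s = 2" "adj (y s) \<alpha> \<longleftrightarrow> s = 2" if "s < 5" for s
      using al[OF l[OF that]] commute[of \<alpha>] \<open>i = j\<close> unfolding y_def by (metis le_antisym order_refl)+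
    have yW: "y s \<in> W" "y s \<noteq> \<alpha>" "y s \<noteq> a" "\<alpha> \<noteq> y s" "a \<noteq> y s" if "s < 5" for s
      using inW[OF l[OF that]] unfolding y_def by auto
    have "embeds W long_claw"
      by (rule embeds_long_claw[of "y 2" \<alpha> "y 1" "y 3" a "y 0" "y 4"])
        (simp_all add: yp ye ya yal yW W aal aal[symmetric] e sym[OF e])
    then show False using no unfolding obstructed_def by blast
  qed
  ultimately show ?thesis using al unfolding n_def by (intro exI[of _ i]) auto
qed

text \<open>Proper subsets must be free of all asteroidal triples, not only of \<open>a\<close>,
  \<open>b\<close>, \<open>c\<close>; this allows a corner to be replaced by another vertex.\<close>

definition min_AT :: "'a set \<Rightarrow> 'a \<Rightarrow> 'a \<Rightarrow> 'a \<Rightarrow> bool" where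
  "min_AT W a b c \<longleftrightarrow> chordal W \<and> asteroidal W a b c \<and> (\<forall>W'. W' \<subset> W \<longrightarrow> (\<forall>x y z. \<not> asteroidal W' x y z))"

lemma min_AT_swap1: "min_AT W a b c \<Longrightarrow> min_AT W b a c"
  unfolding min_AT_def by (elim conjE, intro conjI) (assumption | erule asteroidal_swap1)+

lemma min_AT_swap2: "min_AT W a b c \<Longrightarrow> min_AT W a c b"
  unfolding min_AT_def by (elim conjE, intro conjI) (assumption | erule asteroidal_swap2)+

lemma asteroidal_nonadj:
  assumes "asteroidal W a b c"
  shows "a \<in> W" "b \<in> W" "c \<in> W" "a \<noteq> b" "a \<noteq> c" "b \<noteq> c" "\<not> adj a b" "\<not> adj a c" "\<not> adj b c" "\<not> adj b a" "\<not> adj c a" "\<not> adj c b"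
proof -
  have *: "b \<in> W - cnb a" "c \<in> W - cnb a" "a \<in> W - cnb b" "c \<in> W - cnb b" "a \<in> W - cnb c" "b \<in> W - cnb c"
    using assms joined_mem unfolding asteroidal_def by blast+
  then show "a \<in> W" "b \<in> W" "c \<in> W" "a \<noteq> b" "a \<noteq> c" "b \<noteq> c" "\<not> adj a b" "\<not> adj a c" "\<not> adj b c" "\<not> adj b a" "\<not> adj c a" "\<not> adj c b"
    by (auto simp: cnb_iff)
qed

lemma min_AT_nonadj:
  assumes "min_AT W a b c"
  shows "a \<in> W" "b \<in> W" "c \<in> W" "a \<noteq> b" "a \<noteq> c" "b \<noteq> c" "\<not> adj a b" "\<not> adj a c" "\<not> adj b c" "\<not> adj b a" "\<not> adj c a" "\<not> adj c b"
proof -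
  have "asteroidal W a b c" using assms unfolding min_AT_def by blast
  then show "a \<in> W" "b \<in> W" "c \<in> W" "a \<noteq> b" "a \<noteq> c" "b \<noteq> c" "\<not> adj a b" "\<not> adj a c" "\<not> adj b c" "\<not> adj b a" "\<not> adj c a" "\<not> adj c b"
    by (rule asteroidal_nonadj)+
qed

text \<open>Let \<open>C\<close> be the component of \<open>W - N[a]\<close> containing
  \<open>b\<close> and \<open>c\<close>, with boundary \<open>X\<close>. The triple already lives on
  \<open>a\<close>, \<open>X\<close> and \<open>C\<close>, so by minimality these are everything,
  and the neighbourhood of \<open>a\<close> is the clique \<open>X\<close>.\<close>

lemma min_AT_clique:
  assumes m: "min_AT W a b c" shows "clique {x \<in> W. adj a x}"
proof -
  have ch: "chordal W" and AT: "asteroidal W a b c" using m unfolding min_AT_def by blast+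
  note nadj = min_AT_nonadj[OF m]
  define C where "C = comp (W - cnb a) b"
  define X where "X = {x \<in> W. x \<in> cnb a \<and> (\<exists>c\<in>C. adj c x)}"
  have cl: "clique X" and aX: "\<And>x. x \<in> X \<Longrightarrow> adj a x"
    using clique_boundary[OF ch nadj(1) C_def] unfolding X_def by blast+
  have C: "C \<subseteq> W - cnb a" unfolding C_def by (rule comp_sub)
  have bC: "b \<in> C" unfolding C_def using nadj by (intro comp_self) (auto simp: cnb_iff)
  have cC: "c \<in> C" using AT unfolding C_def comp_def asteroidal_def by blast
  define V where "V = insert a (X \<union> C)"
  have VW: "V \<subseteq> W" unfolding V_def X_def using C nadj(1) by blast
  have conn: "joined (V - cnb d) x a" if x: "x \<in> C" and d: "d \<in> W" "d \<notin> cnb a" and j: "joined (W - cnb d) x a" for x d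
  proof -
    have ad: "a \<in> V - cnb d" unfolding V_def using d(2) cnb_commute[of a d] by blast
    \<comment> \<open>A walk from \<open>x\<close> is followed as long as it stays in
      \<open>C\<close>. When it leaves \<open>C\<close> it enters \<open>X\<close>, and one more
      step reaches \<open>a\<close>.\<close>
    have "joined (V - cnb d) x y \<and> y \<in> C \<or> joined (V - cnb d) x a" if "joined (W - cnb d) x y" for y
      using that
    proof (induction rule: joined_induct)
      case refl
      then show ?case using x joined_refl[of x "V - cnb d"] unfolding V_def by blast
    next
      case (step y z)
      show ?case
      proof (cases "joined (V - cnb d) x a")
        case False
        then have y: "joined (V - cnb d) x y" "y \<in> C" using step by blast+
        show ?thesis
        proof (cases "z \<in> cnb a")
          case True
          then have zX: "z \<in> X" using step y(2) unfolding X_def by blast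
          then have "z \<in> V - cnb d" using step unfolding V_def by blast
          then have "joined (V - cnb d) x z" using joined_step[OF y(1)] step by blast
          then have "joined (V - cnb d) x a" using joined_step ad sym[OF aX[OF zX]] by blast
          then show ?thesis ..
        next
          case False
          then have "z \<in> C" using comp_step[of y "W - cnb a" b z] y(2) step unfolding C_def by blast
          moreover have "z \<in> V - cnb d" using calculation step unfolding V_def by blast
          ultimately show ?thesis using joined_step[OF y(1)] step by blast
        qed
      qed simp
    qed
    from this[OF j] show ?thesis using C by (auto simp: cnb_iff)
  qed
  have "asteroidal V a b c"
    unfolding asteroidal_def
  proof (intro conjI)
    show "a \<in> V" "b \<in> V" "c \<in> V" unfolding V_def using bC cC by blast+
    have "joined C b c" using comp_joined bC cC unfolding C_def by blast
    moreover have "C \<subseteq> V - cnb a" unfolding V_def using C by blast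
    ultimately show "joined (V - cnb a) b c" by (rule joined_mono)
    have "joined (W - cnb b) c a" "joined (W - cnb c) b a" using AT joined_sym unfolding asteroidal_def by blast+
    then have "joined (V - cnb b) c a" "joined (V - cnb c) b a"
      using conn[OF cC nadj(2)] conn[OF bC nadj(3)] nadj by (auto simp: cnb_iff)
    then show "joined (V - cnb b) a c" "joined (V - cnb c) a b" using joined_sym by blast+
  qed
  then have "V = W" using m VW unfolding min_AT_def by blast
  then have "{x \<in> W. adj a x} = X"
    using aX C irrefl[of a] VW unfolding V_def by (auto simp: cnb_iff)
  then show ?thesis using cl by simp
qed

text \<open>A common neighbour of all three corners lies in every closed neighbourhood to be
  avoided, so no connecting path uses it and it can be deleted.\<close>

lemma min_AT_no_common:
  assumes m: "min_AT W a b c" and t: "t \<in> W" "adj a t" "adj b t" "adj c t"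
  shows False
proof -
  have "W - cnb x = W - {t} - cnb x" if "adj x t" for x using that by (auto simp: cnb_iff)
  then have "W - cnb a = W - {t} - cnb a" "W - cnb b = W - {t} - cnb b" "W - cnb c = W - {t} - cnb c" using t by blast+
  moreover have "t \<noteq> a" "t \<noteq> b" "t \<noteq> c" using t irrefl by blast+
  ultimately have "asteroidal (W - {t}) a b c"
    using m unfolding min_AT_def asteroidal_def by (metis Diff_iff singletonD)
  moreover have "W - {t} \<subset> W" using t(1) by blast
  ultimately show False using m unfolding min_AT_def by blast
qed

text \<open>If \<open>\<alpha>\<close> saw nothing on the path, it could take over the role of
  \<open>a\<close>: the path avoids \<open>N[\<alpha>]\<close>, and the walks from \<open>a\<close>
  can start at \<open>\<alpha>\<close> instead. The triple \<open>\<alpha>\<close>,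
  \<open>b\<close>, \<open>c\<close> would then survive the deletion of \<open>a\<close>.\<close>

lemma min_AT_hit:
  assumes m: "min_AT W a b c" and al: "\<alpha> \<in> W" "adj a \<alpha>" "\<not> adj b \<alpha>" "\<not> adj c \<alpha>"
    and p: "ipath xs" "set xs \<subseteq> W - cnb a" "xs \<noteq> []" "hd xs = b" "last xs = c"
  shows "\<exists>x\<in>set xs. adj \<alpha> x"
proof (rule ccontr)
  assume none: "\<not> (\<exists>x\<in>set xs. adj \<alpha> x)"
  note nadj = min_AT_nonadj[OF m]
  have AT: "asteroidal W a b c" using m unfolding min_AT_def by blast
  have ala: "\<alpha> \<noteq> a" "\<alpha> \<noteq> b" "\<alpha> \<noteq> c" using al irrefl nadj by blast+
  have cl: "clique {x \<in> W. adj a x}" by (rule min_AT_clique[OF m])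
  \<comment> \<open>The second vertex on an induced path from \<open>a\<close> lies in the clique of
    neighbours of \<open>a\<close>, so it equals \<open>\<alpha>\<close> or is adjacent to
    it.\<close>
  have moved: "joined (W - {a} - cnb y) \<alpha> z"
    if j: "joined (W - cnb y) a z" and y: "\<alpha> \<notin> cnb y" and z: "z \<noteq> a" for y z
  proof -
    obtain p where p: "ipath p" "set p \<subseteq> W - cnb y" "p \<noteq> []" "hd p = a" "last p = z" using joined_ipath[OF j] .
    obtain q where q: "p = a # q" using p(3,4) by (cases p) auto
    have qne: "q \<noteq> []" using q p(5) z by auto
    have sub: "set q \<subseteq> W - {a} - cnb y" using p(1,2) q by auto
    have a': "adj a (hd q)" "hd q \<in> set q" using p(1) q qne by auto
    have "joined (W - {a} - cnb y) (q ! 0) (q ! (length q - 1))"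
      using p(1) q qne sub by (intro ipath_joined) auto
    then have "joined (W - {a} - cnb y) (hd q) z" using qne p(5) q by (simp add: hd_conv_nth last_conv_nth)
    moreover have "\<alpha> \<in> W - {a} - cnb y" using al(1) ala(1) y by blast
    moreover have "\<alpha> = hd q \<or> adj \<alpha> (hd q)" using cl a' sub al(1,2) unfolding clique_def by blast
    ultimately show ?thesis using joined_trans joined_edge a'(2) sub by (metis subsetD)
  qed
  have na: "\<alpha> \<notin> cnb b" "\<alpha> \<notin> cnb c" using al ala by (auto simp: cnb_iff)
  have sub: "set xs \<subseteq> W - {a} - cnb \<alpha>" using p(2) none al(2) by (auto simp: cnb_iff)
  have "asteroidal (W - {a}) \<alpha> b c"
    unfolding asteroidal_def
  proof (intro conjI)
    show "\<alpha> \<in> W - {a}" "b \<in> W - {a}" "c \<in> W - {a}" using al ala nadj by auto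
    have "joined (W - {a} - cnb \<alpha>) (xs ! 0) (xs ! (length xs - 1))"
      using p(1,3) sub by (intro ipath_joined) auto
    then show "joined (W - {a} - cnb \<alpha>) b c" using p(3,4,5) by (simp add: hd_conv_nth last_conv_nth)
    show "joined (W - {a} - cnb b) \<alpha> c" using moved[OF _ na(1), of c] AT nadj(5) unfolding asteroidal_def by blast
    show "joined (W - {a} - cnb c) \<alpha> b" using moved[OF _ na(2), of b] AT nadj(4) unfolding asteroidal_def by blast
  qed
  moreover have "W - {a} \<subset> W" using nadj(1) by blast
  ultimately show False using m unfolding min_AT_def by blast
qed

text \<open>\<open>min_AT_hit\<close> gives a neighbour of \<open>\<alpha>\<close> on the path, and
  \<open>single_neighbour_on_path\<close> makes it the only one and places it next to an end. With
  at least four vertices the two places differ, hence exactly one of them is adjacent to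
  \<open>\<alpha>\<close>.\<close>

lemma min_AT_second_or_penultimate:
  assumes m: "min_AT W a b c" and no: "\<not> obstructed W"
    and al: "\<alpha> \<in> W" "adj a \<alpha>" "\<not> adj b \<alpha>" "\<not> adj c \<alpha>"
    and p: "ipath xs" "set xs \<subseteq> W - cnb a" "hd xs = b" "last xs = c" and len: "4 \<le> length xs"
  shows "adj \<alpha> (xs ! 1) \<longleftrightarrow> \<not> adj \<alpha> (xs ! (length xs - 2))"
proof -
  have ne: "xs \<noteq> []" using len by auto
  obtain x where x: "x \<in> set xs" "adj \<alpha> x" using min_AT_hit[OF m al p(1,2) ne p(3,4)] by blast
  have "\<not> adj \<alpha> (xs ! 0)" "\<not> adj \<alpha> (xs ! (length xs - 1))"
    using al(3,4) p(3,4) ne commute by (auto simp: hd_conv_nth last_conv_nth)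
  then obtain i where i: "i = 1 \<or> i = length xs - 2" "\<And>k. k < length xs \<Longrightarrow> adj \<alpha> (xs ! k) \<longleftrightarrow> k = i"
    using single_neighbour_on_path[OF _ p(1,2) min_AT_nonadj(1)[OF m] al(1,2) _ _ x no] m unfolding min_AT_def by blast
  have "1 < length xs" "length xs - 2 < length xs" "1 \<noteq> length xs - 2" using len by linarith+
  then show ?thesis using i by metis
qed

text \<open>An induced path with three vertices would have a common neighbour of \<open>a\<close>
  and \<open>b\<close> in the middle, so there are at least four. The facts about its second and
  penultimate vertices are those that \<open>min_AT_second_or_penultimate\<close> asks of
  \<open>\<alpha>\<close>.\<close>

lemma path_between:
  assumes m: "min_AT W a b c" and nc: "\<And>t. t \<in> W \<Longrightarrow> adj a t \<Longrightarrow> \<not> adj b t"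
  obtains xs where "ipath xs" "set xs \<subseteq> W - cnb c" "hd xs = a" "last xs = b" "4 \<le> length xs"
    "adj a (xs ! 1)" "adj b (xs ! (length xs - 2))"
    "\<not> adj b (xs ! 1)" "\<not> adj a (xs ! (length xs - 2))" "xs ! 1 \<in> W" "xs ! (length xs - 2) \<in> W"
    "\<not> adj c (xs ! 1)" "\<not> adj c (xs ! (length xs - 2))"
proof -
  note nadj = min_AT_nonadj[OF m]
  have "joined (W - cnb c) a b" using m unfolding min_AT_def asteroidal_def by blast
  then obtain xs where p: "ipath xs" "set xs \<subseteq> W - cnb c" "xs \<noteq> []" "hd xs = a" "last xs = b" by (rule joined_ipath)
  let ?n = "length xs"
  have ends: "xs ! 0 = a" "xs ! (?n - 1) = b" using p by (auto simp: hd_conv_nth last_conv_nth)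
  have n0: "0 < ?n" using p(3) by simp
  have "?n \<noteq> 1" using ends nadj(4) by auto
  moreover have "?n \<noteq> 2"
  proof
    assume "?n = 2"
    then show False using ipath_nth[OF p(1), of 0 1] ends nadj(7) by simp
  qed
  ultimately have n3: "3 \<le> ?n" using n0 by linarith
  have in': "xs ! k \<in> W - cnb c" if "k < ?n" for k using subsetD[OF p(2) nth_mem[OF that]] .
  have inW: "xs ! k \<in> W" "\<not> adj c (xs ! k)" if "k < ?n" for k using in'[OF that] by (auto simp: cnb_iff)
  have 1: "adj a (xs ! 1)" using ipath_nth[OF p(1), of 0 1] ends n3 n0 by simp
  have idx: "1 < ?n" "?n - 2 < ?n" "?n - 1 < ?n" "?n - 1 = Suc (?n - 2)" using n3 by linarith+
  have 2: "adj b (xs ! (?n - 2))" using ipath_nth[OF p(1) idx(3,2)] ends idx(4) by simp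
  have 3: "\<not> adj b (xs ! 1)" using nc[OF inW(1)[OF idx(1)] 1] .
  have 4: "\<not> adj a (xs ! (?n - 2))" using nc[OF inW(1)[OF idx(2)]] 2 by blast
  have "?n - 2 \<noteq> 1" using 2 3 by metis
  then have "4 \<le> ?n" using n3 by linarith
  then show ?thesis using that[OF p(1,2,4,5) _ 1 2 3 4 inW(1)[OF idx(1)] inW(1)[OF idx(2)] inW(2)[OF idx(1)] inW(2)[OF idx(2)]] by blast
qed

text \<open>\<open>u\<close> misses \<open>b\<close> and \<open>w\<close> misses \<open>a\<close>,
  as no vertex sees all three corners; \<open>u\<close> and \<open>w\<close> are adjacent in the
  clique of neighbours of \<open>c\<close>. So \<open>ddagger_of_path\<close> applies to a path from
  \<open>a\<close> to \<open>b\<close> that avoids \<open>N[c]\<close>.\<close>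

lemma obstructed_two_common:
  assumes m: "min_AT W a b c" and u: "u \<in> W" "adj a u" "adj c u" and w: "w \<in> W" "adj b w" "adj c w"
  shows "obstructed W"
proof -
  note nadj = min_AT_nonadj[OF m]
  have ub: "\<not> adj b u" using min_AT_no_common[OF m u(1,2) _ u(3)] by blast
  have wa: "\<not> adj a w" using min_AT_no_common[OF m w(1) _ w(2,3)] by blast
  have "clique {x \<in> W. adj c x}"
    using min_AT_clique[OF min_AT_swap1[OF min_AT_swap2[OF m]]] .
  moreover have "u \<noteq> w" using u(2) wa by blast
  ultimately have uw: "adj u w" using u w unfolding clique_def by blast
  have "joined (W - cnb c) a b" using m unfolding min_AT_def asteroidal_def by blast
  then obtain xs where p: "ipath xs" "set xs \<subseteq> W - cnb c" "xs \<noteq> []" "hd xs = a" "last xs = b" by (rule joined_ipath)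
  have ch: "chordal W" using m unfolding min_AT_def by blast
  show ?thesis
    by (rule ddagger_of_path[OF ch p(1-3) u(1) w(1) nadj(3) u(3) w(3) uw])
      (use p(4,5) u w ub wa commute in simp_all)
qed

lemma ipath4:
  assumes "adj x y" "adj y z" "adj z w" "\<not> adj x z" "\<not> adj x w" "\<not> adj y w" "x \<noteq> z" "x \<noteq> w" "y \<noteq> w"
  shows "ipath [x, y, z, w]"
  using assms irrefl by auto

text \<open>\<open>c\<close> shares no neighbour with \<open>a\<close> or \<open>b\<close>, but
  \<open>a\<close> and \<open>b\<close> may share one. Assuming no obstruction,
  \<open>min_AT_second_or_penultimate\<close> fixes the adjacencies among the corners' neighbours
  until a whipping top or an induced four-cycle appears.\<close>

lemma obstructed_one_common:
  assumes m: "min_AT W a b c"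
    and ac: "\<And>t. t \<in> W \<Longrightarrow> adj a t \<Longrightarrow> \<not> adj c t" and bc: "\<And>t. t \<in> W \<Longrightarrow> adj b t \<Longrightarrow> \<not> adj c t"
  shows "obstructed W"
proof (rule ccontr)
  assume no: "\<not> obstructed W"
  have ch: "chordal W" using m unfolding min_AT_def by blast
  note nadj = min_AT_nonadj[OF m]
  note mb = min_AT_swap1[OF m]
  note mc = min_AT_swap1[OF min_AT_swap2[OF m]]
  have clA: "adj x y" if "x \<in> W" "y \<in> W" "adj a x" "adj a y" "x \<noteq> y" for x y
    using min_AT_clique[OF m] that unfolding clique_def by blast
  have clB: "adj x y" if "x \<in> W" "y \<in> W" "adj b x" "adj b y" "x \<noteq> y" for x y
    using min_AT_clique[OF mb] that unfolding clique_def by blast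
  have clC: "adj x y" if "x \<in> W" "y \<in> W" "adj c x" "adj c y" "x \<noteq> y" for x y
    using min_AT_clique[OF mc] that unfolding clique_def by blast
  \<comment> \<open>Chordality for a path of three vertices, that is, the exclusion of induced
    four-cycles.\<close>
  have fan3: "adj u y" if "adj x y" "adj y z" "\<not> adj x z" "x \<noteq> z" "x \<in> W" "y \<in> W" "z \<in> W" "u \<in> W" "adj u x" "adj u z" "u \<noteq> y" for u x y z
  proof -
    have "ipath [x, y, z]" using that irrefl by auto
    then show ?thesis using chordalD[OF ch, of "[x, y, z]" u y] that irrefl by auto
  qed
  obtain q where q: "ipath q" "set q \<subseteq> W - cnb b" "hd q = a" "last q = c" "4 \<le> length q"
    "adj a (q ! 1)" "adj c (q ! (length q - 2))" "\<not> adj c (q ! 1)" "\<not> adj a (q ! (length q - 2))" "q ! 1 \<in> W" "q ! (length q - 2) \<in> W"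
    "\<not> adj b (q ! 1)" "\<not> adj b (q ! (length q - 2))"
    using path_between[OF min_AT_swap2[OF m] ac] by blast
  obtain p where p: "ipath p" "set p \<subseteq> W - cnb a" "hd p = b" "last p = c" "4 \<le> length p"
    "adj b (p ! 1)" "adj c (p ! (length p - 2))" "\<not> adj c (p ! 1)" "\<not> adj b (p ! (length p - 2))" "p ! 1 \<in> W" "p ! (length p - 2) \<in> W"
    "\<not> adj a (p ! 1)" "\<not> adj a (p ! (length p - 2))"
    using path_between[OF min_AT_swap2[OF mb] bc] by blast
  define \<alpha> where "\<alpha> = q ! 1"
  define \<gamma>' where "\<gamma>' = q ! (length q - 2)"
  define \<beta> where "\<beta> = p ! 1"
  define \<gamma> where "\<gamma> = p ! (length p - 2)"
  have al: "\<alpha> \<in> W" "adj a \<alpha>" "\<not> adj b \<alpha>" "\<not> adj c \<alpha>" using q unfolding \<alpha>_def by blast+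
  have be: "\<beta> \<in> W" "adj b \<beta>" "\<not> adj a \<beta>" "\<not> adj c \<beta>" using p unfolding \<beta>_def by blast+
  have ga: "\<gamma> \<in> W" "adj c \<gamma>" "\<not> adj a \<gamma>" "\<not> adj b \<gamma>" using p unfolding \<gamma>_def by blast+
  have ga': "\<gamma>' \<in> W" "adj c \<gamma>'" "\<not> adj a \<gamma>'" "\<not> adj b \<gamma>'" using q unfolding \<gamma>'_def by blast+
  have xa: "adj \<alpha> \<beta> \<longleftrightarrow> \<not> adj \<alpha> \<gamma>"
    using min_AT_second_or_penultimate[OF m no al p(1-5)] unfolding \<beta>_def \<gamma>_def .
  have xb: "adj \<beta> \<alpha> \<longleftrightarrow> \<not> adj \<beta> \<gamma>'"
    using min_AT_second_or_penultimate[OF mb no be q(1-5)] unfolding \<alpha>_def \<gamma>'_def .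
  have dist: "\<alpha> \<noteq> \<beta>" "\<alpha> \<noteq> \<gamma>" "\<alpha> \<noteq> \<gamma>'" "\<beta> \<noteq> \<gamma>" "\<beta> \<noteq> \<gamma>'"
    "a \<noteq> \<alpha>" "a \<noteq> \<beta>" "a \<noteq> \<gamma>" "b \<noteq> \<alpha>" "b \<noteq> \<beta>" "b \<noteq> \<gamma>" "c \<noteq> \<alpha>" "c \<noteq> \<beta>" "c \<noteq> \<gamma>"
    using al be ga ga' irrefl nadj by metis+
  show False
  proof (cases "adj \<alpha> \<beta>")
    case True
    have r: "ipath [a, \<alpha>, \<beta>, b]"
      using ipath4[OF al(2) True sym[OF be(2)]] al be dist nadj commute by blast
    have rs: "set [a, \<alpha>, \<beta>, b] \<subseteq> W - cnb c"
      using al be nadj dist by (auto simp: cnb_iff)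
    \<comment> \<open>On the path \<open>a\<close>, \<open>\<alpha>\<close>, \<open>\<beta>\<close>,
      \<open>b\<close> the two inner vertices are the second and the penultimate, so each such
      \<open>g\<close> sees exactly one of them.\<close>
    have one: "adj g \<alpha> \<longleftrightarrow> \<not> adj g \<beta>" if "g \<in> W" "adj c g" "\<not> adj a g" "\<not> adj b g" for g
      using min_AT_second_or_penultimate[OF mc no that r rs] by simp
    have 1: "\<not> adj \<alpha> \<gamma>" using xa True by blast
    have 2: "\<not> adj \<beta> \<gamma>'" using xb sym[OF True] by blast
    have 3: "adj \<gamma> \<beta>" using one[OF ga] 1 commute by blast
    have 4: "adj \<gamma>' \<alpha>" using one[OF ga'] 2 commute by blast
    have "\<gamma> \<noteq> \<gamma>'" using 3 2 commute by blast
    then have "adj \<gamma>' \<gamma>" using clC ga ga' by blast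
    \<comment> \<open>Otherwise \<open>\<alpha>\<close>, \<open>\<beta>\<close>,
      \<open>\<gamma>\<close>, \<open>\<gamma>'\<close> form an induced four-cycle.\<close>
    then have "adj \<gamma>' \<beta>" using fan3[OF True sym[OF 3] 1 dist(2) al(1) be(1) ga(1) ga'(1) 4] dist(5) by blast
    then show False using 2 sym by blast
  next
    case False
    have 1: "adj \<alpha> \<gamma>" using xa False by blast
    \<comment> \<open>Now \<open>\<gamma>\<close> is adjacent to \<open>\<alpha>\<close>, so it also
      serves as the penultimate vertex of a short path from \<open>a\<close> to \<open>c\<close>.
      That path forces \<open>\<beta>\<close> to see \<open>\<gamma>\<close>, and
      \<open>\<gamma>\<close> becomes the meeting point of the three arms.\<close>
    have q': "ipath [a, \<alpha>, \<gamma>, c]"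
      using ipath4[OF al(2) 1 sym[OF ga(2)]] al ga dist nadj commute by blast
    have qs': "set [a, \<alpha>, \<gamma>, c] \<subseteq> W - cnb b"
      using al ga nadj dist by (auto simp: cnb_iff)
    have oneb: "adj g \<alpha> \<longleftrightarrow> \<not> adj g \<gamma>" if "g \<in> W" "adj b g" "\<not> adj a g" "\<not> adj c g" for g
      using min_AT_second_or_penultimate[OF mb no that q' _ _ _ _] qs' by simp
    have 2: "adj \<beta> \<gamma>" using oneb[OF be] False commute by blast
    have p': "ipath [b, \<beta>, \<gamma>, c]"
      using ipath4[OF be(2) 2 sym[OF ga(2)]] be ga dist nadj commute by blast
    have ps': "set [b, \<beta>, \<gamma>, c] \<subseteq> W - cnb a"
      using be ga nadj dist by (auto simp: cnb_iff)
    have onea: "adj g \<beta> \<longleftrightarrow> \<not> adj g \<gamma>" if "g \<in> W" "adj a g" "\<not> adj b g" "\<not> adj c g" for g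
      using min_AT_second_or_penultimate[OF m no that p' _ _ _ _] ps' by simp
    show False
    proof (cases "\<exists>u\<in>W. adj a u \<and> adj b u")
      case True
      then obtain u where u: "u \<in> W" "adj a u" "adj b u" by blast
      have uc: "\<not> adj c u" using ac u by blast
      have un: "u \<noteq> a" "u \<noteq> b" "u \<noteq> c" "u \<noteq> \<alpha>" "u \<noteq> \<beta>" "u \<noteq> \<gamma>" using u irrefl nadj al be ga by blast+
      have r: "ipath [a, u, b]" using u nadj irrefl sym[OF u(3)] un by auto
      have rs: "set [a, u, b] \<subseteq> W - cnb c" using u uc un nadj by (auto simp: cnb_iff)
      \<comment> \<open>The path \<open>a\<close>, \<open>u\<close>, \<open>b\<close> has only three
        vertices, so the weaker \<open>min_AT_hit\<close> is used; \<open>\<gamma>\<close> misses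
        \<open>a\<close> and \<open>b\<close>, so it must see \<open>u\<close>.\<close>
      obtain x where x: "x \<in> set [a, u, b]" "adj \<gamma> x"
        using min_AT_hit[OF mc ga r rs] by auto
      then have ug: "adj u \<gamma>" using ga(3,4) commute by auto
      have ua: "adj u \<alpha>" using clA[OF u(1) al(1) u(2) al(2)] un by blast
      have ub: "adj u \<beta>" using clB[OF u(1) be(1) u(3) be(2)] un by blast
      \<comment> \<open>The path is \<open>a\<close>, \<open>\<alpha>\<close>,
        \<open>\<gamma>\<close>, \<open>\<beta>\<close>, \<open>b\<close>, with \<open>u\<close>
        adjacent to all of it and \<open>c\<close> hanging from \<open>\<gamma>\<close>.\<close>
      have "embeds W whipping_top"
        by (rule embeds_whipping_top[of a \<alpha> \<gamma> \<beta> b u c])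
          (use al be ga u uc ug ua ub un 1 2 False dist nadj commute in auto)
      then show False using no unfolding obstructed_def by blast
    next
      case none: False
      then have ab: "\<not> adj b t" if "t \<in> W" "adj a t" for t using that by blast
      obtain r where r: "ipath r" "set r \<subseteq> W - cnb c" "hd r = a" "last r = b" "4 \<le> length r"
        "adj a (r ! 1)" "adj b (r ! (length r - 2))" "\<not> adj b (r ! 1)" "\<not> adj a (r ! (length r - 2))" "r ! 1 \<in> W" "r ! (length r - 2) \<in> W"
        "\<not> adj c (r ! 1)" "\<not> adj c (r ! (length r - 2))"
        using path_between[OF m ab] by blast
      \<comment> \<open>\<open>\<gamma>\<close> misses one of the two vertices next to the ends of
        \<open>r\<close>. That vertex, with \<open>\<alpha>\<close>, \<open>\<gamma>\<close>,
        \<open>\<beta>\<close>, closes a four-cycle in which \<open>\<alpha>\<close> and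
        \<open>\<beta>\<close> are nonadjacent.\<close>
      have "adj \<gamma> (r ! 1) \<longleftrightarrow> \<not> adj \<gamma> (r ! (length r - 2))"
        using min_AT_second_or_penultimate[OF mc no ga r(1-5)] .
      then consider "\<not> adj \<gamma> (r ! 1)" | "\<not> adj \<gamma> (r ! (length r - 2))" by blast
      then show False
      proof cases
        case c1: 1
        let ?x = "r ! 1"
        have n: "\<not> adj ?x \<gamma>" using c1 sym by blast
        have b: "adj ?x \<beta>" using onea[OF r(10,6,8,12)] n by blast
        have "?x \<noteq> \<gamma>" using r(6) ga(3) by metis
        have "?x \<noteq> \<alpha>" using n 1 by metis
        then have "adj ?x \<alpha>" using clA r(10,6) al by blast
        then have "adj ?x \<gamma>"
          using fan3[OF 1 sym[OF 2] False dist(1) al(1) ga(1) be(1) r(10) _ b \<open>?x \<noteq> \<gamma>\<close>] by blast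
        then show False using n by blast
      next
        case c2: 2
        let ?x = "r ! (length r - 2)"
        have n: "\<not> adj ?x \<gamma>" using c2 sym by blast
        have a: "adj ?x \<alpha>" using oneb[OF r(11,7,9,13)] n by blast
        have "?x \<noteq> \<gamma>" using r(7) ga(4) by metis
        have "?x \<noteq> \<beta>" using n 2 by metis
        then have "adj ?x \<beta>" using clB r(11,7) be by blast
        then have "adj ?x \<gamma>"
          using fan3[OF 1 sym[OF 2] False dist(1) al(1) ga(1) be(1) r(11) a] \<open>?x \<noteq> \<gamma>\<close> by blast
        then show False using n by blast
      qed
    qed
  qed
qed

text \<open>It suffices to treat a vertex set minimal with an asteroidal triple; there the number of
  pairs of corners with a common neighbour decides.\<close>

theorem asteroidal_obstructed:
  assumes "finite W" "chordal W" "asteroidal W a b c"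
  shows "obstructed W"
  using assms
proof (induction "card W" arbitrary: W a b c rule: less_induct)
  case less
  show ?case
  proof (cases "\<exists>W' x y z. W' \<subset> W \<and> asteroidal W' x y z")
    case True
    then obtain W' x y z where W': "W' \<subset> W" "asteroidal W' x y z" by blast
    have "obstructed W'"
    proof (rule less.hyps[OF _ _ _ W'(2)])
      show "card W' < card W" using less.prems(1) W'(1) by (rule psubset_card_mono)
      show "finite W'" using less.prems(1) W'(1) finite_subset by blast
      show "chordal W'" using chordal_mono[OF less.prems(2)] W'(1) by blast
    qed
    then show ?thesis using obstructed_mono W'(1) by blast
  next
    case False
    then have m: "min_AT W a b c" using less.prems unfolding min_AT_def by blast
    define common where "common x y \<longleftrightarrow> (\<exists>t\<in>W. adj x t \<and> adj y t)" for x y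
    \<comment> \<open>Among the three pairs of corners, two have a common neighbour or two have
      none. The corner belonging to both of these pairs takes the role of \<open>c\<close>.\<close>
    consider "common a c \<and> common b c" | "common a b \<and> common c b" | "common b a \<and> common c a"
      | "\<not> common a c \<and> \<not> common b c" | "\<not> common a b \<and> \<not> common c b" | "\<not> common b a \<and> \<not> common c a"
      unfolding common_def by blast
    then show ?thesis
    proof cases
      case 1
      then show ?thesis using obstructed_two_common[OF m] unfolding common_def by blast
    next
      case 2
      then show ?thesis using obstructed_two_common[OF min_AT_swap2[OF m]] unfolding common_def by blast
    next
      case 3
      then show ?thesis using obstructed_two_common[OF min_AT_swap2[OF min_AT_swap1[OF m]]] unfolding common_def by blast
    next
      case 4
      then show ?thesis using obstructed_one_common[OF m] unfolding common_def by blast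
    next
      case 5
      then show ?thesis using obstructed_one_common[OF min_AT_swap2[OF m]] unfolding common_def by blast
    next
      case 6
      then show ?thesis using obstructed_one_common[OF min_AT_swap2[OF min_AT_swap1[OF m]]] unfolding common_def by blast
    qed
  qed
qed

end

lemma cycle_graph_verts: "pverts (cycle_graph n) = {..<n}"
  unfolding cycle_graph_def undirected_def by simp

lemma cycle_graph_arcs: "(i, j) \<in> parcs (cycle_graph n) \<longleftrightarrow> i < n \<and> j = Suc i mod n \<or> j < n \<and> i = Suc j mod n"
  unfolding cycle_graph_def undirected_def by auto

context sgraph
begin

subsection \<open>Interval graphs contain no obstruction\<close>

text \<open>Of three disjoint intervals one lies between the other two, and by
  \<open>rep_side\<close> no walk between those can pass it while avoiding its neighbours.\<close>

lemma interval_not_asteroidal: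
  assumes "interval W" shows "\<not> asteroidal W a b c"
proof
  assume AT: "asteroidal W a b c"
  obtain l r where rep: "is_rep W l r" using assms unfolding interval_def by blast
  note n = asteroidal_nonadj[OF AT]
  have mid: False if y: "joined (W - cnb y) x z" "y \<in> W" "x \<in> W" "z \<in> W" and o: "r x < l y" "r y < l z" for x y z
  proof -
    have "r z < l y" using rep_side[OF rep y(1) _ y(2) _ o(1)] by blast
    moreover have "l y \<le> r y" "l z \<le> r z" using is_repD(1)[OF rep] y by blast+
    ultimately show False using o by linarith
  qed
  have j: "joined (W - cnb a) b c" "joined (W - cnb a) c b" "joined (W - cnb b) a c" "joined (W - cnb b) c a"
    "joined (W - cnb c) a b" "joined (W - cnb c) b a"
    using AT joined_sym unfolding asteroidal_def by blast+
  have "r a < l b \<or> r b < l a" "r a < l c \<or> r c < l a" "r b < l c \<or> r c < l b"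
    using is_repD(2)[OF rep n(1,2,4)] is_repD(2)[OF rep n(1,3,5)] is_repD(2)[OF rep n(2,3,6)] n by linarith+
  moreover have "l a \<le> r a" "l b \<le> r b" "l c \<le> r c" using is_repD(1)[OF rep] n by blast+
  ultimately show False
    using mid[OF j(1)] mid[OF j(2)] mid[OF j(3)] mid[OF j(4)] mid[OF j(5)] mid[OF j(6)] n(1-3) by (smt (verit))
qed

text \<open>For the interval that ends first, all neighbours contain its right end and so meet each
  other. This is what rules out long cycles.\<close>

lemma interval_simplicial:
  assumes "interval W" "finite W" "W \<noteq> {}"
  shows "\<exists>v\<in>W. \<forall>x\<in>W. \<forall>y\<in>W. adj v x \<longrightarrow> adj v y \<longrightarrow> x \<noteq> y \<longrightarrow> adj x y"
proof -
  obtain l r where rep: "is_rep W l r" using assms(1) unfolding interval_def by blast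
  have "Min (r ` W) \<in> r ` W" using assms by (intro Min_in) auto
  then obtain v where v: "v \<in> W" "r v = Min (r ` W)" by auto
  have le: "r v \<le> r x" if "x \<in> W" for x using v(2) assms(2) that by simp
  have "adj x y" if "x \<in> W" "y \<in> W" "adj v x" "adj v y" "x \<noteq> y" for x y
  proof -
    have "v \<noteq> x" "v \<noteq> y" using that irrefl by blast+
    then have "l x \<le> r v" "l y \<le> r v" using is_repD(2)[OF rep v(1)] that by blast+
    then show ?thesis using is_repD(2)[OF rep that(1,2,5)] le[OF that(1)] le[OF that(2)] by linarith
  qed
  then show ?thesis using v(1) by blast
qed

text \<open>With explicit vertex lists, connectedness in the concrete graphs becomes a
  computation.\<close>

lemma joined_walk: "successively adj xs \<Longrightarrow> xs \<noteq> [] \<Longrightarrow> set xs \<subseteq> W \<Longrightarrow> joined W (hd xs) (last xs)"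
proof (induction xs rule: induct_list012)
  case (3 x y zs)
  have xy: "adj x y" "x \<in> W" "y \<in> W" "set (y # zs) \<subseteq> W" "successively adj (y # zs)" using 3(3-) by auto
  have "joined W (hd (y # zs)) (last (y # zs))" using "3.IH"(2) xy(4,5) by blast
  then have "joined W y (last (y # zs))" by simp
  with joined_edge[OF xy(2,3,1)] have "joined W x (last (y # zs))" by (rule joined_trans)
  then show ?case by simp
qed (simp_all add: joined_refl)

text \<open>The endpoints are pulled back along the embedding. The small graph is treated as an
  \<open>sgraph\<close> in its own right, so the two lemmas above apply to it.\<close>

lemma embeds_interval:
  assumes e: "embeds W F" and int: "interval W" and F: "sgraph (\<lambda>x y. (x, y) \<in> parcs F)"
  shows "sgraph.interval (\<lambda>x y. (x, y) \<in> parcs F) (pverts F)"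
proof -
  interpret F: sgraph "\<lambda>x y. (x, y) \<in> parcs F" by fact
  obtain f where f: "inj_on f (pverts F)" "f ` pverts F \<subseteq> W"
    "\<And>x y. x \<in> pverts F \<Longrightarrow> y \<in> pverts F \<Longrightarrow> (x, y) \<in> parcs F \<longleftrightarrow> adj (f x) (f y)"
    using e unfolding embeds_def by blast
  obtain l r where rep: "is_rep W l r" using int unfolding interval_def by blast
  have "F.is_rep (pverts F) (l \<circ> f) (r \<circ> f)"
    unfolding F.is_rep_def
  proof (intro conjI ballI impI)
    fix v assume "v \<in> pverts F"
    then show "(l \<circ> f) v \<le> (r \<circ> f) v" using is_repD(1)[OF rep, of "f v" "f v"] f(2) by auto
  next
    fix u v assume uv: "u \<in> pverts F" "v \<in> pverts F" "u \<noteq> v"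
    then have "f u \<noteq> f v" "f u \<in> W" "f v \<in> W" using f(1,2) by (auto dest: inj_onD)
    then show "((u, v) \<in> parcs F) = ((l \<circ> f) u \<le> (r \<circ> f) v \<and> (l \<circ> f) v \<le> (r \<circ> f) u)"
      using f(3)[OF uv(1,2)] is_repD(2)[OF rep, of "f u" "f v"] by simp
  qed
  then show ?thesis unfolding F.interval_def by blast
qed

lemma embeds_asteroidal:
  assumes "embeds W F" "sgraph (\<lambda>x y. (x, y) \<in> parcs F)" "sgraph.asteroidal (\<lambda>x y. (x, y) \<in> parcs F) (pverts F) a b c"
  shows "\<not> interval W"
  using embeds_interval[OF assms(1) _ assms(2)] sgraph.interval_not_asteroidal[OF assms(2)] assms(3) by blast

end

section \<open>Asteroidal triples in the named graphs, and cycles without a simplicial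
  vertex\<close>

lemma asteroidal_long_claw:
  "sgraph (\<lambda>x y. (x, y) \<in> parcs long_claw)"
  "sgraph.asteroidal (\<lambda>x y. (x, y) \<in> parcs long_claw) (pverts long_claw) (LC_b 1) (LC_b 2) (LC_b 3)"
proof -
  show "sgraph (\<lambda>x y. (x, y) \<in> parcs long_claw)"
    by unfold_locales (auto simp: long_claw_def undirected_def)
  then interpret sgraph "\<lambda>x y. (x, y) \<in> parcs long_claw" .
  show "asteroidal (pverts long_claw) (LC_b 1) (LC_b 2) (LC_b 3)"
    unfolding asteroidal_def
    using joined_walk[of "[LC_b 2, LC_a 2, LC_c, LC_a 3, LC_b 3]" "pverts long_claw - cnb (LC_b 1)"]
      joined_walk[of "[LC_b 1, LC_a 1, LC_c, LC_a 3, LC_b 3]" "pverts long_claw - cnb (LC_b 2)"]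
      joined_walk[of "[LC_b 1, LC_a 1, LC_c, LC_a 2, LC_b 2]" "pverts long_claw - cnb (LC_b 3)"]
    by (simp add: long_claw_verts long_claw_arcs cnb_iff)
qed

lemma asteroidal_whipping_top:
  "sgraph (\<lambda>x y. (x, y) \<in> parcs whipping_top)"
  "sgraph.asteroidal (\<lambda>x y. (x, y) \<in> parcs whipping_top) (pverts whipping_top) (WT_x 1) (WT_x 5) WT_z"
proof -
  show "sgraph (\<lambda>x y. (x, y) \<in> parcs whipping_top)"
    by unfold_locales (auto simp: whipping_top_def undirected_def)
  then interpret sgraph "\<lambda>x y. (x, y) \<in> parcs whipping_top" .
  show "asteroidal (pverts whipping_top) (WT_x 1) (WT_x 5) WT_z"
    unfolding asteroidal_def
    using joined_walk[of "[WT_x 5, WT_x 4, WT_x 3, WT_z]" "pverts whipping_top - cnb (WT_x 1)"]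
      joined_walk[of "[WT_x 1, WT_x 2, WT_x 3, WT_z]" "pverts whipping_top - cnb (WT_x 5)"]
      joined_walk[of "[WT_x 1, WT_y, WT_x 5]" "pverts whipping_top - cnb WT_z"]
    by (simp add: whipping_top_verts whipping_top_arcs cnb_iff)
qed

lemma asteroidal_dagger:
  assumes k: "2 \<le> k"
  shows "sgraph (\<lambda>x y. (x, y) \<in> parcs (dagger k))"
    "sgraph.asteroidal (\<lambda>x y. (x, y) \<in> parcs (dagger k)) (pverts (dagger k)) Dag_p Dag_q Dag_s"
proof -
  show "sgraph (\<lambda>x y. (x, y) \<in> parcs (dagger k))"
    by unfold_locales (auto simp: dagger_def undirected_def)
  then interpret sgraph "\<lambda>x y. (x, y) \<in> parcs (dagger k)" .
  let ?V = "pverts (dagger k)"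
  have v: "Dag_v i \<in> ?V \<longleftrightarrow> 1 \<le> i \<and> i \<le> k" for i unfolding dagger_def undirected_def by auto
  have c: "{Dag_c, Dag_p, Dag_q, Dag_s} \<subseteq> ?V" unfolding dagger_def undirected_def by auto
  \<comment> \<open>\<open>Dag_s\<close> has \<open>Dag_c\<close> as its only neighbour, so
    \<open>Dag_p\<close> and \<open>Dag_q\<close> are joined along the path; the other two walks go
    through \<open>Dag_c\<close>.\<close>
  have "joined (?V - cnb Dag_s) Dag_p (Dag_v (Suc i))" if "i < k" for i
    using that
  proof (induction i)
    case 0
    then show ?case using v c by (intro joined_edge) (auto simp: cnb_iff dagger_arcs)
  next
    case (Suc i)
    then have "joined (?V - cnb Dag_s) Dag_p (Dag_v (Suc i))" by simp
    then show ?case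
      by (rule joined_step) (use Suc.prems v in \<open>auto simp: cnb_iff dagger_arcs\<close>)
  qed
  from this[of "k - 1"] have "joined (?V - cnb Dag_s) Dag_p (Dag_v k)" using k by simp
  then have 1: "joined (?V - cnb Dag_s) Dag_p Dag_q"
    by (rule joined_step) (use k c in \<open>auto simp: cnb_iff dagger_arcs\<close>)
  have 2: "joined (?V - cnb Dag_p) Dag_q Dag_s"
    using joined_walk[of "[Dag_q, Dag_v k, Dag_c, Dag_s]" "?V - cnb Dag_p"] k v c by (simp add: cnb_iff dagger_arcs)
  have 3: "joined (?V - cnb Dag_q) Dag_p Dag_s"
    using joined_walk[of "[Dag_p, Dag_v 1, Dag_c, Dag_s]" "?V - cnb Dag_q"] k v c by (simp add: cnb_iff dagger_arcs)
  show "asteroidal ?V Dag_p Dag_q Dag_s" unfolding asteroidal_def using 1 2 3 c by blast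
qed

lemma asteroidal_ddagger:
  assumes n: "3 \<le> n"
  shows "sgraph (\<lambda>x y. (x, y) \<in> parcs (ddagger n))"
    "sgraph.asteroidal (\<lambda>x y. (x, y) \<in> parcs (ddagger n)) (pverts (ddagger n)) (DDag_x 1) (DDag_x n) DDag_w"
proof -
  show "sgraph (\<lambda>x y. (x, y) \<in> parcs (ddagger n))"
    by unfold_locales (auto simp: ddagger_def undirected_def)
  then interpret sgraph "\<lambda>x y. (x, y) \<in> parcs (ddagger n)" .
  let ?V = "pverts (ddagger n)"
  have v: "DDag_x i \<in> ?V \<longleftrightarrow> 1 \<le> i \<and> i \<le> n" for i unfolding ddagger_def undirected_def by auto
  have c: "{DDag_u, DDag_v, DDag_w} \<subseteq> ?V" unfolding ddagger_def undirected_def by auto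
  have "joined (?V - cnb DDag_w) (DDag_x 1) (DDag_x (Suc i))" if "i < n" for i
    using that
  proof (induction i)
    case 0
    then have "DDag_x 1 \<in> ?V - cnb DDag_w" using v[of 1] by (simp add: cnb_iff ddagger_arcs)
    then have "joined (?V - cnb DDag_w) (DDag_x 1) (DDag_x 1)" by (rule joined_refl)
    then show ?case by simp
  next
    case (Suc i)
    then have "joined (?V - cnb DDag_w) (DDag_x 1) (DDag_x (Suc i))" by simp
    then show ?case
      by (rule joined_step) (use Suc.prems v in \<open>auto simp: cnb_iff ddagger_arcs\<close>)
  qed
  from this[of "n - 1"] have 1: "joined (?V - cnb DDag_w) (DDag_x 1) (DDag_x n)" using n by simp
  have 2: "joined (?V - cnb (DDag_x 1)) (DDag_x n) DDag_w"
    using joined_walk[of "[DDag_x n, DDag_v, DDag_w]" "?V - cnb (DDag_x 1)"] n v c by (simp add: cnb_iff ddagger_arcs)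
  have 3: "joined (?V - cnb (DDag_x n)) (DDag_x 1) DDag_w"
    using joined_walk[of "[DDag_x 1, DDag_u, DDag_w]" "?V - cnb (DDag_x n)"] n v c by (simp add: cnb_iff ddagger_arcs)
  show "asteroidal ?V (DDag_x 1) (DDag_x n) DDag_w" unfolding asteroidal_def using 1 2 3 c v[of 1] v[of n] n by simp
qed

text \<open>In a cycle of length at least four the two neighbours of a vertex are nonadjacent, so
  \<open>interval_simplicial\<close> fails.\<close>

lemma cycle_graph_not_interval:
  assumes n: "4 \<le> n"
  shows "sgraph (\<lambda>x y. (x, y) \<in> parcs (cycle_graph n))"
    "\<not> sgraph.interval (\<lambda>x y. (x, y) \<in> parcs (cycle_graph n)) (pverts (cycle_graph n))"
proof -
  have "i \<noteq> Suc i mod n" if "i < n" for i using that n by (cases "Suc i = n") auto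
  then show "sgraph (\<lambda>x y. (x, y) \<in> parcs (cycle_graph n))"
    by unfold_locales (auto simp: cycle_graph_arcs)
  then interpret sgraph "\<lambda>x y. (x, y) \<in> parcs (cycle_graph n)" .
  show "\<not> interval (pverts (cycle_graph n))"
  proof
    assume "interval (pverts (cycle_graph n))"
    moreover have "0 \<in> {..<n}" using n by simp
    then have "{..<n} \<noteq> {}" by blast
    ultimately have "\<exists>v\<in>{..<n}. \<forall>x\<in>{..<n}. \<forall>y\<in>{..<n}. (v, x) \<in> parcs (cycle_graph n) \<longrightarrow>
        (v, y) \<in> parcs (cycle_graph n) \<longrightarrow> x \<noteq> y \<longrightarrow> (x, y) \<in> parcs (cycle_graph n)"
      using interval_simplicial[of "pverts (cycle_graph n)"] unfolding cycle_graph_verts by simp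
    then obtain v where v: "v < n" and s: "\<And>x y. x < n \<Longrightarrow> y < n \<Longrightarrow> (v, x) \<in> parcs (cycle_graph n) \<Longrightarrow>
        (v, y) \<in> parcs (cycle_graph n) \<Longrightarrow> x \<noteq> y \<Longrightarrow> (x, y) \<in> parcs (cycle_graph n)"
      unfolding lessThan_iff Ball_def Bex_def by blast
    \<comment> \<open>The neighbours wrap around modulo \<open>n\<close> only at the two extreme
      indices.\<close>
    consider "v = 0" | "v = n - 1" | "0 < v" "Suc v < n" using v by linarith
    then show False
    proof cases
      case 1
      have m: "Suc 0 mod n = 1" "Suc (n - 1) mod n = 0" "Suc 1 mod n = 2" using n by simp_all
      have "(1, n - 1) \<in> parcs (cycle_graph n)"
        by (rule s) (use n 1 m in \<open>simp_all add: cycle_graph_arcs\<close>)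
      then show False unfolding cycle_graph_arcs m using n by linarith
    next
      case 2
      have eq: "Suc (n - 1) = n" "Suc (n - 2) = n - 1" using n by linarith+
      have m: "Suc (n - 1) mod n = 0" "Suc (n - 2) mod n = n - 1" "Suc 0 mod n = 1" unfolding eq using n by simp_all
      have "(0, n - 2) \<in> parcs (cycle_graph n)"
        by (rule s) (use n 2 m in \<open>simp_all add: cycle_graph_arcs\<close>)
      then show False unfolding cycle_graph_arcs m using n by linarith
    next
      case 3
      then obtain t where t: "v = Suc t" by (cases v) auto
      have m: "Suc (Suc t) mod n = Suc (Suc t)" "Suc t mod n = Suc t" using 3 t by simp_all
      have "(Suc (Suc t), t) \<in> parcs (cycle_graph n)"
        by (rule s) (use 3 t m in \<open>simp_all add: cycle_graph_arcs\<close>)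
      then have "t = Suc (Suc (Suc t)) mod n" unfolding cycle_graph_arcs m by auto
      moreover have "Suc (Suc (Suc t)) mod n = (if Suc (Suc (Suc t)) = n then 0 else Suc (Suc (Suc t)))"
        using 3 t by auto
      ultimately show False using n by (auto split: if_splits)
    qed
  qed
qed

section \<open>Chordality from excluded cycles, and the characterisation of interval graphs\<close>

context sgraph
begin

text \<open>If \<open>u\<close> misses a vertex of the path, the nearest neighbours of
  \<open>u\<close> on either side of it bound a stretch that closes up through \<open>u\<close> to
  an induced cycle.\<close>

lemma chordal_of_no_cycle:
  assumes no: "\<And>n. 4 \<le> n \<Longrightarrow> \<not> embeds W (cycle_graph n)"
  shows "chordal W"
  unfolding chordal_def
proof (intro allI impI ballI, elim conjE)
  fix xs u x
  assume p: "ipath xs" "set xs \<subseteq> W" "xs \<noteq> []" and u: "u \<in> W" "u \<notin> set xs" "adj u (hd xs)" "adj u (last xs)"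
    and x: "x \<in> set xs"
  show "adj u x"
  proof (rule ccontr)
    assume nx: "\<not> adj u x"
    define n where "n = length xs"
    obtain k where k: "k < n" "x = xs ! k" using x unfolding n_def by (metis in_set_conv_nth)
    define I where "I = {i. i < k \<and> adj u (xs ! i)}"
    define J where "J = {j. k < j \<and> j < n \<and> adj u (xs ! j)}"
    have ends: "adj u (xs ! 0)" "adj u (xs ! (n - 1))" using u p(3) unfolding n_def by (auto simp: hd_conv_nth last_conv_nth)
    have fin: "finite I" "finite J" unfolding I_def J_def by auto
    have "k \<noteq> 0" "k \<noteq> n - 1" using ends nx k(2) by metis+
    then have "0 \<in> I" "n - 1 \<in> J" using ends k(1) unfolding I_def J_def by auto
    then have ne: "I \<noteq> {}" "J \<noteq> {}" by auto
    define i where "i = Max I"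
    define j where "j = Min J"
    have iI: "i \<in> I" "\<And>m. m \<in> I \<Longrightarrow> m \<le> i" unfolding i_def using Max_in[OF fin(1) ne(1)] Max_ge[OF fin(1)] by auto
    have jJ: "j \<in> J" "\<And>m. m \<in> J \<Longrightarrow> j \<le> m" unfolding j_def using Min_in[OF fin(2) ne(2)] Min_le[OF fin(2)] by auto
    have ij: "i < k" "k < j" "j < n" "adj u (xs ! i)" "adj u (xs ! j)" using iI(1) jJ(1) unfolding I_def J_def by auto
    have between: "adj u (xs ! m) \<longleftrightarrow> m = i \<or> m = j" if m: "i \<le> m" "m \<le> j" for m
    proof
      assume a: "adj u (xs ! m)"
      then have "m \<noteq> k" using nx k(2) by blast
      then have "m < k \<or> k < m \<and> m < n" using m ij(3) by linarith
      then have "m \<in> I \<or> m \<in> J" using a unfolding I_def J_def by blast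
      then show "m = i \<or> m = j" using iI(2)[of m] jJ(2)[of m] m by auto
    qed (use ij in blast)
    define d where "d = j - i"
    have d: "2 \<le> d" "i + d = j" using ij unfolding d_def by auto
    \<comment> \<open>The stretch takes the indices 0 to \<open>d\<close> and \<open>u\<close> takes
      \<open>Suc d\<close>. As \<open>d\<close> is at least 2, the cycle has length
      \<open>d + 2\<close>, at least 4.\<close>
    define f where "f t = (if t = Suc d then u else xs ! (i + t))" for t
    have idx: "i + t < length xs" if "t \<le> d" for t using that ij d unfolding n_def by auto
    have inxs: "f t \<in> set xs" "f t = xs ! (i + t)" if "t \<le> d" for t using idx[OF that] that unfolding f_def by auto
    have fu: "f (Suc d) = u" unfolding f_def by simp
    have split: "t \<le> d \<or> t = Suc d" if "t < d + 2" for t using that by linarith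
    have uf: "adj u (f t) \<longleftrightarrow> t = 0 \<or> t = d" if "t \<le> d" for t
      using between[of "i + t"] that d inxs(2)[OF that] by auto
    have ff: "adj (f s) (f t) \<longleftrightarrow> t = Suc s \<or> s = Suc t" if "s \<le> d" "t \<le> d" for s t
      using ipath_nth[OF p(1) idx[OF that(1)] idx[OF that(2)]] inxs(2)[OF that(1)] inxs(2)[OF that(2)] by auto
    have "embeds W (cycle_graph (d + 2))"
      unfolding embeds_def cycle_graph_verts
    proof (intro exI[of _ f] conjI ballI)
      show "inj_on f {..<d + 2}"
      proof (rule inj_onI)
        fix s t assume st: "s \<in> {..<d + 2}" "t \<in> {..<d + 2}" "f s = f t"
        have "s = t" if "s \<le> d" "t \<le> d"
          using st(3) inxs(2)[OF that(1)] inxs(2)[OF that(2)] nth_eq_iff_index_eq[OF ipath_distinct[OF p(1)] idx[OF that(1)] idx[OF that(2)]] by simp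
        then show "s = t" using split[of s] split[of t] st fu inxs(1)[of s] inxs(1)[of t] u(2) by auto
      qed
      show "f ` {..<d + 2} \<subseteq> W"
      proof
        fix y assume "y \<in> f ` {..<d + 2}"
        then obtain t where "t < d + 2" "y = f t" by auto
        then show "y \<in> W" using split[of t] fu inxs(1)[of t] p(2) u(1) by auto
      qed
      fix s t assume "s \<in> {..<d + 2}" "t \<in> {..<d + 2}"
      then have st: "s \<le> d \<or> s = Suc d" "t \<le> d \<or> t = Suc d" using split by auto
      then show "((s, t) \<in> parcs (cycle_graph (d + 2))) = adj (f s) (f t)"
      proof (elim disjE)
        assume "s \<le> d" "t \<le> d"
        then show ?thesis by (auto simp: cycle_graph_arcs ff mod_Suc)
      next
        assume a: "s \<le> d" "t = Suc d"
        then show ?thesis using uf[OF a(1)] fu commute[of u] by (auto simp: cycle_graph_arcs mod_Suc)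
      next
        assume a: "s = Suc d" "t \<le> d"
        then show ?thesis using uf[OF a(2)] fu by (auto simp: cycle_graph_arcs mod_Suc)
      next
        assume a: "s = Suc d" "t = Suc d"
        then show ?thesis using fu irrefl by (auto simp: cycle_graph_arcs mod_Suc)
      qed
    qed
    then show False using no[of "d + 2"] d by simp
  qed
qed

theorem lekkerkerker_boland:
  assumes "finite W"
  shows "interval W \<longleftrightarrow> (\<forall>n\<ge>4. \<not> embeds W (cycle_graph n)) \<and> \<not> obstructed W"
proof
  assume int: "interval W"
  have "\<not> embeds W (cycle_graph n)" if "4 \<le> n" for n
    using embeds_interval[OF _ int cycle_graph_not_interval(1)[OF that]] cycle_graph_not_interval(2)[OF that] by blast
  moreover have "\<not> obstructed W"
    unfolding obstructed_def
    using embeds_asteroidal[OF _ asteroidal_long_claw] embeds_asteroidal[OF _ asteroidal_whipping_top]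
      embeds_asteroidal[OF _ asteroidal_dagger] embeds_asteroidal[OF _ asteroidal_ddagger] int by blast
  ultimately show "(\<forall>n\<ge>4. \<not> embeds W (cycle_graph n)) \<and> \<not> obstructed W" by blast
next
  assume R: "(\<forall>n\<ge>4. \<not> embeds W (cycle_graph n)) \<and> \<not> obstructed W"
  then have "chordal W" using chordal_of_no_cycle by blast
  then show "interval W" using chordal_asteroidal_free_interval[OF assms] asteroidal_obstructed[OF assms] R by blast
qed

text \<open>\<open>v\<close> receives an interval from below all right ends to above all left ends,
  so it meets every other. Taking \<open>min\<close> and \<open>max\<close> of both bounds keeps its
  ends in order.\<close>

lemma interval_insert_universal:
  assumes "finite W" "\<And>x. x \<in> W \<Longrightarrow> adj v x"
  shows "interval (insert v W) \<longleftrightarrow> interval W"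
proof
  assume "interval W"
  then obtain l r where rep: "is_rep W l r" unfolding interval_def by blast
  have vW: "v \<notin> W" using assms(2) irrefl by blast
  have "bdd_below (r ` W)" "bdd_above (l ` W)" using assms(1) by auto
  then obtain m M where m: "\<And>x. x \<in> W \<Longrightarrow> m \<le> r x" and M: "\<And>x. x \<in> W \<Longrightarrow> l x \<le> M"
    unfolding bdd_below_def bdd_above_def by auto
  have "is_rep (insert v W) (l(v := min m M)) (r(v := max m M))"
    unfolding is_rep_def
  proof (intro conjI ballI impI)
    fix x assume "x \<in> insert v W"
    then show "(l(v := min m M)) x \<le> (r(v := max m M)) x" using is_repD(1)[OF rep, of x x] by auto
  next
    fix x y assume xy: "x \<in> insert v W" "y \<in> insert v W" "x \<noteq> y"
    then show "adj x y = ((l(v := min m M)) x \<le> (r(v := max m M)) y \<and> (l(v := min m M)) y \<le> (r(v := max m M)) x)"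
      using is_repD(2)[OF rep, of x y] assms(2)[of x] assms(2)[of y] m[of x] m[of y] M[of x] M[of y] vW commute[of v x]
      by (auto simp: min_le_iff_disj le_max_iff_disj)
  qed
  then show "interval (insert v W)" unfolding interval_def by blast
qed (rule interval_mono, auto)

end

subsection \<open>Interval graphs as integer interval representations\<close>

lemma path_graph_simps:
  "pverts (path_graph n) = {1..n}"
  "(i, j) \<in> parcs (path_graph n) \<longleftrightarrow> (j = Suc i \<or> i = Suc j) \<and> i \<in> {1..n} \<and> j \<in> {1..n}"
  unfolding path_graph_def undirected_def by auto

lemma digraph_iso_with_proj_iff:
  "digraph_iso (with_proj F) (with_proj H) \<longleftrightarrow> wf_digraph (with_proj F) \<and>
     (\<exists>f. inj_on f (pverts F) \<and> pverts H = f ` pverts F \<and> parcs H = map_prod f f ` parcs F)"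
proof
  assume "digraph_iso (with_proj F) (with_proj H)"
  then obtain h where h: "pre_digraph.digraph_isomorphism (with_proj F) h" "with_proj H = app_iso h (with_proj F)"
    unfolding digraph_iso_def by blast
  \<comment> \<open>Comparing the fields of the two records also forces the head and tail maps of
    \<open>h\<close> to be the projections.\<close>
  have H: "pverts H = iso_verts h ` pverts F" "parcs H = iso_arcs h ` parcs F" "iso_tail h = fst" "iso_head h = snd"
    using arg_cong[OF h(2), of verts] arg_cong[OF h(2), of arcs] arg_cong[OF h(2), of tail] arg_cong[OF h(2), of head]
    by simp_all
  have I: "wf_digraph (with_proj F)" "inj_on (iso_verts h) (pverts F)"
    "\<forall>a\<in>parcs F. iso_verts h (fst a) = fst (iso_arcs h a) \<and> iso_verts h (snd a) = snd (iso_arcs h a)"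
    using h(1) H(3,4) unfolding pre_digraph.digraph_isomorphism_def by simp_all
  have "iso_arcs h a = map_prod (iso_verts h) (iso_verts h) a" if "a \<in> parcs F" for a
    using bspec[OF I(3) that] by (simp add: prod_eq_iff)
  then have "iso_arcs h ` parcs F = map_prod (iso_verts h) (iso_verts h) ` parcs F" by (intro image_cong) auto
  then show "wf_digraph (with_proj F) \<and>
     (\<exists>f. inj_on f (pverts F) \<and> pverts H = f ` pverts F \<and> parcs H = map_prod f f ` parcs F)"
    using H I by metis
next
  assume "wf_digraph (with_proj F) \<and>
     (\<exists>f. inj_on f (pverts F) \<and> pverts H = f ` pverts F \<and> parcs H = map_prod f f ` parcs F)"
  then obtain f where f: "wf_digraph (with_proj F)" "inj_on f (pverts F)" "pverts H = f ` pverts F" "parcs H = map_prod f f ` parcs F"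
    by blast
  let ?h = "\<lparr>iso_verts = f, iso_arcs = map_prod f f, iso_head = snd, iso_tail = fst\<rparr>"
  have sub: "parcs F \<subseteq> pverts F \<times> pverts F"
    using f(1) unfolding wf_digraph_wp_iff pair_wf_digraph_def by auto
  have "inj_on (map_prod f f) (parcs F)"
    using inj_on_subset[OF map_prod_inj_on[OF f(2) f(2)] sub] .
  then have "pre_digraph.digraph_isomorphism (with_proj F) ?h"
    unfolding pre_digraph.digraph_isomorphism_def using f(1,2) by simp
  moreover have "with_proj H = app_iso ?h (with_proj F)"
    unfolding app_iso_def with_proj_def using f(3,4) by simp
  ultimately show "digraph_iso (with_proj F) (with_proj H)" unfolding digraph_iso_def by blast
qed

lemma path_graph_wf: "wf_digraph (with_proj (path_graph n))"
  unfolding wf_digraph_wp_iff by unfold_locales (auto simp: path_graph_def undirected_def)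

text \<open>A discrete intermediate value property: a walk with unit steps skips no number. Applied
  to the positions of a subpath in its host path, it shows that they fill an interval.\<close>

lemma unit_steps_image:
  assumes "1 \<le> m" and "\<And>i. 1 \<le> i \<Longrightarrow> i < m \<Longrightarrow> s (Suc i) = Suc (s i) \<or> s i = Suc (s (Suc i))"
  shows "\<exists>l r :: nat. l \<le> r \<and> s ` {1..m} = {l..r}"
  using assms
proof (induction m rule: dec_induct)
  case base
  then show ?case by (intro exI[of _ "s 1"]) auto
next
  case (step m)
  have "\<exists>l r. l \<le> r \<and> s ` {1..m} = {l..r}" by (rule step.IH) (use step.prems in auto)
  then obtain l r where lr: "l \<le> r" "s ` {1..m} = {l..r}" by blast
  have "s m \<in> {l..r}" using lr(2) step.hyps by auto
  have eq: "s ` {1..Suc m} = insert (s (Suc m)) {l..r}"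
    using lr(2) by (simp add: atLeastAtMostSuc_conv)
  have "s (Suc m) = Suc (s m) \<or> s m = Suc (s (Suc m))" using step.prems[of m] step.hyps by simp
  then consider "s (Suc m) \<in> {l..r}" | "s (Suc m) = Suc r" | "Suc (s (Suc m)) = l"
    using \<open>s m \<in> {l..r}\<close> by fastforce
  then show ?case
  proof cases
    case 1
    then have "s ` {1..Suc m} = {l..r}" using eq by (simp only: insert_absorb)
    then show ?thesis using lr(1) by blast
  next
    case 2
    then have "s ` {1..Suc m} = {l..Suc r}" using eq lr(1) by auto
    then show ?thesis using lr(1) le_SucI by blast
  next
    case 3
    then have "s ` {1..Suc m} = {s (Suc m)..r}" using eq lr(1) by auto
    then show ?thesis using lr(1) 3 by (intro exI[of _ "s (Suc m)"] exI[of _ r]) auto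
  qed
qed

lemma is_path_segment:
  fixes l r :: nat
  assumes "l \<le> r"
  shows "is_path \<lparr>pverts = {l..r}, parcs = {(i, j). (j = Suc i \<or> i = Suc j) \<and> i \<in> {l..r} \<and> j \<in> {l..r}}\<rparr>"
  unfolding is_path_def digraph_iso_with_proj_iff
\<comment> \<open>There are \<open>r - l + 1\<close> vertices, and the shift is by
  \<open>l - 1\<close> because \<open>path_graph\<close> counts from 1.\<close>
proof (intro exI[of _ "Suc (r - l)"] conjI exI[of _ "\<lambda>i. i + l - 1"])
  let ?f = "\<lambda>i. i + l - 1"
  let ?n = "Suc (r - l)"
  show "wf_digraph (with_proj (path_graph ?n))" by (rule path_graph_wf)
  show "inj_on ?f (pverts (path_graph ?n))" unfolding path_graph_simps by (intro inj_onI) auto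
  have pre: "\<exists>i\<in>{1..?n}. k = ?f i" if "k \<in> {l..r}" for k
    using that by (intro bexI[of _ "Suc k - l"]) auto
  show "pverts \<lparr>pverts = {l..r}, parcs = {(i, j). (j = Suc i \<or> i = Suc j) \<and> i \<in> {l..r} \<and> j \<in> {l..r}}\<rparr> = ?f ` pverts (path_graph ?n)"
    unfolding path_graph_simps
  proof (intro set_eqI iffI)
    fix k assume "k \<in> pverts \<lparr>pverts = {l..r}, parcs = {(i, j). (j = Suc i \<or> i = Suc j) \<and> i \<in> {l..r} \<and> j \<in> {l..r}}\<rparr>"
    then show "k \<in> ?f ` {1..?n}" using pre[of k] by (simp only: pair_pre_digraph.simps image_iff)
  qed (use assms in auto)
  have "(a, b) \<in> map_prod ?f ?f ` parcs (path_graph ?n) \<longleftrightarrow> (b = Suc a \<or> a = Suc b) \<and> a \<in> {l..r} \<and> b \<in> {l..r}" for a b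
  proof
    assume "(a, b) \<in> map_prod ?f ?f ` parcs (path_graph ?n)"
    then obtain i j where "(i, j) \<in> parcs (path_graph ?n)" "a = ?f i" "b = ?f j" by auto
    then show "(b = Suc a \<or> a = Suc b) \<and> a \<in> {l..r} \<and> b \<in> {l..r}" using assms unfolding path_graph_simps by auto
  next
    assume ab: "(b = Suc a \<or> a = Suc b) \<and> a \<in> {l..r} \<and> b \<in> {l..r}"
    obtain i j where ij: "i \<in> {1..?n}" "a = ?f i" "j \<in> {1..?n}" "b = ?f j" using pre[of a] pre[of b] ab by blast
    then have "(i, j) \<in> parcs (path_graph ?n)" using ab unfolding path_graph_simps by auto
    then show "(a, b) \<in> map_prod ?f ?f ` parcs (path_graph ?n)" using ij by force
  qed
  note arcs = this
  show "parcs \<lparr>pverts = {l..r}, parcs = {(i, j). (j = Suc i \<or> i = Suc j) \<and> i \<in> {l..r} \<and> j \<in> {l..r}}\<rparr> = map_prod ?f ?f ` parcs (path_graph ?n)"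
  proof (intro set_eqI)
    fix p
    show "p \<in> parcs \<lparr>pverts = {l..r}, parcs = {(i, j). (j = Suc i \<or> i = Suc j) \<and> i \<in> {l..r} \<and> j \<in> {l..r}}\<rparr> \<longleftrightarrow> p \<in> map_prod ?f ?f ` parcs (path_graph ?n)"
      by (cases p) (simp only: arcs pair_pre_digraph.simps mem_Collect_eq prod.case)
  qed
qed simp

text \<open>Forwards, subpaths become the intervals of their positions along the host path.
  Backwards, finitely many integer intervals are translated into the vertices of a long enough
  \<open>path_graph\<close>.\<close>

lemma interval_graph_iff:
  fixes G :: "'a pair_pre_digraph"
  assumes fin: "finite (pverts G)"
  shows "interval_graph G \<longleftrightarrow> (\<exists>l r :: 'a \<Rightarrow> int. (\<forall>v\<in>pverts G. l v \<le> r v) \<and>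
    (\<forall>u\<in>pverts G. \<forall>v\<in>pverts G. u \<noteq> v \<longrightarrow> ((u, v) \<in> parcs G \<longleftrightarrow> l u \<le> r v \<and> l v \<le> r u)))"
proof
  assume "interval_graph G"
  then obtain P :: "nat pair_pre_digraph" and S :: "'a \<Rightarrow> nat pair_pre_digraph" where P: "is_path P"
    and S: "\<And>v. v \<in> pverts G \<Longrightarrow> is_path (S v) \<and> subgraph (with_proj (S v)) (with_proj P)"
    and adj: "\<And>u v. u \<in> pverts G \<Longrightarrow> v \<in> pverts G \<Longrightarrow> u \<noteq> v \<Longrightarrow> (u, v) \<in> parcs G \<longleftrightarrow> pverts (S u) \<inter> pverts (S v) \<noteq> {}"
    unfolding interval_graph_def by blast
  obtain n f where f: "inj_on f {1..n}" "pverts P = f ` {1..n}" "parcs P = map_prod f f ` parcs (path_graph n)"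
    using P unfolding is_path_def digraph_iso_with_proj_iff path_graph_simps by blast
  \<comment> \<open>\<open>g\<close> numbers the vertices of the host path from 1 to
    \<open>n\<close>; consecutive vertices of a subpath get numbers differing by one.\<close>
  define g where "g = the_inv_into {1..n} f"
  have gf: "g (f i) = i" if "i \<in> {1..n}" for i unfolding g_def using the_inv_into_f_f[OF f(1) that] .
  have ginj: "inj_on g (pverts P)" unfolding f(2) by (intro inj_onI) (auto simp: gf)
  have seg: "\<exists>l r :: nat. l \<le> r \<and> g ` pverts (S v) = {l..r}" if v: "v \<in> pverts G" for v
  proof -
    obtain m k where m: "1 \<le> m" and k: "pverts (S v) = k ` {1..m}" "parcs (S v) = map_prod k k ` parcs (path_graph m)"
      using S[OF v] unfolding is_path_def digraph_iso_with_proj_iff path_graph_simps by blast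
    have "parcs (S v) \<subseteq> parcs P" using S[OF v] unfolding subgraph_def by simp
    have "g (k (Suc i)) = Suc (g (k i)) \<or> g (k i) = Suc (g (k (Suc i)))" if i: "1 \<le> i" "i < m" for i
    proof -
      have "(i, Suc i) \<in> parcs (path_graph m)" using i unfolding path_graph_simps by simp
      then have "map_prod k k (i, Suc i) \<in> parcs (S v)" unfolding k(2) by (rule imageI)
      then have "(k i, k (Suc i)) \<in> map_prod f f ` parcs (path_graph n)"
        using \<open>parcs (S v) \<subseteq> parcs P\<close> f(3) by auto
      then obtain a b where ab: "k i = f a" "k (Suc i) = f b" "(a, b) \<in> parcs (path_graph n)" by auto
      then show ?thesis using gf[of a] gf[of b] unfolding path_graph_simps by auto
    qed
    then have "\<exists>l r :: nat. l \<le> r \<and> (g \<circ> k) ` {1..m} = {l..r}" using unit_steps_image[OF m, of "g \<circ> k"] by simp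
    then show ?thesis unfolding k(1) image_comp .
  qed
  then obtain l r where lr: "\<And>v. v \<in> pverts G \<Longrightarrow> l v \<le> r v \<and> g ` pverts (S v) = {l v..r v}" by metis
  have sub: "pverts (S v) \<subseteq> pverts P" if "v \<in> pverts G" for v using S[OF that] unfolding subgraph_def by simp
  have "(u, v) \<in> parcs G \<longleftrightarrow> int (l u) \<le> int (r v) \<and> int (l v) \<le> int (r u)"
    if uv: "u \<in> pverts G" "v \<in> pverts G" "u \<noteq> v" for u v
  proof -
    have "pverts (S u) \<inter> pverts (S v) \<noteq> {} \<longleftrightarrow> g ` pverts (S u) \<inter> g ` pverts (S v) \<noteq> {}"
      using inj_on_image_Int[OF ginj sub[OF uv(1)] sub[OF uv(2)]] by (metis image_is_empty)
    also have "\<dots> \<longleftrightarrow> {l u..r u} \<inter> {l v..r v} \<noteq> {}" using lr uv by simp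
    also have "\<dots> \<longleftrightarrow> l u \<le> r v \<and> l v \<le> r u" using lr[OF uv(1)] lr[OF uv(2)] by (auto simp: Int_atLeastAtMost)
    finally show ?thesis using adj[OF uv] by simp
  qed
  then show "\<exists>l r :: 'a \<Rightarrow> int. (\<forall>v\<in>pverts G. l v \<le> r v) \<and>
    (\<forall>u\<in>pverts G. \<forall>v\<in>pverts G. u \<noteq> v \<longrightarrow> ((u, v) \<in> parcs G \<longleftrightarrow> l u \<le> r v \<and> l v \<le> r u))"
    using lr by (intro exI[of _ "\<lambda>v. int (l v)"] exI[of _ "\<lambda>v. int (r v)"]) simp
next
  assume "\<exists>l r :: 'a \<Rightarrow> int. (\<forall>v\<in>pverts G. l v \<le> r v) \<and>
    (\<forall>u\<in>pverts G. \<forall>v\<in>pverts G. u \<noteq> v \<longrightarrow> ((u, v) \<in> parcs G \<longleftrightarrow> l u \<le> r v \<and> l v \<le> r u))"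
  then obtain l r :: "'a \<Rightarrow> int" where lr: "\<And>v. v \<in> pverts G \<Longrightarrow> l v \<le> r v"
    and adj: "\<And>u v. u \<in> pverts G \<Longrightarrow> v \<in> pverts G \<Longrightarrow> u \<noteq> v \<Longrightarrow> (u, v) \<in> parcs G \<longleftrightarrow> l u \<le> r v \<and> l v \<le> r u"
    by blast
  have "bdd_below (l ` pverts G)" "bdd_above (r ` pverts G)" using fin by auto
  then obtain m M where m: "\<And>v. v \<in> pverts G \<Longrightarrow> m \<le> l v" and M: "\<And>v. v \<in> pverts G \<Longrightarrow> r v \<le> M"
    unfolding bdd_below_def bdd_above_def by auto
  \<comment> \<open>Subtracting the lower bound \<open>m\<close> makes the values natural, and
    \<open>Suc\<close> starts them at 1, as in \<open>path_graph\<close>.\<close>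
  define l' where "l' v = Suc (nat (l v - m))" for v
  define r' where "r' v = Suc (nat (r v - m))" for v
  define N where "N = Suc (nat (M - m))"
  have lr': "1 \<le> l' v" "l' v \<le> r' v" "r' v \<le> N" if "v \<in> pverts G" for v
    using lr[OF that] m[OF that] M[OF that] unfolding l'_def r'_def N_def by auto
  define S where "S v = \<lparr>pverts = {l' v..r' v}, parcs = {(i, j). (j = Suc i \<or> i = Suc j) \<and> i \<in> {l' v..r' v} \<and> j \<in> {l' v..r' v}}\<rparr>" for v
  have "is_path (path_graph N)"
    unfolding is_path_def digraph_iso_with_proj_iff
    by (intro exI[of _ N] conjI exI[of _ id] path_graph_wf) (auto simp: N_def map_prod.id)
  moreover have "is_path (S v)" "subgraph (with_proj (S v)) (with_proj (path_graph N))" if v: "v \<in> pverts G" for v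
  proof -
    show "is_path (S v)" unfolding S_def using is_path_segment[OF lr'(2)[OF v]] .
    have "wf_digraph (with_proj (S v))"
      unfolding wf_digraph_wp_iff by unfold_locales (auto simp: S_def)
    then show "subgraph (with_proj (S v)) (with_proj (path_graph N))"
      unfolding subgraph_def using lr'[OF v] path_graph_wf
      by (auto simp: S_def path_graph_simps)
  qed
  moreover have "(u, v) \<in> parcs G \<longleftrightarrow> pverts (S u) \<inter> pverts (S v) \<noteq> {}"
    if uv: "u \<in> pverts G" "v \<in> pverts G" "u \<noteq> v" for u v
  proof -
    have "pverts (S u) \<inter> pverts (S v) \<noteq> {} \<longleftrightarrow> l' u \<le> r' v \<and> l' v \<le> r' u"
      using lr'[OF uv(1)] lr'[OF uv(2)] unfolding S_def by (auto simp: Int_atLeastAtMost)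
    also have "\<dots> \<longleftrightarrow> l u \<le> r v \<and> l v \<le> r u"
      using m[OF uv(1)] m[OF uv(2)] lr[OF uv(1)] lr[OF uv(2)] unfolding l'_def r'_def by auto
    finally show ?thesis using adj[OF uv] by simp
  qed
  ultimately show "interval_graph G" unfolding interval_graph_def
    by (intro exI[of _ "path_graph N"] exI[of _ S]) blast
qed

subsection \<open>Balls and apex vertices\<close>

text \<open>The centre is at distance at most 1 from each vertex of the ball, so the sum of two
  distances is at most 2 and the bound 3 excludes no edge.\<close>

lemma parcs_ball_three_halves:
  assumes G: "pair_graph G" and v: "v \<in> pverts G"
    and xy: "x \<in> pverts (ball_three_halves G v)" "y \<in> pverts (ball_three_halves G v)"
  shows "(x, y) \<in> parcs (ball_three_halves G v) \<longleftrightarrow> (x, y) \<in> parcs G"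
proof -
  interpret pair_graph G by (rule G)
  have le: "graph_dist G v x \<le> 1" if "x \<in> pverts (ball_three_halves G v)" for x
  proof (cases "x = v")
    case True
    have "awalk v [] v" using v by (simp add: awalk_Nil_iff)
    then have "\<mu> (\<lambda>_. 1) v v \<le> awalk_cost (\<lambda>_. 1) []" by (rule min_cost_le_walk_cost)
    then show ?thesis using True unfolding graph_dist_def by (simp add: order_trans)
  next
    case False
    then have e: "(v, x) \<in> parcs G" using that unfolding ball_three_halves_def by simp
    then have "awalk v [(v, x)] x" using in_arcsD2[OF e] v by (simp add: awalk_simps)
    then have "\<mu> (\<lambda>_. 1) v x \<le> awalk_cost (\<lambda>_. 1) [(v, x)]" by (rule min_cost_le_walk_cost)
    then show ?thesis unfolding graph_dist_def by (simp add: one_ereal_def)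
  qed
  have "graph_dist G v x + graph_dist G v y \<le> 1 + 1" using le[OF xy(1)] le[OF xy(2)] by (rule add_mono)
  also have "(1 + 1 :: ereal) < 3" by (simp add: one_ereal_def numeral_eq_ereal)
  finally show ?thesis unfolding ball_three_halves_def by simp
qed

text \<open>The subgraph \<open>H\<close> is the image of \<open>F\<close>. Well-formedness puts the
  ends of arcs of \<open>F\<close> among its vertices, where \<open>f\<close> is injective, so no
  arc of \<open>H\<close> can come from a different pair.\<close>

lemma has_induced_iff:
  fixes G :: "'a pair_pre_digraph" and F :: "'b pair_pre_digraph"
  assumes G: "pair_graph G" and F: "wf_digraph (with_proj F)"
  shows "has_induced G F \<longleftrightarrow> sgraph.embeds (\<lambda>x y. (x, y) \<in> parcs G) (pverts G) F"
proof -
  interpret pair_graph G by (rule G)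
  interpret sgraph "\<lambda>x y. (x, y) \<in> parcs G"
    by unfold_locales (auto intro: arcs_symmetric dest: no_loops')
  have sub: "parcs F \<subseteq> pverts F \<times> pverts F"
    using F unfolding wf_digraph_wp_iff pair_wf_digraph_def by auto
  show ?thesis
  proof
    assume "has_induced G F"
    then obtain H :: "'a pair_pre_digraph" and f where H: "induced_subgraph (with_proj H) (with_proj G)"
      and f: "inj_on f (pverts F)" "pverts H = f ` pverts F" "parcs H = map_prod f f ` parcs F"
      unfolding has_induced_def digraph_iso_with_proj_iff by blast
    have H': "pverts H \<subseteq> pverts G" "parcs H = {e \<in> parcs G. fst e \<in> pverts H \<and> snd e \<in> pverts H}"
      using H unfolding induced_subgraph_def subgraph_def by simp_all
    have "(x, y) \<in> parcs F \<longleftrightarrow> (f x, f y) \<in> parcs G" if xy: "x \<in> pverts F" "y \<in> pverts F" for x y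
    proof -
      have "(f x, f y) \<in> parcs G \<longleftrightarrow> (f x, f y) \<in> parcs H" using H'(2) f(2) xy by simp
      also have "\<dots> \<longleftrightarrow> (x, y) \<in> parcs F"
      proof
        assume "(f x, f y) \<in> parcs H"
        then obtain x' y' where *: "(x', y') \<in> parcs F" "f x = f x'" "f y = f y'" unfolding f(3) by auto
        then have "x = x'" "y = y'" using f(1) xy sub unfolding inj_on_def by blast+
        then show "(x, y) \<in> parcs F" using * by simp
      next
        assume "(x, y) \<in> parcs F"
        then show "(f x, f y) \<in> parcs H" unfolding f(3) by force
      qed
      finally show ?thesis by simp
    qed
    then show "embeds (pverts G) F" unfolding embeds_def using f(1,2) H'(1) by blast
  next
    assume "embeds (pverts G) F"
    then obtain f where f: "inj_on f (pverts F)" "f ` pverts F \<subseteq> pverts G"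
      "\<And>x y. x \<in> pverts F \<Longrightarrow> y \<in> pverts F \<Longrightarrow> (x, y) \<in> parcs F \<longleftrightarrow> (f x, f y) \<in> parcs G"
      unfolding embeds_def by blast
    define H where "H = \<lparr>pverts = f ` pverts F, parcs = map_prod f f ` parcs F\<rparr>"
    have arcs: "parcs H = {e \<in> parcs G. fst e \<in> pverts H \<and> snd e \<in> pverts H}"
    proof (intro set_eqI iffI)
      fix e assume "e \<in> parcs H"
      then obtain x y where "(x, y) \<in> parcs F" "e = (f x, f y)" unfolding H_def by auto
      then show "e \<in> {e \<in> parcs G. fst e \<in> pverts H \<and> snd e \<in> pverts H}"
        using f(3) sub unfolding H_def by auto
    next
      fix e assume "e \<in> {e \<in> parcs G. fst e \<in> pverts H \<and> snd e \<in> pverts H}"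
      then obtain x y where "x \<in> pverts F" "y \<in> pverts F" "e = (f x, f y)" "e \<in> parcs G"
        unfolding H_def by (cases e) auto
      then show "e \<in> parcs H" using f(3)[of x y] unfolding H_def by force
    qed
    have "wf_digraph (with_proj H)"
      unfolding wf_digraph_wp_iff by unfold_locales (auto simp: arcs)
    moreover have "wf_digraph (with_proj G)" unfolding wf_digraph_wp_iff by unfold_locales
    moreover have "pverts H \<subseteq> pverts G" unfolding H_def using f(2) by simp
    moreover have "parcs H \<subseteq> parcs G" using arcs by blast
    ultimately have "induced_subgraph (with_proj H) (with_proj G)"
      unfolding induced_subgraph_def subgraph_def using arcs by auto
    moreover have "digraph_iso (with_proj F) (with_proj H)"
      unfolding digraph_iso_with_proj_iff using F f(1) H_def by auto
    ultimately show "has_induced G F" unfolding has_induced_def by blast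
  qed
qed

lemma wf_undirected: "E \<subseteq> V \<times> V \<Longrightarrow> wf_digraph (with_proj (undirected V E))"
  unfolding wf_digraph_wp_iff by unfold_locales (auto simp: undirected_def)

text \<open>\<open>undirected\<close> adds all reversed arcs, so the arcs between
  \<open>Some\<close> vertices are exactly those of \<open>F\<close> only when \<open>F\<close> is
  symmetric.\<close>

lemma add_apex_simps:
  assumes "Relation.sym (parcs F)"
  shows "pverts (add_apex F) = insert None (Some ` pverts F)"
    "(None, Some x) \<in> parcs (add_apex F) \<longleftrightarrow> x \<in> pverts F" "(Some x, None) \<in> parcs (add_apex F) \<longleftrightarrow> x \<in> pverts F"
    "(Some x, Some y) \<in> parcs (add_apex F) \<longleftrightarrow> (x, y) \<in> parcs F" "(None, None) \<notin> parcs (add_apex F)"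
  unfolding add_apex_def undirected_def using assms by (auto simp: image_iff dest: symD; force)+

text \<open>The image of the apex \<open>None\<close> is the vertex \<open>v\<close>, and the copy
  of \<open>F\<close> then lies in its neighbourhood.\<close>

lemma (in sgraph) embeds_add_apex:
  assumes F: "Relation.sym (parcs F)"
  shows "embeds V (add_apex F) \<longleftrightarrow> (\<exists>v\<in>V. embeds {x \<in> V. adj v x} F)"
proof
  note A = add_apex_simps[OF F]
  assume "embeds V (add_apex F)"
  then obtain f where f: "inj_on f (pverts (add_apex F))" "f ` pverts (add_apex F) \<subseteq> V"
    "\<And>x y. x \<in> pverts (add_apex F) \<Longrightarrow> y \<in> pverts (add_apex F) \<Longrightarrow> (x, y) \<in> parcs (add_apex F) \<longleftrightarrow> adj (f x) (f y)"
    unfolding embeds_def by blast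
  have "embeds {x \<in> V. adj (f None) x} F"
    unfolding embeds_def
  proof (intro exI[of _ "f \<circ> Some"] conjI ballI)
    show "inj_on (f \<circ> Some) (pverts F)" using f(1)[unfolded A(1)] by (auto simp: inj_on_def)
    show "(f \<circ> Some) ` pverts F \<subseteq> {x \<in> V. adj (f None) x}"
    proof
      fix y assume "y \<in> (f \<circ> Some) ` pverts F"
      then obtain x where x: "x \<in> pverts F" "y = f (Some x)" by auto
      then have "Some x \<in> pverts (add_apex F)" "None \<in> pverts (add_apex F)" unfolding A(1) by simp_all
      then show "y \<in> {x \<in> V. adj (f None) x}" using f(2) f(3)[of None "Some x"] A(2)[of x] x by blast
    qed
    show "((x, y) \<in> parcs F) = adj ((f \<circ> Some) x) ((f \<circ> Some) y)" if "x \<in> pverts F" "y \<in> pverts F" for x y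
      using f(3)[of "Some x" "Some y"] A(1,4) that by simp
  qed
  then show "\<exists>v\<in>V. embeds {x \<in> V. adj v x} F" using f(2) A(1) by auto
next
  note A = add_apex_simps[OF F]
  assume "\<exists>v\<in>V. embeds {x \<in> V. adj v x} F"
  then obtain v where v: "v \<in> V" and e: "embeds {x \<in> V. adj v x} F" by blast
  from e obtain f where f: "inj_on f (pverts F)" "f ` pverts F \<subseteq> {x \<in> V. adj v x}"
    "\<And>x y. x \<in> pverts F \<Longrightarrow> y \<in> pverts F \<Longrightarrow> (x, y) \<in> parcs F \<longleftrightarrow> adj (f x) (f y)"
    unfolding embeds_def by blast
  have fx: "f x \<in> V" "adj v (f x)" "adj (f x) v" "f x \<noteq> v" "v \<noteq> f x" if "x \<in> pverts F" for x
  proof -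
    have *: "f x \<in> V" "adj v (f x)" using f(2) that by blast+
    then have "v \<noteq> f x" using irrefl[of v] by metis
    then show "f x \<in> V" "adj v (f x)" "adj (f x) v" "f x \<noteq> v" "v \<noteq> f x" using * sym[of v "f x"] by auto
  qed
  show "embeds V (add_apex F)"
    unfolding embeds_def
  proof (intro exI[of _ "case_option v f"] conjI ballI)
    show "inj_on (case_option v f) (pverts (add_apex F))"
      using f(1) fx(4,5) unfolding A(1) inj_on_def by auto
    show "case_option v f ` pverts (add_apex F) \<subseteq> V" using v fx(1) A(1) by auto
    fix x y assume "x \<in> pverts (add_apex F)" "y \<in> pverts (add_apex F)"
    then show "((x, y) \<in> parcs (add_apex F)) = adj (case_option v f x) (case_option v f y)"
      using f(3) fx irrefl A by (cases x; cases y) auto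
  qed
qed

lemma add_apex_wf: "wf_digraph (with_proj F) \<Longrightarrow> wf_digraph (with_proj (add_apex F))"
  unfolding add_apex_def
  by (rule wf_undirected) (auto simp: wf_digraph_wp_iff pair_wf_digraph_def)

lemma undirected_sym: "sym (parcs (undirected V E))"
  unfolding undirected_def sym_def by auto

lemma obstruction_sym:
  "sym (parcs (cycle_graph n))" "sym (parcs long_claw)" "sym (parcs whipping_top)"
  "sym (parcs (dagger n))" "sym (parcs (ddagger n))"
  unfolding cycle_graph_def long_claw_def whipping_top_def dagger_def ddagger_def by (rule undirected_sym)+

text \<open>For \<open>n = 0\<close> the arcs at \<open>Dag_p\<close> and \<open>Dag_q\<close> would
  lead to path vertices that do not exist, hence the condition for \<open>dagger\<close>.\<close>

lemma obstruction_wf: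
  "wf_digraph (with_proj (cycle_graph n))" "wf_digraph (with_proj long_claw)" "wf_digraph (with_proj whipping_top)"
  "1 \<le> n \<Longrightarrow> wf_digraph (with_proj (dagger n))" "wf_digraph (with_proj (ddagger n))"
proof -
  show "wf_digraph (with_proj (cycle_graph n))"
    unfolding cycle_graph_def by (rule wf_undirected) auto
  show "wf_digraph (with_proj long_claw)"
    unfolding long_claw_def by (rule wf_undirected) auto
  show "wf_digraph (with_proj whipping_top)"
    unfolding whipping_top_def by (rule wf_undirected) auto
  show "wf_digraph (with_proj (dagger n))" if "1 \<le> n"
  proof -
    have "Dag_v i \<in> Dag_v ` {1..n} \<longleftrightarrow> i \<in> {1..n}" for i by (rule inj_image_mem_iff) (simp add: inj_def)
    then show ?thesis
      unfolding dagger_def by (intro wf_undirected subsetI) (elim UnE insertE CollectE exE conjE emptyE; use that in simp)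
  qed
  have le: "i \<le> n" if "i \<le> n - Suc 0" for i using that by simp
  have "DDag_x i \<in> DDag_x ` {1..n} \<longleftrightarrow> i \<in> {1..n}" for i by (rule inj_image_mem_iff) (simp add: inj_def)
  then show "wf_digraph (with_proj (ddagger n))"
    unfolding ddagger_def
    by (intro wf_undirected subsetI) (elim UnE insertE CollectE exE conjE emptyE; simp add: le)
qed

lemma sgraph_of_pair_graph: "pair_graph G \<Longrightarrow> sgraph (\<lambda>x y. (x, y) \<in> parcs G)"
proof -
  assume "pair_graph G"
  then interpret pair_graph G .
  show "sgraph (\<lambda>x y. (x, y) \<in> parcs G)"
    by unfold_locales (auto intro: arcs_symmetric dest: no_loops')
qed

lemma has_induced_add_apex_iff:
  assumes "pair_graph G" "wf_digraph (with_proj F)" "Relation.sym (parcs F)"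
  shows "has_induced G (add_apex F) \<longleftrightarrow>
    (\<exists>v\<in>pverts G. sgraph.embeds (\<lambda>x y. (x, y) \<in> parcs G) {x \<in> pverts G. (v, x) \<in> parcs G} F)"
  using has_induced_iff[OF assms(1) add_apex_wf[OF assms(2)]]
    sgraph.embeds_add_apex[OF sgraph_of_pair_graph[OF assms(1)] assms(3)] by blast

theorem theorem2:
  fixes G :: "'a pair_pre_digraph"
  assumes "pair_graph G"
  shows "three_locally_interval G \<longleftrightarrow>
    wheel_free G \<and>
    \<not> has_induced G (add_apex long_claw) \<and>
    \<not> has_induced G (add_apex whipping_top) \<and>
    (\<forall>k\<ge>2. \<not> has_induced G (add_apex (dagger k))) \<and>
    (\<forall>n\<ge>3. \<not> has_induced G (add_apex (ddagger n)))"
proof -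
  interpret pair_graph G by (rule assms)
  let ?V = "pverts G"
  interpret sgraph "\<lambda>x y. (x, y) \<in> parcs G"
    by unfold_locales (auto intro: arcs_symmetric dest: no_loops')
  let ?N = "\<lambda>v. {x \<in> ?V. (v, x) \<in> parcs G}"
  have fin: "finite (?N v)" for v using pair_finite_verts by simp
  \<comment> \<open>The ball is the neighbourhood with the centre as a universal vertex, and
    \<open>interval_insert_universal\<close> removes the centre.\<close>
  have ball: "interval_graph (ball_three_halves G v) \<longleftrightarrow> interval (?N v)" if v: "v \<in> ?V" for v
  proof -
    have B: "pverts (ball_three_halves G v) = insert v (?N v)"
      unfolding ball_three_halves_def using in_arcsD2 by auto
    have "interval_graph (ball_three_halves G v) \<longleftrightarrow> interval (insert v (?N v))"
      unfolding interval_def is_rep_def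
      using interval_graph_iff[of "ball_three_halves G v"] parcs_ball_three_halves[OF assms v] fin[of v] unfolding B by simp
    then show ?thesis using interval_insert_universal[OF fin, of v v] by simp
  qed
  note apex = has_induced_add_apex_iff[OF assms]
  have cyc: "has_induced G (wheel n) \<longleftrightarrow> (\<exists>v\<in>?V. embeds (?N v) (cycle_graph n))" for n
    unfolding wheel_def by (rule apex[OF obstruction_wf(1) obstruction_sym(1)])
  have lc: "has_induced G (add_apex long_claw) \<longleftrightarrow> (\<exists>v\<in>?V. embeds (?N v) long_claw)"
    by (rule apex[OF obstruction_wf(2) obstruction_sym(2)])
  have wt: "has_induced G (add_apex whipping_top) \<longleftrightarrow> (\<exists>v\<in>?V. embeds (?N v) whipping_top)"
    by (rule apex[OF obstruction_wf(3) obstruction_sym(3)])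
  have dag: "has_induced G (add_apex (dagger k)) \<longleftrightarrow> (\<exists>v\<in>?V. embeds (?N v) (dagger k))" if "2 \<le> k" for k
    by (rule apex[OF obstruction_wf(4) obstruction_sym(4)]) (use that in simp)
  have ddag: "has_induced G (add_apex (ddagger n)) \<longleftrightarrow> (\<exists>v\<in>?V. embeds (?N v) (ddagger n))" for n
    by (rule apex[OF obstruction_wf(5) obstruction_sym(5)])
  \<comment> \<open>Each forbidden graph with an apex amounts to a forbidden graph in some
    neighbourhood, so the claim is \<open>lekkerkerker_boland\<close> for every
    \<open>?N v\<close>.\<close>
  have "three_locally_interval G \<longleftrightarrow>
    (\<forall>v\<in>?V. (\<forall>n\<ge>4. \<not> embeds (?N v) (cycle_graph n)) \<and> \<not> obstructed (?N v))"
    unfolding three_locally_interval_def using ball lekkerkerker_boland[OF fin] by simp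
  then show ?thesis
    unfolding wheel_free_def obstructed_def cyc lc wt ddag using dag by blast
qed

end
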